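(* Let $(A,\cdot,[\cdot,\cdot,\cdot])$ be a (finite-dimensional) Poisson 3-Lie algebra over a field $\mathbb F$ of characteristic zero and let $(A,\Delta,\delta)$ be a Poisson 3-Lie coalgebra on the same vector space $A$. Let $(A^*,\circ,[\cdot,\cdot,\cdot]^* )$ be the Poisson 3-Lie algebra on the dual space with $\circ=\Delta^*$ and $[\cdot,\cdot,\cdot]^*=\delta^*$. Then the following statements are equivalent: (a) $(A,\cdot,[\cdot,\cdot,\cdot],\Delta,\delta)$ is a double construction Poisson 3-Lie bialgebra; (b) $(A,A^*,\mathrm{ad}^*,-\mathcal L^*,\mathfrak{ad}^*,-L^* )$ is a matched pair of Poisson 3-Lie algebras; (c) $\big((A\oplus A^*,\mathcal B),A,A^*\big)$ is a standard Manin triple of Poisson 3-Lie algebras.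
   Context: All vector spaces are finite-dimensional over a field $\mathbb F$ of characteristic zero; no unit is assumed in algebras; $\langle\cdot,\cdot\rangle$ is the pairing between a space and its dual (extended factorwise to tensor powers), and $(A^* )^*=A$. 3-Lie algebra: vector space with a skew-symmetric trilinear bracket satisfying $[x_1,x_2,[x_3,x_4,x_5]]=[[x_1,x_2,x_3],x_4,x_5]+[x_3,[x_1,x_2,x_4],x_5]+[x_3,x_4,[x_1,x_2,x_5]]$. Poisson 3-Lie algebra $(A,\cdot,[\cdot,\cdot,\cdot])$: $(A,\cdot)$ commutative associative, $(A,[\cdot,\cdot,\cdot])$ a 3-Lie algebra, and $[w\cdot x,y,z]=w\cdot[x,y,z]+x\cdot[w,y,z]$. Representations. A representation of a commutative associative algebra $(A,\cdot)$ on $V$: linear $\mu:A\to\mathfrak{gl}(V)$ with $\mu(x\cdot y)=\mu(x)\mu(y)$. A representation of a 3-Lie algebra on $V$: a skew-symmetric linear $\rho:\otimes^2A\to\mathfrak{gl}(V)$ with $\rho(x_1,x_2)\rho(x_3,x_4)-\rho(x_3,x_4)\rho(x_1,x_2)=\rho([x_1,x_2,x_3],x_4)-\rho([x_1,x_2,x_4],x_3)$ and $\rho([x_1,x_2,x_3],x_4)=\rho(x_1,x_2)\rho(x_3,x_4)+\rho(x_2,x_3)\rho(x_1,x_4)+\rho(x_3,x_1)\rho(x_2,x_4)$. A representation $(V,\rho,\mu)$ of a Poisson 3-Lie algebra: both of these together with $\rho(x\cdot y,z)=\mu(x)\rho(y,z)+\mu(y)\rho(x,z)$ and $\rho(x,y)\mu(z)=\mu([x,y,z])+\mu(z)\rho(x,y)$.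 Duals: $\langle\rho^*(x_1,x_2)\xi,v\rangle=-\langle\xi,\rho(x_1,x_2)v\rangle$, $\langle\mu^*(x)\xi,v\rangle=-\langle\xi,\mu(x)v\rangle$. On $A$: $\mathrm{ad}_{x,y}z=[x,y,z]$, $\mathcal L(x)y=\mathcal L_x y=x\cdot y$. On $A^*$: $\mathfrak{ad}_{\xi,\eta}\zeta=[\xi,\eta,\zeta]^*$, $L(\xi)\eta=\xi\circ\eta$. So $\mathrm{ad}^*:\otimes^2A\to\mathfrak{gl}(A^* )$, $\mathcal L^*:A\to\mathfrak{gl}(A^* )$, $\mathfrak{ad}^*:\otimes^2A^*\to\mathfrak{gl}(A)$, $L^*:A^*\to\mathfrak{gl}(A)$. Matched pair of commutative associative algebras $(A,B,\mu_A,\mu_B)$: $(B,\mu_A)$, $(A,\mu_B)$ are representations of $(A,\cdot_A)$, $(B,\cdot_B)$ and, for $x,y\in A$, $a,b\in B$, $\mu_A(x)(a\cdot_Bb)=(\mu_A(x)a)\cdot_Bb+\mu_A(\mu_B(a)x)b$ and $\mu_B(a)(x\cdot_Ay)=(\mu_B(a)x)\cdot_Ay+\mu_B(\mu_A(x)a)y$. Matched pair of 3-Lie algebras $(A,B,\rho_A,\rho_B)$: $(B,\rho_A)$, $(A,\rho_B)$ are representations of the 3-Lie algebras $A$, $B$ and for $x_i\in A$, $y_i\in B$: $\rho_B(y_4,y_5)[x_1,x_2,x_3]_A=[\rho_B(y_4,y_5)x_1,x_2,x_3]_A+[x_1,\rho_B(y_4,y_5)x_2,x_3]_A+[x_1,x_2,\rho_B(y_4,y_5)x_3]_A$;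 $-\rho_B(\rho_A(x_1,x_2)y_3,y_5)x_4=-\rho_B(\rho_A(x_1,x_4)y_5,y_3)x_2+\rho_B(\rho_A(x_2,x_4)y_5,y_3)x_1-[x_1,x_2,\rho_B(y_3,y_5)x_4]_A$; $[\rho_B(y_2,y_3)x_1,x_4,x_5]_A=\rho_B(y_2,y_3)[x_1,x_4,x_5]_A+\rho_B(\rho_A(x_4,x_5)y_2,y_3)x_1+\rho_B(y_2,\rho_A(x_4,x_5)y_3)x_1$; and the three identities obtained by exchanging the roles of $A$ and $B$ (i.e. $x\leftrightarrow y$, $A\leftrightarrow B$). Matched pair of Poisson 3-Lie algebras $(A,B,\rho_A,\mu_A,\rho_B,\mu_B)$ ($A,B$ Poisson 3-Lie algebras): $(A,B,\mu_A,\mu_B)$ is a matched pair of commutative associative algebras, $(A,B,\rho_A,\rho_B)$ is a matched pair of 3-Lie algebras, $(B,\rho_A,\mu_A)$ and $(A,\rho_B,\mu_B)$ are representations of the Poisson 3-Lie algebras $A$ and $B$, and for $x_i\in A,y_i\in B$: $[\mu_B(y_1)x_1,x_2,x_3]_A=\mu_B(\rho_A(x_2,x_3)y_1)x_1+\mu_B(y_1)[x_1,x_2,x_3]_A$; $[\mu_A(x_1)y_1,y_2,y_3]_B=\mu_A(\rho_B(y_2,y_3)x_1)y_1+\mu_A(x_1)[y_1,y_2,y_3]_B$; $\rho_B(\mu_A(x_1)y_1,y_2)x_2=x_1\cdot_A(\rho_B(y_1,y_2)x_2)$; $\rho_A(\mu_B(y_1)x_1,x_2)y_2=y_1\cdot_B(\rho_A(x_1,x_2)y_2)$;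 $\mu_B(\rho_A(x_1,x_2)y_1)x_3+\mu_B(\rho_A(x_3,x_2)y_1)x_1=0$; $\mu_A(\rho_B(y_1,y_2)x_1)y_3+\mu_A(\rho_B(y_3,y_2)x_1)y_1=0$; $\rho_B(y_3,y_4)(x_1\cdot_Ax_2)=x_1\cdot_A(\rho_B(y_3,y_4)x_2)+x_2\cdot_A(\rho_B(y_3,y_4)x_1)$; $\rho_A(x_3,x_4)(y_1\cdot_By_2)=y_1\cdot_B(\rho_A(x_3,x_4)y_2)+y_2\cdot_B(\rho_A(x_3,x_4)y_1)$. Coalgebras. $\Delta^*:A^*\otimes A^*\to A^*$ and $\delta^*:\otimes^3A^*\to A^*$ are the transposes of $\Delta:A\to A\otimes A$ and $\delta:A\to\otimes^3A$. $\tau_{ij}$ swaps the $i$-th and $j$-th tensor factors, $\tau$ is the flip on $A\otimes A$. Cocommutative coassociative coalgebra: $\tau\Delta=\Delta$, $(\Delta\otimes1)\Delta=(1\otimes\Delta)\Delta$. 3-Lie coalgebra $(A,\delta)$: $\delta^*$ is skew-symmetric and $(\delta\otimes1\otimes1)\delta(x)+\tau_{23}\tau_{12}((1\otimes\delta\otimes1)\delta(x))+\tau_{13}\tau_{24}((1\otimes1\otimes\delta)\delta(x))=(1\otimes1\otimes\delta)\delta(x)$ (equivalently, $\delta^*$ is a 3-Lie bracket on $A^*$). Poisson 3-Lie coalgebra $(A,\Delta,\delta)$: $(A,\Delta)$ cocommutative coassociative, $(A,\delta)$ a 3-Lie coalgebra, and $(\Delta\otimes1\otimes1)\delta(x)=(1\otimes\delta)\Delta(x)+(\tau_{12}\otimes1\otimes1)(1\otimes\delta)\Delta(x)$;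 then $(A^*,\Delta^*,\delta^* )$ is a Poisson 3-Lie algebra. Bialgebras. Commutative and cocommutative infinitesimal bialgebra $(A,\cdot,\Delta)$: $(A,\cdot)$ commutative associative, $(A,\Delta)$ cocommutative coassociative, $\Delta(x\cdot y)=(\mathcal L_x\otimes1)\Delta(y)+(1\otimes\mathcal L_y)\Delta(x)$. Double construction 3-Lie bialgebra $(A,[\cdot,\cdot,\cdot],\delta)$: a 3-Lie algebra and 3-Lie coalgebra with $\delta([x,y,z])=(1\otimes1\otimes\mathrm{ad}_{y,z})\delta(x)+(1\otimes1\otimes\mathrm{ad}_{z,x})\delta(y)+(1\otimes1\otimes\mathrm{ad}_{x,y})\delta(z)$ and $\delta([x,y,z])=(1\otimes1\otimes\mathrm{ad}_{y,z})\delta(x)+(1\otimes\mathrm{ad}_{y,z}\otimes1)\delta(x)+(\mathrm{ad}_{y,z}\otimes1\otimes1)\delta(x)$. Double construction Poisson 3-Lie bialgebra $(A,\cdot,[\cdot,\cdot,\cdot],\Delta,\delta)$: a Poisson 3-Lie algebra and Poisson 3-Lie coalgebra such that $(A,[\cdot,\cdot,\cdot],\delta)$ is a double construction 3-Lie bialgebra, $(A,\cdot,\Delta)$ is a commutative and cocommutative infinitesimal bialgebra, and for all $x,y,z\in A$: $\Delta([x,y,z])=(1\otimes\mathrm{ad}_{y,z})\Delta(x)+(\mathrm{ad}_{y,z}\otimes1)\Delta(x)$; $\delta(x\cdot y)=(\mathcal L(y)\otimes1\otimes1)\delta(x)+(\mathcal L(x)\otimes1\otimes1)\delta(y)$; $(\mathcal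 L(x)\otimes1\otimes1)\delta(y)=(1\otimes1\otimes\mathcal L(x))\delta(y)$; $(1\otimes\mathrm{ad}_{x,y})\Delta(z)=(1\otimes\mathrm{ad}_{y,z})\Delta(x)$. Manin triples. A bilinear form $\mathcal B$ on a Poisson 3-Lie algebra is invariant if $\mathcal B(x\cdot y,z)=\mathcal B(x,y\cdot z)$ and $\mathcal B([x,y,z],u)=-\mathcal B([x,y,u],z)$. A Manin triple $((P,\mathcal B),A_1,A_2)$ of Poisson 3-Lie algebras: $P$ is a Poisson 3-Lie algebra with nondegenerate symmetric invariant bilinear form $\mathcal B$; $A_1,A_2$ are Poisson 3-Lie subalgebras isotropic for $\mathcal B$ ($\mathcal B|_{A_i\times A_i}=0$); $P=A_1\oplus A_2$ as vector spaces; and $\mathrm{pr}_1[x_1,y_1,x_2]=0$, $\mathrm{pr}_2[x_2,y_2,x_1]=0$ for $x_1,y_1\in A_1$, $x_2,y_2\in A_2$ ($\mathrm{pr}_i$ the projections to $A_i$). $\big((A\oplus A^*,\mathcal B),A,A^*\big)$ is a standard Manin triple if it is a Manin triple of Poisson 3-Lie algebras, where $\mathcal B(x+\xi,y+\eta)=\langle x,\eta\rangle+\langle y,\xi\rangle$ and $A\oplus A^*$ carries the operations $[x+\xi,y+\eta,z+\zeta]_{A\oplus A^*}=[x,y,z]+\mathrm{ad}^*_{x,y}\zeta-\mathrm{ad}^*_{x,z}\eta+\mathrm{ad}^*_{y,z}\xi+[\xi,\eta,\zeta]^*+\mathfrak{ad}^*_{\xi,\eta}z-\mathfrak{ad}^*_{\xi,\zeta}y+\mathfrak{ad}^*_{\eta,\zeta}x$,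 $(x+\xi)\cdot_{A\oplus A^*}(y+\eta)=x\cdot y-\mathcal L^*(x)\eta-\mathcal L^*(y)\xi+\xi\circ\eta-L^*(\xi)y-L^*(\eta)x$ (in particular these operations make $A\oplus A^*$ a Poisson 3-Lie algebra). *)

theory Defs
  imports Complex_Main "HOL-Library.Function_Algebras" "HOL-Library.Product_Plus"
begin

section \<open>Vector spaces with an explicit carrier\<close>

text \<open>
  The dual space of a vector space is a subspace of a function type and not a type of its own, so
  a vector space is a subspace \<open>vcarrier V\<close> of an ambient type that is a vector space under
  \<open>vscale V\<close>. All structures below are relativised to the carrier. The addition on functions
  and on pairs is the componentwise one.
\<close>

record ('k, 'v) vspace =
  vscale :: "'k \<Rightarrow> 'v \<Rightarrow> 'v"
  vcarrier :: "'v set"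

definition is_vspace :: "('k::field, 'v::ab_group_add) vspace \<Rightarrow> bool" where
  "is_vspace V \<longleftrightarrow> vector_space (vscale V) \<and> module.subspace (vscale V) (vcarrier V)"

definition linear_on :: "('k::field, 'v::ab_group_add) vspace \<Rightarrow> ('k, 'w::ab_group_add) vspace
    \<Rightarrow> ('v \<Rightarrow> 'w) \<Rightarrow> bool" where
  "linear_on V W f \<longleftrightarrow>
     (\<forall>x\<in>vcarrier V. f x \<in> vcarrier W) \<and>
     (\<forall>x\<in>vcarrier V. \<forall>y\<in>vcarrier V. f (x + y) = f x + f y) \<and>
     (\<forall>c. \<forall>x\<in>vcarrier V. f (vscale V c x) = vscale W c (f x))"

definition bilinear_on :: "('k::field, 'u::ab_group_add) vspace \<Rightarrow> ('k, 'v::ab_group_add) vspace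
    \<Rightarrow> ('k, 'w::ab_group_add) vspace \<Rightarrow> ('u \<Rightarrow> 'v \<Rightarrow> 'w) \<Rightarrow> bool" where
  "bilinear_on U V W f \<longleftrightarrow>
     (\<forall>x\<in>vcarrier U. linear_on V W (\<lambda>y. f x y)) \<and>
     (\<forall>y\<in>vcarrier V. linear_on U W (\<lambda>x. f x y))"

definition trilinear_on :: "('k::field, 't::ab_group_add) vspace
    \<Rightarrow> ('k, 'u::ab_group_add) vspace \<Rightarrow> ('k, 'v::ab_group_add) vspace
    \<Rightarrow> ('k, 'w::ab_group_add) vspace \<Rightarrow> ('t \<Rightarrow> 'u \<Rightarrow> 'v \<Rightarrow> 'w) \<Rightarrow> bool" where
  "trilinear_on T U V W f \<longleftrightarrow>
     (\<forall>x\<in>vcarrier T. \<forall>y\<in>vcarrier U. linear_on V W (\<lambda>z. f x y z)) \<and>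
     (\<forall>x\<in>vcarrier T. \<forall>z\<in>vcarrier V. linear_on U W (\<lambda>y. f x y z)) \<and>
     (\<forall>y\<in>vcarrier U. \<forall>z\<in>vcarrier V. linear_on T W (\<lambda>x. f x y z))"

definition whole :: "('k \<Rightarrow> 'v \<Rightarrow> 'v) \<Rightarrow> ('k, 'v) vspace" where
  "whole sc = \<lparr>vscale = sc, vcarrier = UNIV\<rparr>"

definition scalars :: "('k::field, 'k) vspace" where
  "scalars = whole (*)"

definition fscale :: "'k::field \<Rightarrow> ('x \<Rightarrow> 'k) \<Rightarrow> 'x \<Rightarrow> 'k" where
  "fscale c f = (\<lambda>x. c * f x)"

lemma vector_space_fscale: "vector_space fscale"
  by unfold_locales (auto simp: fscale_def fun_eq_iff algebra_simps)

definition dual_set :: "('k::field \<Rightarrow> 'a::ab_group_add \<Rightarrow> 'a) \<Rightarrow> ('a \<Rightarrow> 'k) set" where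
  "dual_set sc = {\<xi>. Vector_Spaces.linear sc (*) \<xi>}"

definition dual :: "('k::field \<Rightarrow> 'a::ab_group_add \<Rightarrow> 'a) \<Rightarrow> ('k, 'a \<Rightarrow> 'k) vspace" where
  "dual sc = \<lparr>vscale = fscale, vcarrier = dual_set sc\<rparr>"

definition dsum :: "('k, 'v) vspace \<Rightarrow> ('k, 'w) vspace \<Rightarrow> ('k, 'v \<times> 'w) vspace" where
  "dsum V W = \<lparr>vscale = (\<lambda>c (v, w). (vscale V c v, vscale W c w)),
               vcarrier = vcarrier V \<times> vcarrier W\<rparr>"


section \<open>Poisson 3-Lie algebras and their representations\<close>

definition comm_assoc_algebra ::
    "('k::field, 'v::ab_group_add) vspace \<Rightarrow> ('v \<Rightarrow> 'v \<Rightarrow> 'v) \<Rightarrow> bool" where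
  "comm_assoc_algebra V m \<longleftrightarrow> is_vspace V \<and> bilinear_on V V V m \<and>
     (\<forall>x\<in>vcarrier V. \<forall>y\<in>vcarrier V. m x y = m y x) \<and>
     (\<forall>x\<in>vcarrier V. \<forall>y\<in>vcarrier V. \<forall>z\<in>vcarrier V. m (m x y) z = m x (m y z))"

definition skew3_on :: "'v set \<Rightarrow> ('v \<Rightarrow> 'v \<Rightarrow> 'v \<Rightarrow> 'w::ab_group_add) \<Rightarrow> bool" where
  "skew3_on S br \<longleftrightarrow> (\<forall>x\<in>S. \<forall>y\<in>S. \<forall>z\<in>S. br y x z = - br x y z \<and> br x z y = - br x y z)"

definition lie3_algebra ::
    "('k::field, 'v::ab_group_add) vspace \<Rightarrow> ('v \<Rightarrow> 'v \<Rightarrow> 'v \<Rightarrow> 'v) \<Rightarrow> bool" where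
  "lie3_algebra V br \<longleftrightarrow> is_vspace V \<and> trilinear_on V V V V br \<and> skew3_on (vcarrier V) br \<and>
     (\<forall>x1\<in>vcarrier V. \<forall>x2\<in>vcarrier V. \<forall>x3\<in>vcarrier V. \<forall>x4\<in>vcarrier V. \<forall>x5\<in>vcarrier V.
        br x1 x2 (br x3 x4 x5) =
          br (br x1 x2 x3) x4 x5 + br x3 (br x1 x2 x4) x5 + br x3 x4 (br x1 x2 x5))"

definition poisson_lie3_algebra :: "('k::field, 'v::ab_group_add) vspace
    \<Rightarrow> ('v \<Rightarrow> 'v \<Rightarrow> 'v) \<Rightarrow> ('v \<Rightarrow> 'v \<Rightarrow> 'v \<Rightarrow> 'v) \<Rightarrow> bool" where
  "poisson_lie3_algebra V m br \<longleftrightarrow> comm_assoc_algebra V m \<and> lie3_algebra V br \<and>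
     (\<forall>w\<in>vcarrier V. \<forall>x\<in>vcarrier V. \<forall>y\<in>vcarrier V. \<forall>z\<in>vcarrier V.
        br (m w x) y z = m w (br x y z) + m x (br w y z))"

text \<open>
  Linear maps \<open>A \<rightarrow> gl(V)\<close> and \<open>A \<otimes> A \<rightarrow> gl(V)\<close> are uncurried to bilinear and trilinear maps.
\<close>

definition comm_assoc_rep :: "('k::field, 'v::ab_group_add) vspace \<Rightarrow> ('v \<Rightarrow> 'v \<Rightarrow> 'v)
    \<Rightarrow> ('k, 'w::ab_group_add) vspace \<Rightarrow> ('v \<Rightarrow> 'w \<Rightarrow> 'w) \<Rightarrow> bool" where
  "comm_assoc_rep A m V \<mu> \<longleftrightarrow> is_vspace V \<and> bilinear_on A V V \<mu> \<and>
     (\<forall>x\<in>vcarrier A. \<forall>y\<in>vcarrier A. \<forall>v\<in>vcarrier V. \<mu> (m x y) v = \<mu> x (\<mu> y v))"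

definition lie3_rep :: "('k::field, 'v::ab_group_add) vspace \<Rightarrow> ('v \<Rightarrow> 'v \<Rightarrow> 'v \<Rightarrow> 'v)
    \<Rightarrow> ('k, 'w::ab_group_add) vspace \<Rightarrow> ('v \<Rightarrow> 'v \<Rightarrow> 'w \<Rightarrow> 'w) \<Rightarrow> bool" where
  "lie3_rep A br V \<rho> \<longleftrightarrow> is_vspace V \<and> trilinear_on A A V V \<rho> \<and>
     (\<forall>x\<in>vcarrier A. \<forall>y\<in>vcarrier A. \<forall>v\<in>vcarrier V. \<rho> y x v = - \<rho> x y v) \<and>
     (\<forall>x1\<in>vcarrier A. \<forall>x2\<in>vcarrier A. \<forall>x3\<in>vcarrier A. \<forall>x4\<in>vcarrier A. \<forall>v\<in>vcarrier V.
        \<rho> x1 x2 (\<rho> x3 x4 v) - \<rho> x3 x4 (\<rho> x1 x2 v) =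
          \<rho> (br x1 x2 x3) x4 v - \<rho> (br x1 x2 x4) x3 v) \<and>
     (\<forall>x1\<in>vcarrier A. \<forall>x2\<in>vcarrier A. \<forall>x3\<in>vcarrier A. \<forall>x4\<in>vcarrier A. \<forall>v\<in>vcarrier V.
        \<rho> (br x1 x2 x3) x4 v =
          \<rho> x1 x2 (\<rho> x3 x4 v) + \<rho> x2 x3 (\<rho> x1 x4 v) + \<rho> x3 x1 (\<rho> x2 x4 v))"

definition poisson_lie3_rep :: "('k::field, 'v::ab_group_add) vspace \<Rightarrow> ('v \<Rightarrow> 'v \<Rightarrow> 'v)
    \<Rightarrow> ('v \<Rightarrow> 'v \<Rightarrow> 'v \<Rightarrow> 'v) \<Rightarrow> ('k, 'w::ab_group_add) vspace
    \<Rightarrow> ('v \<Rightarrow> 'v \<Rightarrow> 'w \<Rightarrow> 'w) \<Rightarrow> ('v \<Rightarrow> 'w \<Rightarrow> 'w) \<Rightarrow> bool" where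
  "poisson_lie3_rep A m br V \<rho> \<mu> \<longleftrightarrow> comm_assoc_rep A m V \<mu> \<and> lie3_rep A br V \<rho> \<and>
     (\<forall>x\<in>vcarrier A. \<forall>y\<in>vcarrier A. \<forall>z\<in>vcarrier A. \<forall>v\<in>vcarrier V.
        \<rho> (m x y) z v = \<mu> x (\<rho> y z v) + \<mu> y (\<rho> x z v)) \<and>
     (\<forall>x\<in>vcarrier A. \<forall>y\<in>vcarrier A. \<forall>z\<in>vcarrier A. \<forall>v\<in>vcarrier V.
        \<rho> x y (\<mu> z v) = \<mu> (br x y z) v + \<mu> z (\<rho> x y v))"


section \<open>Matched pairs\<close>

definition comm_assoc_matched_pair :: "('k::field, 'v::ab_group_add) vspace \<Rightarrow> ('v \<Rightarrow> 'v \<Rightarrow> 'v)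
    \<Rightarrow> ('k, 'w::ab_group_add) vspace \<Rightarrow> ('w \<Rightarrow> 'w \<Rightarrow> 'w)
    \<Rightarrow> ('v \<Rightarrow> 'w \<Rightarrow> 'w) \<Rightarrow> ('w \<Rightarrow> 'v \<Rightarrow> 'v) \<Rightarrow> bool" where
  "comm_assoc_matched_pair A mA B mB \<mu>A \<mu>B \<longleftrightarrow>
     comm_assoc_algebra A mA \<and> comm_assoc_algebra B mB \<and>
     comm_assoc_rep A mA B \<mu>A \<and> comm_assoc_rep B mB A \<mu>B \<and>
     (\<forall>x\<in>vcarrier A. \<forall>a\<in>vcarrier B. \<forall>b\<in>vcarrier B.
        \<mu>A x (mB a b) = mB (\<mu>A x a) b + \<mu>A (\<mu>B a x) b) \<and>
     (\<forall>a\<in>vcarrier B. \<forall>x\<in>vcarrier A. \<forall>y\<in>vcarrier A.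
        \<mu>B a (mA x y) = mA (\<mu>B a x) y + \<mu>B (\<mu>A x a) y)"

text \<open>The three identities with values in \<open>A\<close>; exchanging the roles gives those in \<open>B\<close>.\<close>

definition lie3_compatible :: "('k::field, 'v::ab_group_add) vspace \<Rightarrow> ('v \<Rightarrow> 'v \<Rightarrow> 'v \<Rightarrow> 'v)
    \<Rightarrow> ('k, 'w::ab_group_add) vspace
    \<Rightarrow> ('v \<Rightarrow> 'v \<Rightarrow> 'w \<Rightarrow> 'w) \<Rightarrow> ('w \<Rightarrow> 'w \<Rightarrow> 'v \<Rightarrow> 'v) \<Rightarrow> bool" where
  "lie3_compatible A brA B \<rho>A \<rho>B \<longleftrightarrow>
     (\<forall>x1\<in>vcarrier A. \<forall>x2\<in>vcarrier A. \<forall>x3\<in>vcarrier A. \<forall>y4\<in>vcarrier B. \<forall>y5\<in>vcarrier B.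
        \<rho>B y4 y5 (brA x1 x2 x3) =
          brA (\<rho>B y4 y5 x1) x2 x3 + brA x1 (\<rho>B y4 y5 x2) x3 + brA x1 x2 (\<rho>B y4 y5 x3)) \<and>
     (\<forall>x1\<in>vcarrier A. \<forall>x2\<in>vcarrier A. \<forall>y3\<in>vcarrier B. \<forall>x4\<in>vcarrier A. \<forall>y5\<in>vcarrier B.
        - \<rho>B (\<rho>A x1 x2 y3) y5 x4 =
          - \<rho>B (\<rho>A x1 x4 y5) y3 x2 + \<rho>B (\<rho>A x2 x4 y5) y3 x1 - brA x1 x2 (\<rho>B y3 y5 x4)) \<and>
     (\<forall>x1\<in>vcarrier A. \<forall>y2\<in>vcarrier B. \<forall>y3\<in>vcarrier B. \<forall>x4\<in>vcarrier A. \<forall>x5\<in>vcarrier A.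
        brA (\<rho>B y2 y3 x1) x4 x5 =
          \<rho>B y2 y3 (brA x1 x4 x5) + \<rho>B (\<rho>A x4 x5 y2) y3 x1 + \<rho>B y2 (\<rho>A x4 x5 y3) x1)"

definition lie3_matched_pair :: "('k::field, 'v::ab_group_add) vspace
    \<Rightarrow> ('v \<Rightarrow> 'v \<Rightarrow> 'v \<Rightarrow> 'v) \<Rightarrow> ('k, 'w::ab_group_add) vspace \<Rightarrow> ('w \<Rightarrow> 'w \<Rightarrow> 'w \<Rightarrow> 'w)
    \<Rightarrow> ('v \<Rightarrow> 'v \<Rightarrow> 'w \<Rightarrow> 'w) \<Rightarrow> ('w \<Rightarrow> 'w \<Rightarrow> 'v \<Rightarrow> 'v) \<Rightarrow> bool" where
  "lie3_matched_pair A brA B brB \<rho>A \<rho>B \<longleftrightarrow>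
     lie3_algebra A brA \<and> lie3_algebra B brB \<and>
     lie3_rep A brA B \<rho>A \<and> lie3_rep B brB A \<rho>B \<and>
     lie3_compatible A brA B \<rho>A \<rho>B \<and> lie3_compatible B brB A \<rho>B \<rho>A"

definition poisson_lie3_matched_pair :: "('k::field, 'v::ab_group_add) vspace
    \<Rightarrow> ('v \<Rightarrow> 'v \<Rightarrow> 'v) \<Rightarrow> ('v \<Rightarrow> 'v \<Rightarrow> 'v \<Rightarrow> 'v)
    \<Rightarrow> ('k, 'w::ab_group_add) vspace \<Rightarrow> ('w \<Rightarrow> 'w \<Rightarrow> 'w) \<Rightarrow> ('w \<Rightarrow> 'w \<Rightarrow> 'w \<Rightarrow> 'w)
    \<Rightarrow> ('v \<Rightarrow> 'v \<Rightarrow> 'w \<Rightarrow> 'w) \<Rightarrow> ('v \<Rightarrow> 'w \<Rightarrow> 'w)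
    \<Rightarrow> ('w \<Rightarrow> 'w \<Rightarrow> 'v \<Rightarrow> 'v) \<Rightarrow> ('w \<Rightarrow> 'v \<Rightarrow> 'v) \<Rightarrow> bool" where
  "poisson_lie3_matched_pair A mA brA B mB brB \<rho>A \<mu>A \<rho>B \<mu>B \<longleftrightarrow>
     poisson_lie3_algebra A mA brA \<and> poisson_lie3_algebra B mB brB \<and>
     comm_assoc_matched_pair A mA B mB \<mu>A \<mu>B \<and>
     lie3_matched_pair A brA B brB \<rho>A \<rho>B \<and>
     poisson_lie3_rep A mA brA B \<rho>A \<mu>A \<and> poisson_lie3_rep B mB brB A \<rho>B \<mu>B \<and>
     (\<forall>x1\<in>vcarrier A. \<forall>x2\<in>vcarrier A. \<forall>x3\<in>vcarrier A. \<forall>y1\<in>vcarrier B.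
        brA (\<mu>B y1 x1) x2 x3 = \<mu>B (\<rho>A x2 x3 y1) x1 + \<mu>B y1 (brA x1 x2 x3)) \<and>
     (\<forall>y1\<in>vcarrier B. \<forall>y2\<in>vcarrier B. \<forall>y3\<in>vcarrier B. \<forall>x1\<in>vcarrier A.
        brB (\<mu>A x1 y1) y2 y3 = \<mu>A (\<rho>B y2 y3 x1) y1 + \<mu>A x1 (brB y1 y2 y3)) \<and>
     (\<forall>x1\<in>vcarrier A. \<forall>x2\<in>vcarrier A. \<forall>y1\<in>vcarrier B. \<forall>y2\<in>vcarrier B.
        \<rho>B (\<mu>A x1 y1) y2 x2 = mA x1 (\<rho>B y1 y2 x2)) \<and>
     (\<forall>x1\<in>vcarrier A. \<forall>x2\<in>vcarrier A. \<forall>y1\<in>vcarrier B. \<forall>y2\<in>vcarrier B.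
        \<rho>A (\<mu>B y1 x1) x2 y2 = mB y1 (\<rho>A x1 x2 y2)) \<and>
     (\<forall>x1\<in>vcarrier A. \<forall>x2\<in>vcarrier A. \<forall>x3\<in>vcarrier A. \<forall>y1\<in>vcarrier B.
        \<mu>B (\<rho>A x1 x2 y1) x3 + \<mu>B (\<rho>A x3 x2 y1) x1 = 0) \<and>
     (\<forall>y1\<in>vcarrier B. \<forall>y2\<in>vcarrier B. \<forall>y3\<in>vcarrier B. \<forall>x1\<in>vcarrier A.
        \<mu>A (\<rho>B y1 y2 x1) y3 + \<mu>A (\<rho>B y3 y2 x1) y1 = 0) \<and>
     (\<forall>x1\<in>vcarrier A. \<forall>x2\<in>vcarrier A. \<forall>y3\<in>vcarrier B. \<forall>y4\<in>vcarrier B.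
        \<rho>B y3 y4 (mA x1 x2) = mA x1 (\<rho>B y3 y4 x2) + mA x2 (\<rho>B y3 y4 x1)) \<and>
     (\<forall>y1\<in>vcarrier B. \<forall>y2\<in>vcarrier B. \<forall>x3\<in>vcarrier A. \<forall>x4\<in>vcarrier A.
        \<rho>A x3 x4 (mB y1 y2) = mB y1 (\<rho>A x3 x4 y2) + mB y2 (\<rho>A x3 x4 y1))"


section \<open>Tensor powers\<close>

text \<open>
  An elementary tensor \<open>x1 \<otimes> \<dots> \<otimes> xn\<close> is represented by the function sending a list
  \<open>[\<xi>1, \<dots>, \<xi>n]\<close> of linear functionals to \<open>\<langle>\<xi>1, x1\<rangle> \<dots> \<langle>\<xi>n, xn\<rangle>\<close> and everything else to 0, and the
  \<open>n\<close>-th tensor power is the linear span of the elementary tensors. This is the canonical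
  embedding of the tensor power into the multilinear forms on the dual space, which is injective
  for vector spaces. Evaluating a tensor at \<open>[\<xi>1, \<dots>, \<xi>n]\<close> is the pairing with
  \<open>\<xi>1 \<otimes> \<dots> \<otimes> \<xi>n\<close>.
\<close>

type_synonym ('k, 'a) tensor = "('a \<Rightarrow> 'k) list \<Rightarrow> 'k"

definition elem_tensor ::
    "('k::field \<Rightarrow> 'a::ab_group_add \<Rightarrow> 'a) \<Rightarrow> 'a list \<Rightarrow> ('k, 'a) tensor" where
  "elem_tensor sc xs = (\<lambda>\<xi>s. if length \<xi>s = length xs \<and> set \<xi>s \<subseteq> dual_set sc
                            then (\<Prod>i<length xs. (\<xi>s ! i) (xs ! i)) else 0)"

definition tensor_power :: "('k::field \<Rightarrow> 'a::ab_group_add \<Rightarrow> 'a) \<Rightarrow> nat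
    \<Rightarrow> ('k, ('k, 'a) tensor) vspace" where
  "tensor_power sc n =
     \<lparr>vscale = fscale, vcarrier = module.span fscale (elem_tensor sc ` {xs. length xs = n})\<rparr>"

text \<open>
  \<open>tmap l m f\<close> is the map \<open>1 \<otimes> \<dots> \<otimes> 1 \<otimes> f \<otimes> 1 \<otimes> \<dots> \<otimes> 1\<close> on tensors, with \<open>l\<close> identity factors
  to the left of a linear map \<open>f\<close> from the space to its \<open>m\<close>-th tensor power; \<open>tmap1\<close> is
  the variant for an endomorphism \<open>f\<close>. \<open>tswap i j\<close> exchanges the \<open>i\<close>-th and \<open>j\<close>-th factors,
  counted from 1.
\<close>

definition tmap :: "nat \<Rightarrow> nat \<Rightarrow> ('a \<Rightarrow> ('k, 'a) tensor) \<Rightarrow> ('k, 'a) tensor \<Rightarrow> ('k, 'a) tensor" where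
  "tmap l m f T =
     (\<lambda>\<xi>s. T (take l \<xi>s @ [\<lambda>x. f x (take m (drop l \<xi>s))] @ drop (l + m) \<xi>s))"

definition tmap1 :: "('k::field \<Rightarrow> 'a::ab_group_add \<Rightarrow> 'a) \<Rightarrow> nat \<Rightarrow> ('a \<Rightarrow> 'a)
    \<Rightarrow> ('k, 'a) tensor \<Rightarrow> ('k, 'a) tensor" where
  "tmap1 sc l f = tmap l 1 (\<lambda>x. elem_tensor sc [f x])"

definition tswap :: "nat \<Rightarrow> nat \<Rightarrow> ('k, 'a) tensor \<Rightarrow> ('k, 'a) tensor" where
  "tswap i j T = (\<lambda>\<xi>s. T (\<xi>s[i - 1 := \<xi>s ! (j - 1), j - 1 := \<xi>s ! (i - 1)]))"

text \<open>The next two facts confirm that \<open>tmap\<close> and \<open>tswap\<close> are the intended maps.\<close>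

lemma elem_tensor_prod_list:
  "length \<xi>s = length xs \<Longrightarrow> set \<xi>s \<subseteq> dual_set sc \<Longrightarrow>
   elem_tensor sc xs \<xi>s = prod_list (map2 (\<lambda>\<xi> x. \<xi> x) \<xi>s xs)"
  by (simp add: elem_tensor_def prod.list_conv_set_nth atLeast0LessThan)

lemma elem_tensor_eq_0:
  "\<not> (length \<xi>s = length xs \<and> set \<xi>s \<subseteq> dual_set sc) \<Longrightarrow> elem_tensor sc xs \<xi>s = 0"
  by (auto simp: elem_tensor_def)

lemma tmap_elem_tensor:
  assumes vs: "vector_space sc" and lin: "linear_on (whole sc) (tensor_power sc m) f"
    and l: "l < length xs" and ys: "f (xs ! l) = elem_tensor sc ys" "length ys = m"
  shows "tmap l m f (elem_tensor sc xs) = elem_tensor sc (take l xs @ ys @ drop (Suc l) xs)"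
proof
  fix \<xi>s :: "('b \<Rightarrow> 'a) list"
  let ?a = "take l \<xi>s" and ?w = "take m (drop l \<xi>s)" and ?c = "drop (l + m) \<xi>s"
  let ?\<phi> = "\<lambda>x. f x ?w"
  have split: "\<xi>s = ?a @ ?w @ ?c"
    by (metis append_take_drop_id drop_drop add.commute)
  have xs: "xs = take l xs @ [xs ! l] @ drop (Suc l) xs"
    using l by (simp add: id_take_nth_drop)
  have \<phi>: "?\<phi> \<in> dual_set sc"
  proof -
    interpret vector_space sc by (rule vs)
    interpret p: vector_space_pair sc "(*) :: 'a \<Rightarrow> 'a \<Rightarrow> 'a"
      by unfold_locales (auto simp: algebra_simps)
    show ?thesis
      using lin unfolding dual_set_def mem_Collect_eq
      by unfold_locales (auto simp: linear_on_def whole_def tensor_power_def fscale_def)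
  qed
  have L: "tmap l m f (elem_tensor sc xs) \<xi>s = elem_tensor sc xs (?a @ [?\<phi>] @ ?c)"
    by (simp add: tmap_def)
  show "tmap l m f (elem_tensor sc xs) \<xi>s
      = elem_tensor sc (take l xs @ ys @ drop (Suc l) xs) \<xi>s"
  proof (cases "length ?w = m \<and> set ?w \<subseteq> dual_set sc")
    case False
    then have z: "?\<phi> (xs ! l) = 0"
      using ys elem_tensor_eq_0[of ?w ys sc] by simp
    have "elem_tensor sc xs (?a @ [?\<phi>] @ ?c) = 0"
    proof (cases "length (?a @ [?\<phi>] @ ?c) = length xs \<and> set (?a @ [?\<phi>] @ ?c) \<subseteq> dual_set sc
                  \<and> length ?a = l")
      case True
      then have "elem_tensor sc xs (?a @ [?\<phi>] @ ?c)
          = prod_list (map2 (\<lambda>\<xi> x. \<xi> x) (?a @ [?\<phi>] @ ?c) xs)"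
        by (intro elem_tensor_prod_list) auto
      also have "\<dots> = prod_list (map2 (\<lambda>\<xi> x. \<xi> x) (?a @ [?\<phi>] @ ?c)
          (take l xs @ [xs ! l] @ drop (Suc l) xs))"
        using xs by simp
      also have "\<dots> = 0"
        using True l z by (simp add: zip_append1)
      finally show ?thesis .
    next
      case False
      then show ?thesis using l by (intro elem_tensor_eq_0) auto
    qed
    moreover have "\<not> (length \<xi>s = length (take l xs @ ys @ drop (Suc l) xs)
        \<and> set \<xi>s \<subseteq> dual_set sc)"
    proof
      assume a: "length \<xi>s = length (take l xs @ ys @ drop (Suc l) xs)
        \<and> set \<xi>s \<subseteq> dual_set sc"
      then have "length ?w = m" using l ys by simp
      moreover have "set ?w \<subseteq> set \<xi>s"
        by (meson set_drop_subset set_take_subset subset_trans)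
      ultimately show False using a False by auto
    qed
    ultimately show ?thesis using L by (metis elem_tensor_eq_0)
  next
    case w: True
    show ?thesis
    proof (cases "length \<xi>s = length xs - 1 + m \<and> set ?a \<subseteq> dual_set sc \<and> set ?c \<subseteq> dual_set sc")
      case True
      have len: "length ?a = l" using True l by auto
      have d: "set \<xi>s \<subseteq> dual_set sc" using True w split
        by (metis set_append Un_least)
      have "elem_tensor sc xs (?a @ [?\<phi>] @ ?c)
          = prod_list (map2 (\<lambda>\<xi> x. \<xi> x) (?a @ [?\<phi>] @ ?c) xs)"
        using True l \<phi> by (intro elem_tensor_prod_list) auto
      also have "\<dots> = prod_list (map2 (\<lambda>\<xi> x. \<xi> x) (?a @ [?\<phi>] @ ?c)
          (take l xs @ [xs ! l] @ drop (Suc l) xs))"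
        using xs by simp
      also have "\<dots> = prod_list (map2 (\<lambda>\<xi> x. \<xi> x) ?a (take l xs)) * ?\<phi> (xs ! l)
          * prod_list (map2 (\<lambda>\<xi> x. \<xi> x) ?c (drop (Suc l) xs))"
        using len l by (simp add: mult.assoc)
      also have "?\<phi> (xs ! l) = prod_list (map2 (\<lambda>\<xi> x. \<xi> x) ?w ys)"
        using ys w elem_tensor_prod_list[of ?w ys sc] by simp
      also have "prod_list (map2 (\<lambda>\<xi> x. \<xi> x) ?a (take l xs))
          * prod_list (map2 (\<lambda>\<xi> x. \<xi> x) ?w ys)
          * prod_list (map2 (\<lambda>\<xi> x. \<xi> x) ?c (drop (Suc l) xs))
          = prod_list (map2 (\<lambda>\<xi> x. \<xi> x) (?a @ ?w @ ?c) (take l xs @ ys @ drop (Suc l) xs))"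
        using len l w ys by (simp add: mult.assoc)
      also have "\<dots> = elem_tensor sc (take l xs @ ys @ drop (Suc l) xs) \<xi>s"
        using elem_tensor_prod_list[of \<xi>s "take l xs @ ys @ drop (Suc l) xs" sc]
          True d l ys split by simp
      finally show ?thesis using L by simp
    next
      case False
      have "\<not> (length (?a @ [?\<phi>] @ ?c) = length xs \<and> set (?a @ [?\<phi>] @ ?c) \<subseteq> dual_set sc)"
      proof
        assume a: "length (?a @ [?\<phi>] @ ?c) = length xs \<and> set (?a @ [?\<phi>] @ ?c) \<subseteq> dual_set sc"
        have "length \<xi>s = length ?a + m + length ?c"
          using w split by (metis length_append add.assoc)
        moreover have "length ?a + 1 + length ?c = length xs" using a by simp
        ultimately have "length \<xi>s = length xs - 1 + m" by linarith
        with a False show False by auto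
      qed
      moreover have "\<not> (length \<xi>s = length (take l xs @ ys @ drop (Suc l) xs)
          \<and> set \<xi>s \<subseteq> dual_set sc)"
      proof
        assume a: "length \<xi>s = length (take l xs @ ys @ drop (Suc l) xs)
          \<and> set \<xi>s \<subseteq> dual_set sc"
        then have "length \<xi>s = length xs - 1 + m" using l ys by auto
        with a False show False
          by (meson set_drop_subset set_take_subset subset_trans)
      qed
      ultimately show ?thesis using L by (metis elem_tensor_eq_0)
    qed
  qed
qed

lemma tswap_elem_tensor:
  assumes ij: "1 \<le> i" "i \<le> length xs" "1 \<le> j" "j \<le> length xs"
  shows "tswap i j (elem_tensor sc xs) =
           elem_tensor sc (xs[i - 1 := xs ! (j - 1), j - 1 := xs ! (i - 1)])"
proof
  fix \<xi>s :: "('a \<Rightarrow> 'b) list"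
  define i' j' where "i' = i - 1" and "j' = j - 1"
  have b: "i' < length xs" "j' < length xs" using ij by (auto simp: i'_def j'_def)
  let ?t = "\<lambda>k. if k = i' then j' else if k = j' then i' else k"
  show "tswap i j (elem_tensor sc xs) \<xi>s
      = elem_tensor sc (xs[i - 1 := xs ! (j - 1), j - 1 := xs ! (i - 1)]) \<xi>s"
  proof (cases "length \<xi>s = length xs")
    case True
    have set: "set (\<xi>s[i' := \<xi>s ! j', j' := \<xi>s ! i']) = set \<xi>s"
      using b True by (simp add: set_swap)
    have "(\<Prod>k<length xs. (\<xi>s[i' := \<xi>s ! j', j' := \<xi>s ! i'] ! k) (xs ! k))
        = (\<Prod>k<length xs. (\<xi>s ! k) (xs[i' := xs ! j', j' := xs ! i'] ! k))"
      by (rule prod.reindex_bij_witness[of _ ?t ?t])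
         (use b True in \<open>auto simp: nth_list_update split: if_splits\<close>)
    then show ?thesis
      using True set by (simp add: tswap_def elem_tensor_def i'_def j'_def)
  qed (simp add: tswap_def elem_tensor_def)
qed


section \<open>Coalgebras and bialgebras\<close>

definition transpose2 :: "('a \<Rightarrow> ('k, 'a) tensor) \<Rightarrow> ('a \<Rightarrow> 'k) \<Rightarrow> ('a \<Rightarrow> 'k) \<Rightarrow> ('a \<Rightarrow> 'k)" where
  "transpose2 \<Delta> \<xi> \<eta> = (\<lambda>x. \<Delta> x [\<xi>, \<eta>])"

definition transpose3 :: "('a \<Rightarrow> ('k, 'a) tensor)
    \<Rightarrow> ('a \<Rightarrow> 'k) \<Rightarrow> ('a \<Rightarrow> 'k) \<Rightarrow> ('a \<Rightarrow> 'k) \<Rightarrow> ('a \<Rightarrow> 'k)" where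
  "transpose3 \<delta> \<xi> \<eta> \<zeta> = (\<lambda>x. \<delta> x [\<xi>, \<eta>, \<zeta>])"

definition cocomm_coassoc_coalgebra :: "('k::field \<Rightarrow> 'a::ab_group_add \<Rightarrow> 'a)
    \<Rightarrow> ('a \<Rightarrow> ('k, 'a) tensor) \<Rightarrow> bool" where
  "cocomm_coassoc_coalgebra sc \<Delta> \<longleftrightarrow>
     vector_space sc \<and> linear_on (whole sc) (tensor_power sc 2) \<Delta> \<and>
     (\<forall>x. tswap 1 2 (\<Delta> x) = \<Delta> x) \<and>
     (\<forall>x. tmap 0 2 \<Delta> (\<Delta> x) = tmap 1 2 \<Delta> (\<Delta> x))"

definition lie3_coalgebra :: "('k::field \<Rightarrow> 'a::ab_group_add \<Rightarrow> 'a)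
    \<Rightarrow> ('a \<Rightarrow> ('k, 'a) tensor) \<Rightarrow> bool" where
  "lie3_coalgebra sc \<delta> \<longleftrightarrow>
     vector_space sc \<and> linear_on (whole sc) (tensor_power sc 3) \<delta> \<and>
     skew3_on (dual_set sc) (transpose3 \<delta>) \<and>
     (\<forall>x. tmap 0 3 \<delta> (\<delta> x)
          + tswap 2 3 (tswap 1 2 (tmap 1 3 \<delta> (\<delta> x)))
          + tswap 1 3 (tswap 2 4 (tmap 2 3 \<delta> (\<delta> x)))
        = tmap 2 3 \<delta> (\<delta> x))"

definition poisson_lie3_coalgebra :: "('k::field \<Rightarrow> 'a::ab_group_add \<Rightarrow> 'a)
    \<Rightarrow> ('a \<Rightarrow> ('k, 'a) tensor) \<Rightarrow> ('a \<Rightarrow> ('k, 'a) tensor) \<Rightarrow> bool" where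
  "poisson_lie3_coalgebra sc \<Delta> \<delta> \<longleftrightarrow>
     cocomm_coassoc_coalgebra sc \<Delta> \<and> lie3_coalgebra sc \<delta> \<and>
     (\<forall>x. tmap 0 2 \<Delta> (\<delta> x) = tmap 1 3 \<delta> (\<Delta> x) + tswap 1 2 (tmap 1 3 \<delta> (\<Delta> x)))"

definition comm_cocomm_infinitesimal_bialgebra :: "('k::field \<Rightarrow> 'a::ab_group_add \<Rightarrow> 'a)
    \<Rightarrow> ('a \<Rightarrow> 'a \<Rightarrow> 'a) \<Rightarrow> ('a \<Rightarrow> ('k, 'a) tensor) \<Rightarrow> bool" where
  "comm_cocomm_infinitesimal_bialgebra sc m \<Delta> \<longleftrightarrow>
     comm_assoc_algebra (whole sc) m \<and> cocomm_coassoc_coalgebra sc \<Delta> \<and>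
     (\<forall>x y. \<Delta> (m x y) = tmap1 sc 0 (m x) (\<Delta> y) + tmap1 sc 1 (m y) (\<Delta> x))"

definition double_lie3_bialgebra :: "('k::field \<Rightarrow> 'a::ab_group_add \<Rightarrow> 'a)
    \<Rightarrow> ('a \<Rightarrow> 'a \<Rightarrow> 'a \<Rightarrow> 'a) \<Rightarrow> ('a \<Rightarrow> ('k, 'a) tensor) \<Rightarrow> bool" where
  "double_lie3_bialgebra sc br \<delta> \<longleftrightarrow>
     lie3_algebra (whole sc) br \<and> lie3_coalgebra sc \<delta> \<and>
     (\<forall>x y z. \<delta> (br x y z) =
        tmap1 sc 2 (br y z) (\<delta> x) + tmap1 sc 2 (br z x) (\<delta> y) + tmap1 sc 2 (br x y) (\<delta> z)) \<and>
     (\<forall>x y z. \<delta> (br x y z) =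
        tmap1 sc 2 (br y z) (\<delta> x) + tmap1 sc 1 (br y z) (\<delta> x) + tmap1 sc 0 (br y z) (\<delta> x))"

definition double_poisson_lie3_bialgebra :: "('k::field \<Rightarrow> 'a::ab_group_add \<Rightarrow> 'a)
    \<Rightarrow> ('a \<Rightarrow> 'a \<Rightarrow> 'a) \<Rightarrow> ('a \<Rightarrow> 'a \<Rightarrow> 'a \<Rightarrow> 'a)
    \<Rightarrow> ('a \<Rightarrow> ('k, 'a) tensor) \<Rightarrow> ('a \<Rightarrow> ('k, 'a) tensor) \<Rightarrow> bool" where
  "double_poisson_lie3_bialgebra sc m br \<Delta> \<delta> \<longleftrightarrow>
     poisson_lie3_algebra (whole sc) m br \<and> poisson_lie3_coalgebra sc \<Delta> \<delta> \<and>
     double_lie3_bialgebra sc br \<delta> \<and> comm_cocomm_infinitesimal_bialgebra sc m \<Delta> \<and>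
     (\<forall>x y z. \<Delta> (br x y z) = tmap1 sc 1 (br y z) (\<Delta> x) + tmap1 sc 0 (br y z) (\<Delta> x)) \<and>
     (\<forall>x y. \<delta> (m x y) = tmap1 sc 0 (m y) (\<delta> x) + tmap1 sc 0 (m x) (\<delta> y)) \<and>
     (\<forall>x y. tmap1 sc 0 (m x) (\<delta> y) = tmap1 sc 2 (m x) (\<delta> y)) \<and>
     (\<forall>x y z. tmap1 sc 1 (br x y) (\<Delta> z) = tmap1 sc 1 (br y z) (\<Delta> x))"


section \<open>Dual actions\<close>

text \<open>
  \<open>dual_act f\<close> is \<open>f\<^sup>*\<close>, with \<open>\<langle>f\<^sup>* \<xi>, v\<rangle> = - \<langle>\<xi>, f v\<rangle>\<close>. For an endomorphism \<open>F\<close> of the dual space,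
  \<open>predual_act sc F\<close> is \<open>F\<^sup>*\<close> under the identification of the bidual with the space itself: the
  vector \<open>F\<^sup>* x\<close> is determined by \<open>\<langle>\<xi>, F\<^sup>* x\<rangle> = - \<langle>F \<xi>, x\<rangle>\<close> for all functionals \<open>\<xi>\<close>.
\<close>

definition dual_act :: "('a \<Rightarrow> 'a) \<Rightarrow> ('a \<Rightarrow> 'k::field) \<Rightarrow> 'a \<Rightarrow> 'k" where
  "dual_act f \<xi> = (\<lambda>v. - \<xi> (f v))"

definition predual_act :: "('k::field \<Rightarrow> 'a::ab_group_add \<Rightarrow> 'a)
    \<Rightarrow> (('a \<Rightarrow> 'k) \<Rightarrow> 'a \<Rightarrow> 'k) \<Rightarrow> 'a \<Rightarrow> 'a" where
  "predual_act sc F x = (THE y. \<forall>\<xi>\<in>dual_set sc. \<xi> y = - F \<xi> x)"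


section \<open>Manin triples\<close>

definition bilinear_form :: "('k::field, 'v::ab_group_add) vspace \<Rightarrow> ('v \<Rightarrow> 'v \<Rightarrow> 'k) \<Rightarrow> bool" where
  "bilinear_form P b \<longleftrightarrow> bilinear_on P P scalars b"

definition symmetric_form :: "('k::field, 'v::ab_group_add) vspace \<Rightarrow> ('v \<Rightarrow> 'v \<Rightarrow> 'k) \<Rightarrow> bool" where
  "symmetric_form P b \<longleftrightarrow> (\<forall>x\<in>vcarrier P. \<forall>y\<in>vcarrier P. b x y = b y x)"

text \<open>For symmetric forms left and right nondegeneracy coincide.\<close>

definition nondegenerate_form ::
    "('k::field, 'v::ab_group_add) vspace \<Rightarrow> ('v \<Rightarrow> 'v \<Rightarrow> 'k) \<Rightarrow> bool" where
  "nondegenerate_form P b \<longleftrightarrow>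
     (\<forall>x\<in>vcarrier P. (\<forall>y\<in>vcarrier P. b x y = 0) \<longrightarrow> x = 0)"

definition invariant_form :: "('k::field, 'v::ab_group_add) vspace \<Rightarrow> ('v \<Rightarrow> 'v \<Rightarrow> 'v)
    \<Rightarrow> ('v \<Rightarrow> 'v \<Rightarrow> 'v \<Rightarrow> 'v) \<Rightarrow> ('v \<Rightarrow> 'v \<Rightarrow> 'k) \<Rightarrow> bool" where
  "invariant_form P m br b \<longleftrightarrow>
     (\<forall>x\<in>vcarrier P. \<forall>y\<in>vcarrier P. \<forall>z\<in>vcarrier P. b (m x y) z = b x (m y z)) \<and>
     (\<forall>x\<in>vcarrier P. \<forall>y\<in>vcarrier P. \<forall>z\<in>vcarrier P. \<forall>u\<in>vcarrier P.
        b (br x y z) u = - b (br x y u) z)"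

definition poisson_lie3_subalgebra :: "('k::field, 'v::ab_group_add) vspace \<Rightarrow> ('v \<Rightarrow> 'v \<Rightarrow> 'v)
    \<Rightarrow> ('v \<Rightarrow> 'v \<Rightarrow> 'v \<Rightarrow> 'v) \<Rightarrow> 'v set \<Rightarrow> bool" where
  "poisson_lie3_subalgebra P m br S \<longleftrightarrow>
     S \<subseteq> vcarrier P \<and> module.subspace (vscale P) S \<and>
     (\<forall>x\<in>S. \<forall>y\<in>S. m x y \<in> S) \<and> (\<forall>x\<in>S. \<forall>y\<in>S. \<forall>z\<in>S. br x y z \<in> S)"

definition isotropic :: "('v \<Rightarrow> 'v \<Rightarrow> 'k::field) \<Rightarrow> 'v set \<Rightarrow> bool" where
  "isotropic b S \<longleftrightarrow> (\<forall>x\<in>S. \<forall>y\<in>S. b x y = 0)"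

definition internal_direct_sum :: "('k, 'v::ab_group_add) vspace \<Rightarrow> 'v set \<Rightarrow> 'v set \<Rightarrow> bool" where
  "internal_direct_sum P S T \<longleftrightarrow> vcarrier P = {s + t |s t. s \<in> S \<and> t \<in> T} \<and> S \<inter> T = {0}"

definition proj :: "'v set \<Rightarrow> 'v set \<Rightarrow> 'v::ab_group_add \<Rightarrow> 'v" where
  "proj S T v = (THE s. s \<in> S \<and> (\<exists>t\<in>T. v = s + t))"

definition manin_triple :: "('k::field, 'v::ab_group_add) vspace \<Rightarrow> ('v \<Rightarrow> 'v \<Rightarrow> 'v)
    \<Rightarrow> ('v \<Rightarrow> 'v \<Rightarrow> 'v \<Rightarrow> 'v) \<Rightarrow> ('v \<Rightarrow> 'v \<Rightarrow> 'k) \<Rightarrow> 'v set \<Rightarrow> 'v set \<Rightarrow> bool" where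
  "manin_triple P m br b S T \<longleftrightarrow>
     poisson_lie3_algebra P m br \<and>
     bilinear_form P b \<and> nondegenerate_form P b \<and> symmetric_form P b \<and>
     invariant_form P m br b \<and>
     poisson_lie3_subalgebra P m br S \<and> poisson_lie3_subalgebra P m br T \<and>
     isotropic b S \<and> isotropic b T \<and> internal_direct_sum P S T \<and>
     (\<forall>x1\<in>S. \<forall>y1\<in>S. \<forall>x2\<in>T. proj S T (br x1 y1 x2) = 0) \<and>
     (\<forall>x2\<in>T. \<forall>y2\<in>T. \<forall>x1\<in>S. proj T S (br x2 y2 x1) = 0)"

definition std_form :: "'a \<times> ('a \<Rightarrow> 'k::field) \<Rightarrow> 'a \<times> ('a \<Rightarrow> 'k) \<Rightarrow> 'k" where
  "std_form = (\<lambda>(x, \<xi>) (y, \<eta>). \<eta> x + \<xi> y)"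

definition std_bracket :: "('k::field \<Rightarrow> 'a::ab_group_add \<Rightarrow> 'a) \<Rightarrow> ('a \<Rightarrow> 'a \<Rightarrow> 'a \<Rightarrow> 'a)
    \<Rightarrow> (('a \<Rightarrow> 'k) \<Rightarrow> ('a \<Rightarrow> 'k) \<Rightarrow> ('a \<Rightarrow> 'k) \<Rightarrow> ('a \<Rightarrow> 'k))
    \<Rightarrow> 'a \<times> ('a \<Rightarrow> 'k) \<Rightarrow> 'a \<times> ('a \<Rightarrow> 'k) \<Rightarrow> 'a \<times> ('a \<Rightarrow> 'k) \<Rightarrow> 'a \<times> ('a \<Rightarrow> 'k)" where
  "std_bracket sc br br' = (\<lambda>(x, \<xi>) (y, \<eta>) (z, \<zeta>).
     (br x y z + predual_act sc (br' \<xi> \<eta>) z - predual_act sc (br' \<xi> \<zeta>) y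
        + predual_act sc (br' \<eta> \<zeta>) x,
      dual_act (br x y) \<zeta> - dual_act (br x z) \<eta> + dual_act (br y z) \<xi> + br' \<xi> \<eta> \<zeta>))"

definition std_mult :: "('k::field \<Rightarrow> 'a::ab_group_add \<Rightarrow> 'a) \<Rightarrow> ('a \<Rightarrow> 'a \<Rightarrow> 'a)
    \<Rightarrow> (('a \<Rightarrow> 'k) \<Rightarrow> ('a \<Rightarrow> 'k) \<Rightarrow> ('a \<Rightarrow> 'k))
    \<Rightarrow> 'a \<times> ('a \<Rightarrow> 'k) \<Rightarrow> 'a \<times> ('a \<Rightarrow> 'k) \<Rightarrow> 'a \<times> ('a \<Rightarrow> 'k)" where
  "std_mult sc m m' = (\<lambda>(x, \<xi>) (y, \<eta>).
     (m x y - predual_act sc (m' \<xi>) y - predual_act sc (m' \<eta>) x,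
      - dual_act (m x) \<eta> - dual_act (m y) \<xi> + m' \<xi> \<eta>))"

text \<open>\<open>m'\<close> and \<open>br'\<close> are the operations on the dual space.\<close>

definition std_manin_triple :: "('k::field \<Rightarrow> 'a::ab_group_add \<Rightarrow> 'a)
    \<Rightarrow> ('a \<Rightarrow> 'a \<Rightarrow> 'a) \<Rightarrow> ('a \<Rightarrow> 'a \<Rightarrow> 'a \<Rightarrow> 'a)
    \<Rightarrow> (('a \<Rightarrow> 'k) \<Rightarrow> ('a \<Rightarrow> 'k) \<Rightarrow> ('a \<Rightarrow> 'k))
    \<Rightarrow> (('a \<Rightarrow> 'k) \<Rightarrow> ('a \<Rightarrow> 'k) \<Rightarrow> ('a \<Rightarrow> 'k) \<Rightarrow> ('a \<Rightarrow> 'k)) \<Rightarrow> bool" where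
  "std_manin_triple sc m br m' br' \<longleftrightarrow>
     manin_triple (dsum (whole sc) (dual sc)) (std_mult sc m m') (std_bracket sc br br')
       std_form (UNIV \<times> {0}) ({0} \<times> dual_set sc)"

end

theory Submission
  imports Defs
begin

text \<open>
  Let \<open>A\<close> and \<open>B\<close> be Poisson 3-Lie algebras in perfect duality and let each act on the other by the
  coadjoint actions. Paired with an arbitrary functional, every matched pair identity becomes a
  scalar identity in the structure constants, and only seven different ones remain; these are the
  bialgebra identities evaluated at functionals, and their list is invariant under exchanging \<open>A\<close>
  and \<open>B\<close>, so that only the identities with values in \<open>A\<close> have to be treated. On the other side,
  by multilinearity the axioms of a Poisson 3-Lie algebra on \<open>A \<oplus> B\<close> need only be checked for
  arguments that lie in \<open>A\<close> or in \<open>B\<close>, where they are the matched pair identities.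
\<close>

section \<open>Linear maps on carriers\<close>

text \<open>The dual space is a carrier inside a function type, so the symmetry between a space and
  its dual is invisible in the types, and an action on the bidual can only be reached through
  \<open>predual_act\<close>. An abstract pairing of two carriers restores the symmetry: actions are
  pinned down by adjunction alone, and bases and \<open>predual_act\<close> occur only in the
  instance at the end. The reduction is so drastic because coadjoint actions satisfy a lot
  automatically: their linearity, all representation axioms and the invariance of the form follow
  from the algebra axioms of each side. Only the mixed identities say something about the interplay
  of the two algebras. Almost every matched pair identity is one scalar identity; the exception is
  the middle identity of \<open>lie3_compatible\<close>, which is obtained by equating the second
  and the third scalar identity. Concerning signs, \<open>\<mu>A\<close> is minus a dual action, so
  that its adjunction has no sign while that of \<open>\<rho>A\<close> has one.\<close>

lemma is_vspace_closed:
  assumes "is_vspace V"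
  shows "0 \<in> vcarrier V"
    and "x \<in> vcarrier V \<Longrightarrow> y \<in> vcarrier V \<Longrightarrow> x + y \<in> vcarrier V"
    and "x \<in> vcarrier V \<Longrightarrow> - x \<in> vcarrier V"
    and "x \<in> vcarrier V \<Longrightarrow> y \<in> vcarrier V \<Longrightarrow> x - y \<in> vcarrier V"
    and "x \<in> vcarrier V \<Longrightarrow> vscale V c x \<in> vcarrier V"
proof -
  interpret vector_space "vscale V" using assms by (simp add: is_vspace_def)
  have S: "subspace (vcarrier V)" using assms by (simp add: is_vspace_def)
  show "0 \<in> vcarrier V"
    and "x \<in> vcarrier V \<Longrightarrow> y \<in> vcarrier V \<Longrightarrow> x + y \<in> vcarrier V"
    and "x \<in> vcarrier V \<Longrightarrow> - x \<in> vcarrier V"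
    and "x \<in> vcarrier V \<Longrightarrow> y \<in> vcarrier V \<Longrightarrow> x - y \<in> vcarrier V"
    and "x \<in> vcarrier V \<Longrightarrow> vscale V c x \<in> vcarrier V"
    using S by (auto intro: subspace_0 subspace_add subspace_neg subspace_diff subspace_scale)
qed

lemma linear_onD:
  assumes "linear_on V W f" and "is_vspace V"
  shows "x \<in> vcarrier V \<Longrightarrow> f x \<in> vcarrier W"
    and "x \<in> vcarrier V \<Longrightarrow> y \<in> vcarrier V \<Longrightarrow> f (x + y) = f x + f y"
    and "f 0 = 0"
    and "x \<in> vcarrier V \<Longrightarrow> f (- x) = - f x"
    and "x \<in> vcarrier V \<Longrightarrow> y \<in> vcarrier V \<Longrightarrow> f (x - y) = f x - f y"
    and "x \<in> vcarrier V \<Longrightarrow> f (vscale V c x) = vscale W c (f x)"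
proof -
  note V = is_vspace_closed[OF assms(2)]
  have add: "f (x + y) = f x + f y" if "x \<in> vcarrier V" "y \<in> vcarrier V" for x y
    using assms(1) that by (simp add: linear_on_def)
  have zero: "f 0 = 0" using add[of 0 0] V(1) by simp
  have neg: "f (- x) = - f x" if "x \<in> vcarrier V" for x
    using add[of "- x" x] V(3)[OF that] that zero by (simp add: eq_neg_iff_add_eq_0)
  show "x \<in> vcarrier V \<Longrightarrow> f x \<in> vcarrier W"
    and "x \<in> vcarrier V \<Longrightarrow> f (vscale V c x) = vscale W c (f x)"
    using assms(1) by (auto simp: linear_on_def)
  show "x \<in> vcarrier V \<Longrightarrow> y \<in> vcarrier V \<Longrightarrow> f (x + y) = f x + f y" by (rule add)
  show "f 0 = 0" by (rule zero)
  show "x \<in> vcarrier V \<Longrightarrow> f (- x) = - f x" by (rule neg)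
  show "x \<in> vcarrier V \<Longrightarrow> y \<in> vcarrier V \<Longrightarrow> f (x - y) = f x - f y"
    using add[of x "- y"] neg[of y] V(3) by simp
qed

lemma bilinear_onD:
  assumes "bilinear_on U V W f"
  shows "y \<in> vcarrier V \<Longrightarrow> linear_on U W (\<lambda>x. f x y)"
    and "x \<in> vcarrier U \<Longrightarrow> linear_on V W (f x)"
  using assms by (auto simp: bilinear_on_def)

lemma trilinear_onD:
  assumes "trilinear_on T U V W f"
  shows "y \<in> vcarrier U \<Longrightarrow> z \<in> vcarrier V \<Longrightarrow> linear_on T W (\<lambda>x. f x y z)"
    and "x \<in> vcarrier T \<Longrightarrow> z \<in> vcarrier V \<Longrightarrow> linear_on U W (\<lambda>y. f x y z)"
    and "x \<in> vcarrier T \<Longrightarrow> y \<in> vcarrier U \<Longrightarrow> linear_on V W (f x y)"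
  using assms by (auto simp: trilinear_on_def)

lemma scalars_simps [simp]: "vscale scalars = (*)" "vcarrier scalars = UNIV"
  by (simp_all add: scalars_def whole_def)

lemma dsum_simps [simp]:
  "vcarrier (dsum V W) = vcarrier V \<times> vcarrier W"
  "vscale (dsum V W) c (v, w) = (vscale V c v, vscale W c w)"
  by (simp_all add: dsum_def)

lemma vspace_scale_add:
  assumes "is_vspace V"
  shows "vscale V c (x + y) = vscale V c x + vscale V c y"
    and "vscale V c (x - y) = vscale V c x - vscale V c y"
    and "vscale V c (- x) = - vscale V c x"
    and "vscale V c 0 = 0"
proof -
  interpret vector_space "vscale V" using assms by (simp add: is_vspace_def)
  show "vscale V c (x + y) = vscale V c x + vscale V c y"
    and "vscale V c (x - y) = vscale V c x - vscale V c y"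
    and "vscale V c (- x) = - vscale V c x"
    and "vscale V c 0 = 0"
    by (simp_all add: scale_right_distrib scale_right_diff_distrib)
qed

lemma is_vspace_dsum:
  assumes "is_vspace V" "is_vspace W"
  shows "is_vspace (dsum V W)"
proof -
  interpret V: vector_space "vscale V" using assms by (simp add: is_vspace_def)
  interpret W: vector_space "vscale W" using assms by (simp add: is_vspace_def)
  have s: "vscale (dsum V W) = (\<lambda>c (v, w). (vscale V c v, vscale W c w))"
    by (simp add: dsum_def)
  have vs: "vector_space (vscale (dsum V W))"
    unfolding s
    by unfold_locales (auto simp: V.scale_right_distrib W.scale_right_distrib
        V.scale_left_distrib W.scale_left_distrib)
  then interpret D: vector_space "vscale (dsum V W)" .
  have "D.subspace (vcarrier (dsum V W))"
    unfolding D.subspace_def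
    using is_vspace_closed[OF assms(1)] is_vspace_closed[OF assms(2)]
    by (auto simp: zero_prod_def)
  with vs show ?thesis by (simp add: is_vspace_def)
qed

section \<open>Perfect pairings of Poisson 3-Lie algebras\<close>

text \<open>
  The bialgebra identities evaluated at functionals, for the actions \<open>\<rho>A\<close> and \<open>\<mu>A\<close> of
  \<open>A\<close> on its dual.
\<close>

definition pairing_compatible ::
    "('k::field, 'v::ab_group_add) vspace \<Rightarrow> ('k, 'w::ab_group_add) vspace \<Rightarrow> ('v \<Rightarrow> 'w \<Rightarrow> 'k)
    \<Rightarrow> ('v \<Rightarrow> 'v \<Rightarrow> 'v) \<Rightarrow> ('v \<Rightarrow> 'v \<Rightarrow> 'v \<Rightarrow> 'v) \<Rightarrow> ('w \<Rightarrow> 'w \<Rightarrow> 'w) \<Rightarrow> ('w \<Rightarrow> 'w \<Rightarrow> 'w \<Rightarrow> 'w)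
    \<Rightarrow> ('v \<Rightarrow> 'v \<Rightarrow> 'w \<Rightarrow> 'w) \<Rightarrow> ('v \<Rightarrow> 'w \<Rightarrow> 'w) \<Rightarrow> bool" where
  "pairing_compatible A B p mA brA mB brB \<rho>A \<mu>A \<longleftrightarrow>
     (\<forall>x\<in>vcarrier A. \<forall>y\<in>vcarrier A. \<forall>z\<in>vcarrier A. \<forall>a\<in>vcarrier B. \<forall>b\<in>vcarrier B. \<forall>c\<in>vcarrier B.
        p (mA x y) (mB a b) = p y (mB (\<mu>A x a) b) + p x (mB a (\<mu>A y b)) \<and>
        p (brA x y z) (brB a b c)
          = - (p x (brB a b (\<rho>A y z c)) + p y (brB a b (\<rho>A z x c)) + p z (brB a b (\<rho>A x y c))) \<and>
        p (brA x y z) (brB a b c)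
          = - (p x (brB a b (\<rho>A y z c)) + p x (brB a (\<rho>A y z b) c) + p x (brB (\<rho>A y z a) b c)) \<and>
        p (brA x y z) (mB a b) = - (p x (mB a (\<rho>A y z b)) + p x (mB (\<rho>A y z a) b)) \<and>
        p (mA x y) (brB a b c) = p x (brB (\<mu>A y a) b c) + p y (brB (\<mu>A x a) b c) \<and>
        p y (brB (\<mu>A x a) b c) = p y (brB a b (\<mu>A x c)) \<and>
        p z (mB a (\<rho>A x y b)) = p x (mB a (\<rho>A y z b)))"

text \<open>Every assumption is accompanied by its mirror image. The actions are arbitrary functions
  that preserve the carriers: the adjunctions and nondegeneracy determine them, and their linearity
  is derived in \<open>rhoA_trilinear\<close> and \<open>muA_bilinear\<close>.\<close>

locale poisson_pairing =
  fixes A :: "('k::field, 'v::ab_group_add) vspace" and B :: "('k, 'w::ab_group_add) vspace"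
    and p :: "'v \<Rightarrow> 'w \<Rightarrow> 'k"
    and mA :: "'v \<Rightarrow> 'v \<Rightarrow> 'v" and brA :: "'v \<Rightarrow> 'v \<Rightarrow> 'v \<Rightarrow> 'v"
    and mB :: "'w \<Rightarrow> 'w \<Rightarrow> 'w" and brB :: "'w \<Rightarrow> 'w \<Rightarrow> 'w \<Rightarrow> 'w"
    and \<rho>A :: "'v \<Rightarrow> 'v \<Rightarrow> 'w \<Rightarrow> 'w" and \<mu>A :: "'v \<Rightarrow> 'w \<Rightarrow> 'w"
    and \<rho>B :: "'w \<Rightarrow> 'w \<Rightarrow> 'v \<Rightarrow> 'v" and \<mu>B :: "'w \<Rightarrow> 'v \<Rightarrow> 'v"
  assumes algA: "poisson_lie3_algebra A mA brA"
    and algB: "poisson_lie3_algebra B mB brB"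
    and p_bilinear: "bilinear_on A B scalars p"
    and nondegA: "\<lbrakk>x \<in> vcarrier A; \<And>b. b \<in> vcarrier B \<Longrightarrow> p x b = 0\<rbrakk> \<Longrightarrow> x = 0"
    and nondegB: "\<lbrakk>b \<in> vcarrier B; \<And>x. x \<in> vcarrier A \<Longrightarrow> p x b = 0\<rbrakk> \<Longrightarrow> b = 0"
    and rhoA_closed: "\<lbrakk>x \<in> vcarrier A; y \<in> vcarrier A; b \<in> vcarrier B\<rbrakk> \<Longrightarrow> \<rho>A x y b \<in> vcarrier B"
    and muA_closed: "\<lbrakk>x \<in> vcarrier A; b \<in> vcarrier B\<rbrakk> \<Longrightarrow> \<mu>A x b \<in> vcarrier B"
    and rhoB_closed: "\<lbrakk>a \<in> vcarrier B; b \<in> vcarrier B; x \<in> vcarrier A\<rbrakk> \<Longrightarrow> \<rho>B a b x \<in> vcarrier A"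
    and muB_closed: "\<lbrakk>a \<in> vcarrier B; x \<in> vcarrier A\<rbrakk> \<Longrightarrow> \<mu>B a x \<in> vcarrier A"
    and rhoA_adj: "\<lbrakk>x \<in> vcarrier A; y \<in> vcarrier A; z \<in> vcarrier A; b \<in> vcarrier B\<rbrakk>
        \<Longrightarrow> p z (\<rho>A x y b) = - p (brA x y z) b"
    and muA_adj: "\<lbrakk>x \<in> vcarrier A; z \<in> vcarrier A; b \<in> vcarrier B\<rbrakk>
        \<Longrightarrow> p z (\<mu>A x b) = p (mA x z) b"
    and rhoB_adj: "\<lbrakk>a \<in> vcarrier B; b \<in> vcarrier B; c \<in> vcarrier B; x \<in> vcarrier A\<rbrakk>
        \<Longrightarrow> p (\<rho>B a b x) c = - p x (brB a b c)"
    and muB_adj: "\<lbrakk>a \<in> vcarrier B; c \<in> vcarrier B; x \<in> vcarrier A\<rbrakk>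
        \<Longrightarrow> p (\<mu>B a x) c = p x (mB a c)"
begin

text \<open>This halves the work: a fact about values in \<open>A\<close>, read for the pairing with
  exchanged sides, is the corresponding fact about values in \<open>B\<close>.\<close>

lemma swap: "poisson_pairing B A (\<lambda>b a. p a b) mB brB mA brA \<rho>B \<mu>B \<rho>A \<mu>A"
proof
  show "bilinear_on B A scalars (\<lambda>b a. p a b)"
    using p_bilinear by (auto simp: bilinear_on_def)
qed (rule algA algB nondegA nondegB rhoA_closed muA_closed rhoB_closed muB_closed
      rhoA_adj muA_adj rhoB_adj muB_adj; assumption)+

lemma vsA: "is_vspace A" and mA_bil: "bilinear_on A A A mA" and brA_tri: "trilinear_on A A A A brA"
  using algA by (simp_all add: poisson_lie3_algebra_def comm_assoc_algebra_def lie3_algebra_def)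

lemma vsB: "is_vspace B" and mB_bil: "bilinear_on B B B mB" and brB_tri: "trilinear_on B B B B brB"
  using algB by (simp_all add: poisson_lie3_algebra_def comm_assoc_algebra_def lie3_algebra_def)

lemmas closedA [simp] = is_vspace_closed[OF vsA]
lemmas closedB [simp] = is_vspace_closed[OF vsB]

lemmas p_lin [simp] =
  linear_onD(2-6)[OF bilinear_onD(1)[OF p_bilinear] vsA]
  linear_onD(2-6)[OF bilinear_onD(2)[OF p_bilinear] vsB]
lemmas mA_lin [simp] =
  linear_onD[OF bilinear_onD(1)[OF mA_bil] vsA] linear_onD(2-6)[OF bilinear_onD(2)[OF mA_bil] vsA]
lemmas mB_lin [simp] =
  linear_onD[OF bilinear_onD(1)[OF mB_bil] vsB] linear_onD(2-6)[OF bilinear_onD(2)[OF mB_bil] vsB]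
lemmas brA_lin [simp] = linear_onD[OF trilinear_onD(1)[OF brA_tri] vsA]
  linear_onD(2-6)[OF trilinear_onD(2)[OF brA_tri] vsA]
  linear_onD(2-6)[OF trilinear_onD(3)[OF brA_tri] vsA]
lemmas brB_lin [simp] = linear_onD[OF trilinear_onD(1)[OF brB_tri] vsB]
  linear_onD(2-6)[OF trilinear_onD(2)[OF brB_tri] vsB]
  linear_onD(2-6)[OF trilinear_onD(3)[OF brB_tri] vsB]
lemmas action_closed [simp] = rhoA_closed muA_closed rhoB_closed muB_closed

lemma eqA:
  assumes "x \<in> vcarrier A" "y \<in> vcarrier A" "\<And>b. b \<in> vcarrier B \<Longrightarrow> p x b = p y b"
  shows "x = y"
  using nondegA[of "x - y"] assms by simp

lemma eqB:
  assumes "a \<in> vcarrier B" "b \<in> vcarrier B" "\<And>x. x \<in> vcarrier A \<Longrightarrow> p x a = p x b"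
  shows "a = b"
  using nondegB[of "a - b"] assms by simp

lemma mA_comm: "\<lbrakk>x \<in> vcarrier A; y \<in> vcarrier A\<rbrakk> \<Longrightarrow> mA x y = mA y x"
  and mA_assoc: "\<lbrakk>x \<in> vcarrier A; y \<in> vcarrier A; z \<in> vcarrier A\<rbrakk> \<Longrightarrow> mA (mA x y) z = mA x (mA y z)"
  using algA unfolding poisson_lie3_algebra_def comm_assoc_algebra_def by blast+

lemma brA_skew:
  "\<lbrakk>x \<in> vcarrier A; y \<in> vcarrier A; z \<in> vcarrier A\<rbrakk> \<Longrightarrow> brA y x z = - brA x y z"
  "\<lbrakk>x \<in> vcarrier A; y \<in> vcarrier A; z \<in> vcarrier A\<rbrakk> \<Longrightarrow> brA x z y = - brA x y z"
  using algA unfolding poisson_lie3_algebra_def lie3_algebra_def skew3_on_def by blast+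

lemma brA_rot:
  "\<lbrakk>x \<in> vcarrier A; y \<in> vcarrier A; z \<in> vcarrier A\<rbrakk> \<Longrightarrow> brA y z x = brA x y z"
  using brA_skew(1)[of x y z] brA_skew(2)[of y x z] by simp

lemma brA_fi:
  "\<lbrakk>x1 \<in> vcarrier A; x2 \<in> vcarrier A; x3 \<in> vcarrier A; x4 \<in> vcarrier A; x5 \<in> vcarrier A\<rbrakk> \<Longrightarrow>
   brA x1 x2 (brA x3 x4 x5) =
     brA (brA x1 x2 x3) x4 x5 + brA x3 (brA x1 x2 x4) x5 + brA x3 x4 (brA x1 x2 x5)"
  using algA unfolding poisson_lie3_algebra_def lie3_algebra_def by blast

lemma leibnizA:
  "\<lbrakk>w \<in> vcarrier A; x \<in> vcarrier A; y \<in> vcarrier A; z \<in> vcarrier A\<rbrakk> \<Longrightarrow>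
   brA (mA w x) y z = mA w (brA x y z) + mA x (brA w y z)"
  using algA unfolding poisson_lie3_algebra_def by blast

text \<open>With the product in the last slot, the Leibniz rule becomes a property of the operator
  \<open>brA y z\<close>. This is the form that the adjunction of \<open>\<rho>A\<close>
  produces.\<close>

lemma leibnizA3:
  assumes "w \<in> vcarrier A" "x \<in> vcarrier A" "y \<in> vcarrier A" "z \<in> vcarrier A"
  shows "brA y z (mA w x) = mA w (brA y z x) + mA x (brA y z w)"
proof -
  have "brA y z (mA w x) = brA (mA w x) y z" using assms by (intro brA_rot) simp_all
  also have "\<dots> = mA w (brA x y z) + mA x (brA w y z)" using assms by (intro leibnizA)
  also have "brA x y z = brA y z x" using assms by (intro brA_rot[symmetric])
  also have "brA w y z = brA y z w" using assms by (intro brA_rot[symmetric])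
  finally show ?thesis .
qed

section \<open>The coadjoint actions are representations\<close>

lemma rhoA_trilinear: "trilinear_on A A B B \<rho>A"
  unfolding trilinear_on_def linear_on_def
  by (intro conjI ballI allI; (rule eqB)?; simp add: rhoA_adj)

lemma muA_bilinear: "bilinear_on A B B \<mu>A"
  unfolding bilinear_on_def linear_on_def
  by (intro conjI ballI allI; (rule eqB)?; simp add: muA_adj)

lemmas rhoA_lin [simp] =
  linear_onD(2-6)[OF trilinear_onD(1)[OF rhoA_trilinear] vsA]
  linear_onD(2-6)[OF trilinear_onD(2)[OF rhoA_trilinear] vsA]
  linear_onD(2-6)[OF trilinear_onD(3)[OF rhoA_trilinear] vsB]
lemmas muA_lin [simp] =
  linear_onD(2-6)[OF bilinear_onD(1)[OF muA_bilinear] vsA]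
  linear_onD(2-6)[OF bilinear_onD(2)[OF muA_bilinear] vsB]

lemma rhoA_skew:
  "\<lbrakk>x \<in> vcarrier A; y \<in> vcarrier A; b \<in> vcarrier B\<rbrakk> \<Longrightarrow> \<rho>A y x b = - \<rho>A x y b"
  by (rule eqB) (simp_all add: rhoA_adj brA_skew(1)[of x y])

text \<open>Transposition reverses composites, so the second composition axiom of
  \<open>lie3_rep\<close> for the coadjoint action becomes this identity of vectors. Each product on
  the left differs from the product with its two operators exchanged by correction terms among
  \<open>a\<close>, \<open>b\<close>, \<open>c\<close>. The corrections add up to twice
  \<open>- d\<close>, and the exchanged products add up to \<open>d\<close>.\<close>

lemma fi_dual:
  assumes [simp]: "x1 \<in> vcarrier A" "x2 \<in> vcarrier A" "x3 \<in> vcarrier A" "x4 \<in> vcarrier A"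
    "v \<in> vcarrier A"
  shows "brA x3 x4 (brA x1 x2 v) + brA x1 x4 (brA x2 x3 v) + brA x2 x4 (brA x3 x1 v)
     = - brA (brA x1 x2 x3) x4 v"
proof -
  define a b c d where "a = brA (brA x1 x4 x3) x2 v" and "b = brA (brA x2 x4 x3) x1 v"
    and "c = brA (brA x1 x4 x2) x3 v" and "d = brA (brA x1 x2 x3) x4 v"
  note defs = a_def b_def c_def d_def
  have sk: "brA x3 x4 x1 = - brA x1 x4 x3" "brA x3 x4 x2 = - brA x2 x4 x3"
    "brA x2 x4 x1 = - brA x1 x4 x2" "brA x1 x2 x4 = - brA x1 x4 x2"
    using brA_rot[of x1 x3 x4] brA_skew(2)[of x1 x4 x3] brA_rot[of x2 x3 x4]
      brA_skew(2)[of x2 x4 x3]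
      brA_rot[of x1 x2 x4] brA_skew(2)[of x1 x4 x2] by simp_all
  have swap12: "brA x u v = - brA u x v" if "x \<in> vcarrier A" "u \<in> vcarrier A" for x u
    by (rule brA_skew(1)) (use that in simp_all)
  have 0: "brA x1 x2 (brA x3 x4 v) = d + c + brA x3 x4 (brA x1 x2 v)"
    using brA_fi[of x1 x2 x3 x4 v] swap12[of x3 "brA x1 x4 x2"] by (simp add: defs sk)
  have 1: "brA x3 x4 (brA x1 x2 v) = - a + b + brA x1 x2 (brA x3 x4 v)"
    using brA_fi[of x3 x4 x1 x2 v] swap12[of x1 "brA x2 x4 x3"] by (simp add: defs sk)
  \<comment> \<open>\<open>0\<close> and \<open>1\<close> compute opposite commutators of the same
    two operators, so their correction terms sum to zero.\<close>
  have "d + c + (b - a) = 0"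
  proof -
    have "d + c = brA x1 x2 (brA x3 x4 v) - brA x3 x4 (brA x1 x2 v)"
      unfolding 0 by (simp only: add_diff_cancel_right')
    moreover have "b - a = brA x3 x4 (brA x1 x2 v) - brA x1 x2 (brA x3 x4 v)"
      unfolding 1 by (simp only: add_diff_cancel_right' uminus_add_conv_diff)
    ultimately show ?thesis by simp
  qed
  then have "d + c + b = a" by (simp add: add_diff_eq)
  then have d: "d = a - b - c" by (simp add: algebra_simps)
  have 2: "brA x1 x4 (brA x2 x3 v) = c - a + brA x2 x3 (brA x1 x4 v)"
    using brA_fi[of x1 x4 x2 x3 v] swap12[of x2 "brA x1 x4 x3"] by (simp add: defs)
  have 3: "brA x2 x4 (brA x3 x1 v) = b + c + brA x3 x1 (brA x2 x4 v)"
    using brA_fi[of x2 x4 x3 x1 v] swap12[of x3 "brA x1 x4 x2"] by (simp add: defs sk)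
  \<comment> \<open>After the rotation \<open>brA x1 x2 x3\<close> is the inner bracket, and the
    fundamental identity for the operator \<open>brA x4 v\<close> writes \<open>d\<close> as the sum
    of the three exchanged products.\<close>
  have "d = brA x4 v (brA x1 x2 x3)"
    unfolding d_def by (rule brA_rot[symmetric]) simp_all
  also have "\<dots> = brA (brA x4 v x1) x2 x3 + brA x1 (brA x4 v x2) x3 + brA x1 x2 (brA x4 v x3)"
    by (rule brA_fi) simp_all
  also have "brA (brA x4 v x1) x2 x3 = brA x2 x3 (brA x1 x4 v)"
    by (subst brA_rot[of x1 x4 v]) (simp_all add: brA_rot[of "brA x1 x4 v" x2 x3])
  also have "brA x1 (brA x4 v x2) x3 = brA x3 x1 (brA x2 x4 v)"
    by (subst brA_rot[of x2 x4 v]) (simp_all add: brA_rot[of x3 x1 "brA x2 x4 v"])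
  also have "brA x1 x2 (brA x4 v x3) = brA x1 x2 (brA x3 x4 v)"
    by (subst brA_rot[of x3 x4 v]) simp_all
  finally have "brA x1 x2 (brA x3 x4 v) = d - brA x2 x3 (brA x1 x4 v) - brA x3 x1 (brA x2 x4 v)"
    by (simp add: algebra_simps)
  then have "brA x3 x4 (brA x1 x2 v) + brA x1 x4 (brA x2 x3 v) + brA x2 x4 (brA x3 x1 v) = - d"
    unfolding 1 2 3 d by (simp add: algebra_simps)
  then show ?thesis by (simp add: d_def)
qed

lemma lie3_repA: "lie3_rep A brA B \<rho>A"
  unfolding lie3_rep_def
proof (intro conjI ballI vsB rhoA_trilinear)
  show "\<rho>A y x v = - \<rho>A x y v" if "x \<in> vcarrier A" "y \<in> vcarrier A" "v \<in> vcarrier B" for x y v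
    using that by (rule rhoA_skew)
next
  fix x1 x2 x3 x4 v
  assume [simp]: "x1 \<in> vcarrier A" "x2 \<in> vcarrier A" "x3 \<in> vcarrier A" "x4 \<in> vcarrier A"
    "v \<in> vcarrier B"
  show "\<rho>A x1 x2 (\<rho>A x3 x4 v) - \<rho>A x3 x4 (\<rho>A x1 x2 v)
    = \<rho>A (brA x1 x2 x3) x4 v - \<rho>A (brA x1 x2 x4) x3 v"
  proof (rule eqB)
    fix z assume [simp]: "z \<in> vcarrier A"
    show "p z (\<rho>A x1 x2 (\<rho>A x3 x4 v) - \<rho>A x3 x4 (\<rho>A x1 x2 v))
        = p z (\<rho>A (brA x1 x2 x3) x4 v - \<rho>A (brA x1 x2 x4) x3 v)"
      using brA_skew(1)[of x3 "brA x1 x2 x4" z]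
      by (simp add: rhoA_adj brA_fi[of x1 x2 x3 x4 z])
  qed simp_all
next
  fix x1 x2 x3 x4 v
  assume [simp]: "x1 \<in> vcarrier A" "x2 \<in> vcarrier A" "x3 \<in> vcarrier A" "x4 \<in> vcarrier A"
    "v \<in> vcarrier B"
  show "\<rho>A (brA x1 x2 x3) x4 v
      = \<rho>A x1 x2 (\<rho>A x3 x4 v) + \<rho>A x2 x3 (\<rho>A x1 x4 v) + \<rho>A x3 x1 (\<rho>A x2 x4 v)"
  proof (rule eqB)
    fix z assume [simp]: "z \<in> vcarrier A"
    show "p z (\<rho>A (brA x1 x2 x3) x4 v)
      = p z (\<rho>A x1 x2 (\<rho>A x3 x4 v) + \<rho>A x2 x3 (\<rho>A x1 x4 v) + \<rho>A x3 x1 (\<rho>A x2 x4 v))"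
      using arg_cong[OF fi_dual[of x1 x2 x3 x4 z], of "\<lambda>u. p u v"] by (simp add: rhoA_adj)
  qed simp_all
qed

text \<open>Transposition reverses the composite, and commutativity of the product restores the
  order.\<close>

lemma comm_assoc_repA: "comm_assoc_rep A mA B \<mu>A"
  unfolding comm_assoc_rep_def
proof (intro conjI ballI vsB muA_bilinear)
  show "\<mu>A (mA x y) v = \<mu>A x (\<mu>A y v)"
    if "x \<in> vcarrier A" "y \<in> vcarrier A" "v \<in> vcarrier B" for x y v
    by (rule eqB) (use that in \<open>simp_all add: muA_adj mA_assoc[symmetric] mA_comm[of y x]\<close>)
qed

lemma poisson_repA: "poisson_lie3_rep A mA brA B \<rho>A \<mu>A"
  unfolding poisson_lie3_rep_def
proof (intro conjI ballI comm_assoc_repA lie3_repA)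
  fix x y z v
  assume [simp]: "x \<in> vcarrier A" "y \<in> vcarrier A" "z \<in> vcarrier A" "v \<in> vcarrier B"
  show "\<rho>A (mA x y) z v = \<mu>A x (\<rho>A y z v) + \<mu>A y (\<rho>A x z v)"
  proof (rule eqB)
    fix u assume [simp]: "u \<in> vcarrier A"
    \<comment> \<open>The right-hand side expands to two further terms,
      \<open>mA u (brA y z x)\<close> and \<open>mA u (brA x z y)\<close>, which cancel by skew
      symmetry.\<close>
    have "brA (mA x y) z u = brA y z (mA x u) + brA x z (mA y u)"
      using brA_rot[of x y z] brA_skew(2)[of x y z] by (simp add: leibnizA leibnizA3)
    then show "p u (\<rho>A (mA x y) z v) = p u (\<mu>A x (\<rho>A y z v) + \<mu>A y (\<rho>A x z v))"
      by (simp add: muA_adj rhoA_adj)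
  qed simp_all
  show "\<rho>A x y (\<mu>A z v) = \<mu>A (brA x y z) v + \<mu>A z (\<rho>A x y v)"
  proof (rule eqB)
    fix u assume [simp]: "u \<in> vcarrier A"
    have "mA z (brA x y u) + mA (brA x y z) u = brA x y (mA z u)"
      by (simp add: leibnizA3 mA_comm[of "brA x y z" u])
    from arg_cong[OF this, of "\<lambda>w. p w v"]
    show "p u (\<rho>A x y (\<mu>A z v)) = p u (\<mu>A (brA x y z) v + \<mu>A z (\<rho>A x y v))"
      by (simp add: muA_adj rhoA_adj algebra_simps)
  qed simp_all
qed

section \<open>Normal forms of the scalar expressions\<close>

lemma brB_skew:
  "\<lbrakk>a \<in> vcarrier B; b \<in> vcarrier B; c \<in> vcarrier B\<rbrakk> \<Longrightarrow> brB b a c = - brB a b c"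
  "\<lbrakk>a \<in> vcarrier B; b \<in> vcarrier B; c \<in> vcarrier B\<rbrakk> \<Longrightarrow> brB a c b = - brB a b c"
  using poisson_pairing.brA_skew[OF swap] by blast+

lemma brB_rot: "\<lbrakk>a \<in> vcarrier B; b \<in> vcarrier B; c \<in> vcarrier B\<rbrakk> \<Longrightarrow> brB b c a = brB a b c"
  using poisson_pairing.brA_rot[OF swap] .

lemma mB_comm: "\<lbrakk>a \<in> vcarrier B; b \<in> vcarrier B\<rbrakk> \<Longrightarrow> mB a b = mB b a"
  using poisson_pairing.mA_comm[OF swap] .

text \<open>The following rules move every action to the last argument of an operation on \<open>B\<close>.\<close>

lemma normalize_brackets:
  shows "\<lbrakk>x \<in> vcarrier A; y \<in> vcarrier A; z \<in> vcarrier A; a \<in> vcarrier B; b \<in> vcarrier B; c \<in>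
    vcarrier B\<rbrakk> \<Longrightarrow>
      p (brA x y (\<rho>B b c z)) a = p z (brB b c (\<rho>A x y a))"
    and "\<lbrakk>x \<in> vcarrier A; y \<in> vcarrier A; z \<in> vcarrier A; a \<in> vcarrier B; b \<in> vcarrier B; c \<in>
      vcarrier B\<rbrakk> \<Longrightarrow>
      p (brA x (\<rho>B b c y) z) a = p y (brB b c (\<rho>A z x a))"
    and "\<lbrakk>x \<in> vcarrier A; y \<in> vcarrier A; z \<in> vcarrier A; a \<in> vcarrier B; b \<in> vcarrier B; c \<in>
      vcarrier B\<rbrakk> \<Longrightarrow>
      p (brA (\<rho>B b c x) y z) a = p x (brB b c (\<rho>A y z a))"
    and "\<lbrakk>x \<in> vcarrier A; y \<in> vcarrier A; a \<in> vcarrier B; b \<in> vcarrier B; c \<in> vcarrier B\<rbrakk> \<Longrightarrow>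
      p (mA x (\<rho>B b c y)) a = - p y (brB b c (\<mu>A x a))"
    and "\<lbrakk>x \<in> vcarrier A; y \<in> vcarrier A; a \<in> vcarrier B; b \<in> vcarrier B; c \<in> vcarrier B\<rbrakk> \<Longrightarrow>
      p (mA (\<rho>B b c x) y) a = - p x (brB b c (\<mu>A y a))"
    and "\<lbrakk>x \<in> vcarrier A; y \<in> vcarrier A; z \<in> vcarrier A; a \<in> vcarrier B; b \<in> vcarrier B\<rbrakk> \<Longrightarrow>
      p (brA x y (\<mu>B a z)) b = - p z (mB a (\<rho>A x y b))"
    and "\<lbrakk>x \<in> vcarrier A; y \<in> vcarrier A; z \<in> vcarrier A; a \<in> vcarrier B; b \<in> vcarrier B\<rbrakk> \<Longrightarrow>
      p (brA (\<mu>B a x) y z) b = - p x (mB a (\<rho>A y z b))"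
    and "\<lbrakk>x \<in> vcarrier A; y \<in> vcarrier A; a \<in> vcarrier B; b \<in> vcarrier B\<rbrakk> \<Longrightarrow>
      p (mA (\<mu>B a x) y) b = p x (mB a (\<mu>A y b))"
    and "\<lbrakk>x \<in> vcarrier A; y \<in> vcarrier A; a \<in> vcarrier B; b \<in> vcarrier B\<rbrakk> \<Longrightarrow>
      p (mA x (\<mu>B a y)) b = p y (mB a (\<mu>A x b))"
    and "\<lbrakk>x \<in> vcarrier A; y \<in> vcarrier A; z \<in> vcarrier A; a \<in> vcarrier B; b \<in> vcarrier B; c \<in>
      vcarrier B\<rbrakk> \<Longrightarrow>
      p x (brB (\<rho>A y z a) b c) = p x (brB b c (\<rho>A y z a))"
    and "\<lbrakk>x \<in> vcarrier A; y \<in> vcarrier A; z \<in> vcarrier A; a \<in> vcarrier B; b \<in> vcarrier B; c \<in>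
      vcarrier B\<rbrakk> \<Longrightarrow>
      p x (brB b (\<rho>A y z a) c) = p x (brB c b (\<rho>A y z a))"
    and "\<lbrakk>x \<in> vcarrier A; y \<in> vcarrier A; a \<in> vcarrier B; b \<in> vcarrier B; c \<in> vcarrier B\<rbrakk> \<Longrightarrow>
      p x (brB (\<mu>A y a) b c) = p x (brB b c (\<mu>A y a))"
    and "\<lbrakk>x \<in> vcarrier A; y \<in> vcarrier A; z \<in> vcarrier A; a \<in> vcarrier B; b \<in> vcarrier B\<rbrakk> \<Longrightarrow>
      p x (mB (\<rho>A y z a) b) = p x (mB b (\<rho>A y z a))"
    and "\<lbrakk>x \<in> vcarrier A; y \<in> vcarrier A; a \<in> vcarrier B; b \<in> vcarrier B\<rbrakk> \<Longrightarrow>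
      p x (mB (\<mu>A y a) b) = p x (mB b (\<mu>A y a))"
proof -
  \<comment> \<open>The adjunctions for \<open>A\<close> are needed in reverse: an operation of
    \<open>A\<close> on the left of the pairing becomes an action on its right. Rotation or
    commutativity first brings the argument that carries an action into the last slot.\<close>
  have r: "p (brA u v w) e = - p w (\<rho>A u v e)"
    if "u \<in> vcarrier A" "v \<in> vcarrier A" "w \<in> vcarrier A" "e \<in> vcarrier B" for u v w e
    using that by (simp add: rhoA_adj)
  have m: "p (mA u v) e = p v (\<mu>A u e)"
    if "u \<in> vcarrier A" "v \<in> vcarrier A" "e \<in> vcarrier B" for u v e
    using that by (simp add: muA_adj)
  show "\<lbrakk>x \<in> vcarrier A; y \<in> vcarrier A; z \<in> vcarrier A; a \<in> vcarrier B; b \<in> vcarrier B; c \<in>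
    vcarrier B\<rbrakk> \<Longrightarrow>
      p (brA x y (\<rho>B b c z)) a = p z (brB b c (\<rho>A x y a))"
    by (simp add: r rhoB_adj)
  show "\<lbrakk>x \<in> vcarrier A; y \<in> vcarrier A; z \<in> vcarrier A; a \<in> vcarrier B; b \<in> vcarrier B; c \<in>
    vcarrier B\<rbrakk> \<Longrightarrow>
      p (brA x (\<rho>B b c y) z) a = p y (brB b c (\<rho>A z x a))"
    by (subst brA_rot[of z x "\<rho>B b c y"]; simp add: r rhoB_adj)
  show "\<lbrakk>x \<in> vcarrier A; y \<in> vcarrier A; z \<in> vcarrier A; a \<in> vcarrier B; b \<in> vcarrier B; c \<in>
    vcarrier B\<rbrakk> \<Longrightarrow>
      p (brA (\<rho>B b c x) y z) a = p x (brB b c (\<rho>A y z a))"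
    by (subst brA_rot[symmetric]; simp add: r rhoB_adj)
  show "\<lbrakk>x \<in> vcarrier A; y \<in> vcarrier A; a \<in> vcarrier B; b \<in> vcarrier B; c \<in> vcarrier B\<rbrakk> \<Longrightarrow>
      p (mA x (\<rho>B b c y)) a = - p y (brB b c (\<mu>A x a))"
    by (simp add: m rhoB_adj)
  show "\<lbrakk>x \<in> vcarrier A; y \<in> vcarrier A; a \<in> vcarrier B; b \<in> vcarrier B; c \<in> vcarrier B\<rbrakk> \<Longrightarrow>
      p (mA (\<rho>B b c x) y) a = - p x (brB b c (\<mu>A y a))"
    by (subst mA_comm; simp add: m rhoB_adj)
  show "\<lbrakk>x \<in> vcarrier A; y \<in> vcarrier A; z \<in> vcarrier A; a \<in> vcarrier B; b \<in> vcarrier B\<rbrakk> \<Longrightarrow>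
      p (brA x y (\<mu>B a z)) b = - p z (mB a (\<rho>A x y b))"
    by (simp add: r muB_adj)
  show "\<lbrakk>x \<in> vcarrier A; y \<in> vcarrier A; z \<in> vcarrier A; a \<in> vcarrier B; b \<in> vcarrier B\<rbrakk> \<Longrightarrow>
      p (brA (\<mu>B a x) y z) b = - p x (mB a (\<rho>A y z b))"
    by (subst brA_rot[symmetric]; simp add: r muB_adj)
  show "\<lbrakk>x \<in> vcarrier A; y \<in> vcarrier A; a \<in> vcarrier B; b \<in> vcarrier B\<rbrakk> \<Longrightarrow>
      p (mA (\<mu>B a x) y) b = p x (mB a (\<mu>A y b))"
    by (subst mA_comm; simp add: m muB_adj)
  show "\<lbrakk>x \<in> vcarrier A; y \<in> vcarrier A; a \<in> vcarrier B; b \<in> vcarrier B\<rbrakk> \<Longrightarrow>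
      p (mA x (\<mu>B a y)) b = p y (mB a (\<mu>A x b))"
    by (simp add: m muB_adj)
  show "\<lbrakk>x \<in> vcarrier A; y \<in> vcarrier A; z \<in> vcarrier A; a \<in> vcarrier B; b \<in> vcarrier B; c \<in>
    vcarrier B\<rbrakk> \<Longrightarrow>
      p x (brB (\<rho>A y z a) b c) = p x (brB b c (\<rho>A y z a))"
    by (subst brB_rot[symmetric]; simp)
  show "\<lbrakk>x \<in> vcarrier A; y \<in> vcarrier A; z \<in> vcarrier A; a \<in> vcarrier B; b \<in> vcarrier B; c \<in>
    vcarrier B\<rbrakk> \<Longrightarrow>
      p x (brB b (\<rho>A y z a) c) = p x (brB c b (\<rho>A y z a))"
    by (subst brB_rot; simp)
  show "\<lbrakk>x \<in> vcarrier A; y \<in> vcarrier A; a \<in> vcarrier B; b \<in> vcarrier B; c \<in> vcarrier B\<rbrakk> \<Longrightarrow>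
      p x (brB (\<mu>A y a) b c) = p x (brB b c (\<mu>A y a))"
    by (subst brB_rot[symmetric]; simp)
  show "\<lbrakk>x \<in> vcarrier A; y \<in> vcarrier A; z \<in> vcarrier A; a \<in> vcarrier B; b \<in> vcarrier B\<rbrakk> \<Longrightarrow>
      p x (mB (\<rho>A y z a) b) = p x (mB b (\<rho>A y z a))"
    by (subst mB_comm; simp)
  show "\<lbrakk>x \<in> vcarrier A; y \<in> vcarrier A; a \<in> vcarrier B; b \<in> vcarrier B\<rbrakk> \<Longrightarrow>
      p x (mB (\<mu>A y a) b) = p x (mB b (\<mu>A y a))"
    by (subst mB_comm; simp)
qed

section \<open>The seven scalar identities and the matched pair\<close>

abbreviation "compatible \<equiv> pairing_compatible A B p mA brA mB brB \<rho>A \<mu>A"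

text \<open>These are the normal forms of the seven identities. A vector identity that is paired
  with a functional and rewritten by \<open>normalize_brackets\<close> can be compared with them
  term by term. All seven are stated for the same six elements, so later instances contain fillers
  for the elements that an identity does not mention.\<close>

lemma compatibleD:
  assumes compatible and [simp]: "x \<in> vcarrier A" "y \<in> vcarrier A" "z \<in> vcarrier A"
    "a \<in> vcarrier B" "b \<in> vcarrier B" "c \<in> vcarrier B"
  shows "p (mA x y) (mB a b) = p y (mB b (\<mu>A x a)) + p x (mB a (\<mu>A y b))"
    and "p (brA x y z) (brB a b c)
      = - (p x (brB a b (\<rho>A y z c)) + p y (brB a b (\<rho>A z x c)) + p z (brB a b (\<rho>A x y c)))"
    and "p (brA x y z) (brB a b c)
      = - (p x (brB a b (\<rho>A y z c)) + p x (brB c a (\<rho>A y z b)) + p x (brB b c (\<rho>A y z a)))"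
    and "p (brA x y z) (mB a b) = - (p x (mB a (\<rho>A y z b)) + p x (mB b (\<rho>A y z a)))"
    and "p (mA x y) (brB a b c) = p x (brB b c (\<mu>A y a)) + p y (brB b c (\<mu>A x a))"
    and "p y (brB b c (\<mu>A x a)) = p y (brB a b (\<mu>A x c))"
    and "p z (mB a (\<rho>A x y b)) = p x (mB a (\<rho>A y z b))"
proof -
  have raw:
    "p (mA x y) (mB a b) = p y (mB (\<mu>A x a) b) + p x (mB a (\<mu>A y b))"
    "p (brA x y z) (brB a b c)
      = - (p x (brB a b (\<rho>A y z c)) + p y (brB a b (\<rho>A z x c)) + p z (brB a b (\<rho>A x y c)))"
    "p (brA x y z) (brB a b c)
      = - (p x (brB a b (\<rho>A y z c)) + p x (brB a (\<rho>A y z b) c) + p x (brB (\<rho>A y z a) b c))"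
    "p (brA x y z) (mB a b) = - (p x (mB a (\<rho>A y z b)) + p x (mB (\<rho>A y z a) b))"
    "p (mA x y) (brB a b c) = p x (brB (\<mu>A y a) b c) + p y (brB (\<mu>A x a) b c)"
    "p y (brB (\<mu>A x a) b c) = p y (brB a b (\<mu>A x c))"
    "p z (mB a (\<rho>A x y b)) = p x (mB a (\<rho>A y z b))"
    using assms(1)[unfolded pairing_compatible_def] assms(2-) by blast+
  show "p (mA x y) (mB a b) = p y (mB b (\<mu>A x a)) + p x (mB a (\<mu>A y b))"
    using raw(1) by (simp only: normalize_brackets(10-) assms(2-))
  show "p (brA x y z) (brB a b c)
      = - (p x (brB a b (\<rho>A y z c)) + p y (brB a b (\<rho>A z x c)) + p z (brB a b (\<rho>A x y c)))"
    by (fact raw(2))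
  show "p (brA x y z) (brB a b c)
      = - (p x (brB a b (\<rho>A y z c)) + p x (brB c a (\<rho>A y z b)) + p x (brB b c (\<rho>A y z a)))"
    using raw(3) by (simp only: normalize_brackets(10-) assms(2-))
  show "p (brA x y z) (mB a b) = - (p x (mB a (\<rho>A y z b)) + p x (mB b (\<rho>A y z a)))"
    using raw(4) by (simp only: normalize_brackets(10-) assms(2-))
  show "p (mA x y) (brB a b c) = p x (brB b c (\<mu>A y a)) + p y (brB b c (\<mu>A x a))"
    using raw(5) by (simp only: normalize_brackets(10-) assms(2-))
  show "p y (brB b c (\<mu>A x a)) = p y (brB a b (\<mu>A x c))"
    using raw(6) by (simp only: normalize_brackets(10-) assms(2-))
  show "p z (mB a (\<rho>A x y b)) = p x (mB a (\<rho>A y z b))"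
    by (fact raw(7))
qed

text \<open>When the actions move across the pairing, the first identity goes to itself, and the
  second and third, the fourth and fifth, and the sixth and seventh change places.\<close>

lemma compatible_swap:
  assumes C: compatible
  shows "pairing_compatible B A (\<lambda>b a. p a b) mB brB mA brA \<rho>B \<mu>B"
  unfolding pairing_compatible_def
proof (intro ballI)
  fix a b c x y z
  assume m [simp]: "a \<in> vcarrier B" "b \<in> vcarrier B" "c \<in> vcarrier B"
    "x \<in> vcarrier A" "y \<in> vcarrier A" "z \<in> vcarrier A"
  note D = compatibleD[OF C]
  \<comment> \<open>Cyclic shifts are even, so they align the brackets with the instances of
    \<open>D(2)\<close> and \<open>D(3)\<close> without a sign.\<close>
  have r: "brB a b c = brB b c a" "brA x y z = brA z x y"
    by (rule brB_rot[symmetric] brA_rot; simp)+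
  show "p (mA x y) (mB a b) = p (mA (\<mu>B a x) y) b + p (mA x (\<mu>B b y)) a \<and>
     p (brA x y z) (brB a b c)
       = - (p (brA x y (\<rho>B b c z)) a + p (brA x y (\<rho>B c a z)) b + p (brA x y (\<rho>B a b z)) c) \<and>
     p (brA x y z) (brB a b c)
       = - (p (brA x y (\<rho>B b c z)) a + p (brA x (\<rho>B b c y) z) a + p (brA (\<rho>B b c x) y z) a) \<and>
     p (mA x y) (brB a b c) = - (p (mA x (\<rho>B b c y)) a + p (mA (\<rho>B b c x) y) a) \<and>
     p (brA x y z) (mB a b) = p (brA (\<mu>B b x) y z) a + p (brA (\<mu>B a x) y z) b \<and>
     p (brA (\<mu>B a x) y z) b = p (brA x y (\<mu>B a z)) b \<and>
     p (mA x (\<rho>B a b y)) c = p (mA x (\<rho>B b c y)) a"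
  proof (intro conjI)
    show "p (brA x y z) (brB a b c)
       = - (p (brA x y (\<rho>B b c z)) a + p (brA x y (\<rho>B c a z)) b + p (brA x y (\<rho>B a b z)) c)"
      using D(3)[of z x y a b c] by (simp add: normalize_brackets r(2))
    show "p (brA x y z) (brB a b c)
       = - (p (brA x y (\<rho>B b c z)) a + p (brA x (\<rho>B b c y) z) a + p (brA (\<rho>B b c x) y z) a)"
      using D(2)[of x y z b c a] by (simp add: normalize_brackets r(1))
    show "p (mA x y) (mB a b) = p (mA (\<mu>B a x) y) b + p (mA x (\<mu>B b y)) a"
      using D(1)[of x y z a b c] by (simp add: normalize_brackets)
    show "p (mA x y) (brB a b c) = - (p (mA x (\<rho>B b c y)) a + p (mA (\<rho>B b c x) y) a)"
      using D(5)[of x y z a b c] by (simp add: normalize_brackets)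
    show "p (brA x y z) (mB a b) = p (brA (\<mu>B b x) y z) a + p (brA (\<mu>B a x) y z) b"
      using D(4)[of x y z a b c] by (simp add: normalize_brackets)
    show "p (brA (\<mu>B a x) y z) b = p (brA x y (\<mu>B a z)) b"
      using D(7)[of x y z a b c] by (simp add: normalize_brackets)
    show "p (mA x (\<rho>B a b y)) c = p (mA x (\<rho>B b c y)) a"
      using D(6)[of x y z a b c] by (simp add: normalize_brackets)
  qed
qed

text \<open>The first identity is \<open>D(2)\<close> and the third is \<open>D(3)\<close>, each in
  transposed form; the middle one needs both.\<close>

lemma lie3_compatibleA:
  assumes C: compatible
  shows "lie3_compatible A brA B \<rho>A \<rho>B"
  unfolding lie3_compatible_def
proof (intro conjI ballI)
  note D = compatibleD[OF C]
  fix x y z a b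
  assume [simp]: "x \<in> vcarrier A" "y \<in> vcarrier A" "z \<in> vcarrier A"
    "a \<in> vcarrier B" "b \<in> vcarrier B"
  show "\<rho>B a b (brA x y z) = brA (\<rho>B a b x) y z + brA x (\<rho>B a b y) z + brA x y (\<rho>B a b z)"
  proof (rule eqA)
    fix c assume [simp]: "c \<in> vcarrier B"
    show "p (\<rho>B a b (brA x y z)) c
      = p (brA (\<rho>B a b x) y z + brA x (\<rho>B a b y) z + brA x y (\<rho>B a b z)) c"
      using D(2)[of x y z a b c] by (simp add: rhoB_adj normalize_brackets)
  qed simp_all
next
  note D = compatibleD[OF C]
  fix x1 x2 y3 x4 y5
  assume [simp]: "x1 \<in> vcarrier A" "x2 \<in> vcarrier A" "y3 \<in> vcarrier B"
    "x4 \<in> vcarrier A" "y5 \<in> vcarrier B"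
  show "- \<rho>B (\<rho>A x1 x2 y3) y5 x4 =
          - \<rho>B (\<rho>A x1 x4 y5) y3 x2 + \<rho>B (\<rho>A x2 x4 y5) y3 x1 - brA x1 x2 (\<rho>B y3 y5 x4)"
  proof (rule eqA)
    fix c assume [simp]: "c \<in> vcarrier B"
    \<comment> \<open>The numbers \<open>p x\<^sub>i (brB a\<^sub>k a\<^sub>l (\<rho>A x\<^sub>m x\<^sub>n a\<^sub>j))\<close>,
      with \<open>(i, m, n)\<close> and \<open>(j, k, l)\<close> cyclic, form a matrix whose row and column sums all equal
      \<open>- p (brA x4 x1 x2) (brB y3 y5 c)\<close>; the identity compares a row with a column through
      their common entry.\<close>
    note rot = brA_rot[of x4 x1 x2] brB_rot[of y3 y5 c] brB_rot[of c y3 y5]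
    have 2: "p (brA x4 x1 x2) (brB y3 y5 c) = - (p x1 (brB c y3 (\<rho>A x2 x4 y5))
        + p x2 (brB c y3 (\<rho>A x4 x1 y5)) + p x4 (brB c y3 (\<rho>A x1 x2 y5)))"
      using D(2)[of x1 x2 x4 c y3 y5] rot by simp
    have 3: "p (brA x4 x1 x2) (brB y3 y5 c) = - (p x4 (brB y3 y5 (\<rho>A x1 x2 c))
        + p x4 (brB c y3 (\<rho>A x1 x2 y5)) + p x4 (brB y5 c (\<rho>A x1 x2 y3)))"
      using D(3)[of x4 x1 x2 y3 y5 c] by simp
    have s: "p x1 (brB y3 c (\<rho>A x2 x4 y5)) = - p x1 (brB c y3 (\<rho>A x2 x4 y5))"
      "p x2 (brB y3 c (\<rho>A x1 x4 y5)) = p x2 (brB c y3 (\<rho>A x4 x1 y5))"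
      using brB_skew(1)[of y3 c] rhoA_skew[of x1 x4 y5] by simp_all
    show "p (- \<rho>B (\<rho>A x1 x2 y3) y5 x4) c =
          p (- \<rho>B (\<rho>A x1 x4 y5) y3 x2 + \<rho>B (\<rho>A x2 x4 y5) y3 x1 - brA x1 x2 (\<rho>B y3 y5 x4)) c"
      by (simp add: rhoB_adj normalize_brackets s) (use 2 3 in algebra)
  qed simp_all
next
  note D = compatibleD[OF C]
  fix x1 y2 y3 x4 x5
  assume [simp]: "x1 \<in> vcarrier A" "y2 \<in> vcarrier B" "y3 \<in> vcarrier B" "x4 \<in> vcarrier A"
    "x5 \<in> vcarrier A"
  show "brA (\<rho>B y2 y3 x1) x4 x5
      = \<rho>B y2 y3 (brA x1 x4 x5) + \<rho>B (\<rho>A x4 x5 y2) y3 x1 + \<rho>B y2 (\<rho>A x4 x5 y3) x1"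
  proof (rule eqA)
    fix c assume [simp]: "c \<in> vcarrier B"
    show "p (brA (\<rho>B y2 y3 x1) x4 x5) c
      = p (\<rho>B y2 y3 (brA x1 x4 x5) + \<rho>B (\<rho>A x4 x5 y2) y3 x1 + \<rho>B y2 (\<rho>A x4 x5 y3) x1) c"
      using D(3)[of x1 x4 x5 y2 y3 c] by (simp add: rhoB_adj normalize_brackets)
  qed simp_all
qed

text \<open>Each equation is one scalar identity, up to rotation and skew symmetry: in this order
  the first, fourth, sixth, seventh and fifth of \<open>compatibleD\<close>.\<close>

lemma poisson_compatibleA:
  assumes C: compatible and [simp]: "x1 \<in> vcarrier A" "x2 \<in> vcarrier A" "x3 \<in> vcarrier A"
    "y1 \<in> vcarrier B" "y2 \<in> vcarrier B"
  shows "\<mu>B y1 (mA x1 x2) = mA (\<mu>B y1 x1) x2 + \<mu>B (\<mu>A x1 y1) x2"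
    and "brA (\<mu>B y1 x1) x2 x3 = \<mu>B (\<rho>A x2 x3 y1) x1 + \<mu>B y1 (brA x1 x2 x3)"
    and "\<rho>B (\<mu>A x1 y1) y2 x2 = mA x1 (\<rho>B y1 y2 x2)"
    and "\<mu>B (\<rho>A x1 x2 y1) x3 + \<mu>B (\<rho>A x3 x2 y1) x1 = 0"
    and "\<rho>B y1 y2 (mA x1 x2) = mA x1 (\<rho>B y1 y2 x2) + mA x2 (\<rho>B y1 y2 x1)"
proof -
  note D = compatibleD[OF C]
  note N = muB_adj rhoB_adj normalize_brackets
  show "\<mu>B y1 (mA x1 x2) = mA (\<mu>B y1 x1) x2 + \<mu>B (\<mu>A x1 y1) x2"
    by (rule eqA) (use D(1)[of x1 x2 x3 y1 _ y1] in \<open>simp_all add: N\<close>)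
  show "brA (\<mu>B y1 x1) x2 x3 = \<mu>B (\<rho>A x2 x3 y1) x1 + \<mu>B y1 (brA x1 x2 x3)"
    by (rule eqA) (use D(4)[of x1 x2 x3 y1 _ y1] in \<open>simp_all add: N\<close>)
  show "\<rho>B (\<mu>A x1 y1) y2 x2 = mA x1 (\<rho>B y1 y2 x2)"
    by (rule eqA) (use D(6)[of x1 x2 x3 y1 y2] in \<open>simp_all add: N\<close>)
  show "\<mu>B (\<rho>A x1 x2 y1) x3 + \<mu>B (\<rho>A x3 x2 y1) x1 = 0"
    by (rule eqA) (use D(7)[of x1 x2 x3 _ y1 y1] rhoA_skew[of x2 x3 y1] in \<open>simp_all add: N\<close>)
  show "\<rho>B y1 y2 (mA x1 x2) = mA x1 (\<rho>B y1 y2 x2) + mA x2 (\<rho>B y1 y2 x1)"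
  proof (rule eqA)
    fix c assume [simp]: "c \<in> vcarrier B"
    show "p (\<rho>B y1 y2 (mA x1 x2)) c = p (mA x1 (\<rho>B y1 y2 x2) + mA x2 (\<rho>B y1 y2 x1)) c"
      using D(5)[of x1 x2 x3 c y1 y2] brB_rot[of c y1 y2] by (simp add: N)
  qed simp_all
qed

lemma compatible_imp_matched_pair:
  assumes C: compatible
  shows "poisson_lie3_matched_pair A mA brA B mB brB \<rho>A \<mu>A \<rho>B \<mu>B"
proof -
  interpret S: poisson_pairing B A "\<lambda>b a. p a b" mB brB mA brA \<rho>B \<mu>B \<rho>A \<mu>A
    by (rule swap)
  note C' = compatible_swap[OF C]
  have "comm_assoc_matched_pair A mA B mB \<mu>A \<mu>B"
    using algA algB comm_assoc_repA S.comm_assoc_repA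
      poisson_compatibleA(1)[OF C] S.poisson_compatibleA(1)[OF C']
    by (auto simp: comm_assoc_matched_pair_def poisson_lie3_algebra_def)
  moreover have "lie3_matched_pair A brA B brB \<rho>A \<rho>B"
    using algA algB lie3_repA S.lie3_repA
      lie3_compatibleA[OF C] S.lie3_compatibleA[OF C']
    by (auto simp: lie3_matched_pair_def poisson_lie3_algebra_def)
  ultimately show ?thesis
    unfolding poisson_lie3_matched_pair_def
    using algA algB poisson_repA S.poisson_repA poisson_compatibleA(2-)[OF C]
      S.poisson_compatibleA(2-)[OF C']
    by (intro conjI ballI) assumption+
qed

end

section \<open>The double\<close>

text \<open>This is the product on the direct sum of a matched pair. \<open>std_mult\<close> is the
  instance whose minus signs sit inside \<open>\<mu>A\<close> and \<open>\<mu>B\<close>, hence the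
  plus signs throughout.\<close>

definition double_mult :: "('v \<Rightarrow> 'v \<Rightarrow> 'v) \<Rightarrow> ('w \<Rightarrow> 'w \<Rightarrow> 'w) \<Rightarrow> ('v \<Rightarrow> 'w \<Rightarrow> 'w) \<Rightarrow> ('w \<Rightarrow> 'v \<Rightarrow> 'v)
    \<Rightarrow> 'v::ab_group_add \<times> 'w::ab_group_add \<Rightarrow> 'v \<times> 'w \<Rightarrow> 'v \<times> 'w" where
  "double_mult mA mB \<mu>A \<mu>B = (\<lambda>(x, a) (y, b).
     (mA x y + \<mu>B a y + \<mu>B b x, \<mu>A x b + \<mu>A y a + mB a b))"

definition double_bracket :: "('v \<Rightarrow> 'v \<Rightarrow> 'v \<Rightarrow> 'v) \<Rightarrow> ('w \<Rightarrow> 'w \<Rightarrow> 'w \<Rightarrow> 'w)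
    \<Rightarrow> ('v \<Rightarrow> 'v \<Rightarrow> 'w \<Rightarrow> 'w) \<Rightarrow> ('w \<Rightarrow> 'w \<Rightarrow> 'v \<Rightarrow> 'v)
    \<Rightarrow> 'v::ab_group_add \<times> 'w::ab_group_add \<Rightarrow> 'v \<times> 'w \<Rightarrow> 'v \<times> 'w \<Rightarrow> 'v \<times> 'w" where
  "double_bracket brA brB \<rho>A \<rho>B = (\<lambda>(x, a) (y, b) (z, c).
     (brA x y z + \<rho>B a b z - \<rho>B a c y + \<rho>B b c x,
      \<rho>A x y c - \<rho>A x z b + \<rho>A y z a + brB a b c))"

definition double_form :: "('v \<Rightarrow> 'w \<Rightarrow> 'k::field) \<Rightarrow> 'v \<times> 'w \<Rightarrow> 'v \<times> 'w \<Rightarrow> 'k" where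
  "double_form p = (\<lambda>(x, a) (y, b). p x b + p y a)"

text \<open>The fundamental identity at five given elements is made a predicate so that it can be
  carried from one tuple of arguments to another, by transpositions and by additivity in one
  slot.\<close>

definition fi_at :: "('u::ab_group_add \<Rightarrow> 'u \<Rightarrow> 'u \<Rightarrow> 'u) \<Rightarrow> 'u \<Rightarrow> 'u \<Rightarrow> 'u \<Rightarrow> 'u \<Rightarrow> 'u \<Rightarrow> bool" where
  "fi_at br u1 u2 u3 u4 u5 \<longleftrightarrow>
     br u1 u2 (br u3 u4 u5)
       = br (br u1 u2 u3) u4 u5 + br u3 (br u1 u2 u4) u5 + br u3 u4 (br u1 u2 u5)"

definition leibniz_at ::
    "('u::ab_group_add \<Rightarrow> 'u \<Rightarrow> 'u) \<Rightarrow> ('u \<Rightarrow> 'u \<Rightarrow> 'u \<Rightarrow> 'u) \<Rightarrow> 'u \<Rightarrow> 'u \<Rightarrow> 'u \<Rightarrow> 'u \<Rightarrow> bool" where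
  "leibniz_at m br u1 u2 u3 u4 \<longleftrightarrow> br (m u1 u2) u3 u4 = m u1 (br u2 u3 u4) + m u2 (br u1 u3 u4)"

text \<open>
  By skew symmetry, the arguments of the inner and of the outer bracket may be sorted, with those
  in \<open>S\<close> first.
\<close>

lemma fi_at_homogeneous:
  assumes vs: "is_vspace P" and tri: "trilinear_on P P P P br"
    and sk: "skew3_on (vcarrier P) br"
    and sum: "vcarrier P = {s + t |s t. s \<in> S \<and> t \<in> T}" and sub: "S \<subseteq> vcarrier P" "T \<subseteq> vcarrier P"
    and base: "\<And>X1 X2 X3 X4 X5 u1 u2 u3 u4 u5. \<lbrakk>(X1, X2) \<in> {(S, S), (S, T), (T, T)};
      (X3, X4, X5) \<in> {(S, S, S), (S, S, T), (S, T, T), (T, T, T)};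
      u1 \<in> X1; u2 \<in> X2; u3 \<in> X3; u4 \<in> X4; u5 \<in> X5\<rbrakk> \<Longrightarrow> fi_at br u1 u2 u3 u4 u5"
    and u: "u1 \<in> vcarrier P" "u2 \<in> vcarrier P" "u3 \<in> vcarrier P" "u4 \<in> vcarrier P" "u5 \<in> vcarrier P"
  shows "fi_at br u1 u2 u3 u4 u5"
proof -
  define H where "H = S \<union> T"
  note lin = linear_onD[OF trilinear_onD(1)[OF tri] vs]
    linear_onD(2-6)[OF trilinear_onD(2)[OF tri] vs]
    linear_onD(2-6)[OF trilinear_onD(3)[OF tri] vs]
  note cl = is_vspace_closed[OF vs]
  have sk1: "br y x z = - br x y z" and sk2: "br x z y = - br x y z"
    if "x \<in> vcarrier P" "y \<in> vcarrier P" "z \<in> vcarrier P" for x y z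
    using sk that unfolding skew3_on_def by blast+
  have sw12: "fi_at br v2 v1 v3 v4 v5"
    if "fi_at br v1 v2 v3 v4 v5" and v: "v1 \<in> H" "v2 \<in> H" "v3 \<in> H" "v4 \<in> H" "v5 \<in> H"
      for v1 v2 v3 v4 v5
  proof -
    have [simp]: "v1 \<in> vcarrier P" "v2 \<in> vcarrier P" "v3 \<in> vcarrier P" "v4 \<in> vcarrier P"
      "v5 \<in> vcarrier P"
      using v sub by (auto simp: H_def)
    show ?thesis using that(1) by (simp add: fi_at_def sk1[of v1 v2] lin cl algebra_simps)
  qed
  \<comment> \<open>Both sides change sign, and the first two summands on the right change places;
    in \<open>sw45\<close> it is the last two.\<close>
  have sw34: "fi_at br v1 v2 v4 v3 v5"
    if "fi_at br v1 v2 v3 v4 v5" and v: "v1 \<in> H" "v2 \<in> H" "v3 \<in> H" "v4 \<in> H" "v5 \<in> H"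
      for v1 v2 v3 v4 v5
  proof -
    have [simp]: "v1 \<in> vcarrier P" "v2 \<in> vcarrier P" "v3 \<in> vcarrier P" "v4 \<in> vcarrier P"
      "v5 \<in> vcarrier P"
      using v sub by (auto simp: H_def)
    show ?thesis
      using that(1) sk1[of v3 "br v1 v2 v4" v5] sk1[of "br v1 v2 v3" v4 v5]
      by (simp add: fi_at_def sk1[of v3 v4] lin cl algebra_simps)
  qed
  have sw45: "fi_at br v1 v2 v3 v5 v4"
    if "fi_at br v1 v2 v3 v4 v5" and v: "v1 \<in> H" "v2 \<in> H" "v3 \<in> H" "v4 \<in> H" "v5 \<in> H"
      for v1 v2 v3 v4 v5
  proof -
    have [simp]: "v1 \<in> vcarrier P" "v2 \<in> vcarrier P" "v3 \<in> vcarrier P" "v4 \<in> vcarrier P"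
      "v5 \<in> vcarrier P"
      using v sub by (auto simp: H_def)
    show ?thesis
      using that(1) sk2[of v3 "br v1 v2 v4" v5] sk2[of v3 v4 "br v1 v2 v5"]
      by (simp add: fi_at_def sk2[of _ v4 v5] lin cl algebra_simps)
  qed
  have h1: "fi_at br v1 v2 v3 v4 v5"
    if "(X1, X2) \<in> {(S, S), (S, T), (T, T)}" "v1 \<in> X1" "v2 \<in> X2"
      and v: "v1 \<in> H" "v2 \<in> H" "v3 \<in> H" "v4 \<in> H" "v5 \<in> H" for X1 X2 v1 v2 v3 v4 v5
  proof -
    note b = base[OF that(1) _ that(2,3)]
    have srt: "fi_at br v1 v2 w3 w4 w5"
      if "w3 \<in> S \<and> w4 \<in> S \<and> w5 \<in> H \<or> w3 \<in> S \<and> w4 \<in> T \<and> w5 \<in> T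
        \<or> w3 \<in> T \<and> w4 \<in> T \<and> w5 \<in> T" for w3 w4 w5
      using that b[of S S S w3 w4 w5] b[of S S T w3 w4 w5] b[of S T T w3 w4 w5] b[of T T T w3 w4 w5]
      unfolding H_def by auto
    note s34 = sw34[OF _ v(1,2)] and s45 = sw45[OF _ v(1,2)]
    \<comment> \<open>If some argument of the inner bracket lies in \<open>S\<close>, it can be
      moved to the front: \<open>a\<close>, \<open>b\<close> and \<open>c\<close> treat the three
      positions where it may stand. Otherwise all three lie in \<open>T\<close>, which is a sorted
      case.\<close>
    have a: "fi_at br v1 v2 w3 w4 w5" if "w3 \<in> S" "w4 \<in> H" "w5 \<in> H" for w3 w4 w5
    proof (cases "w4 \<in> S \<or> w5 \<in> T")
      case True
      then show ?thesis using that by (intro srt) (auto simp: H_def)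
    next
      case False
      then have "fi_at br v1 v2 w3 w5 w4" using that by (intro srt) (auto simp: H_def)
      then show ?thesis by (rule s45) (use that in \<open>auto simp: H_def\<close>)
    qed
    have b: "fi_at br v1 v2 w3 w4 w5" if "w4 \<in> S" "w3 \<in> H" "w5 \<in> H" for w3 w4 w5
      using a[OF that] by (rule s34) (use that in \<open>auto simp: H_def\<close>)
    have c: "fi_at br v1 v2 w3 w4 w5" if "w5 \<in> S" "w3 \<in> H" "w4 \<in> H" for w3 w4 w5
      using b[OF that] by (rule s45) (use that in \<open>auto simp: H_def\<close>)
    show ?thesis
    proof (cases "v3 \<in> S \<or> v4 \<in> S \<or> v5 \<in> S")
      case True
      then show ?thesis using a b c v by blast
    next
      case False
      then show ?thesis using v by (intro srt) (auto simp: H_def)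
    qed
  qed
  have h: "fi_at br v1 v2 v3 v4 v5"
    if v: "v1 \<in> H" "v2 \<in> H" "v3 \<in> H" "v4 \<in> H" "v5 \<in> H" for v1 v2 v3 v4 v5
  proof (cases "v1 \<in> S \<or> v2 \<in> T")
    case True
    then show ?thesis
      using h1[of S S v1 v2 v3 v4 v5] h1[of S T v1 v2 v3 v4 v5] h1[of T T v1 v2 v3 v4 v5] v
      unfolding H_def by simp blast
  next
    case False
    then have "fi_at br v2 v1 v3 v4 v5"
      using v by (intro h1[of S T]) (auto simp: H_def)
    then show ?thesis by (rule sw12) (use v in simp_all)
  qed
  have HP: "v \<in> vcarrier P" if "v \<in> H" for v using that sub by (auto simp: H_def)
  have dec: "\<exists>s t. s \<in> H \<and> t \<in> H \<and> v = s + t" if "v \<in> vcarrier P" for v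
    using that unfolding sum H_def by blast
  \<comment> \<open>From here the arguments are released one slot at a time. Additivity in that slot
    splits an arbitrary vector into two homogeneous ones, while the earlier slots are already
    arbitrary.\<close>
  have g1: "fi_at br v1 v2 v3 v4 v5"
    if v: "v1 \<in> vcarrier P" "v2 \<in> H" "v3 \<in> H" "v4 \<in> H" "v5 \<in> H" for v1 v2 v3 v4 v5
  proof -
    obtain s t where st: "s \<in> H" "t \<in> H" and e: "v1 = s + t" using dec[OF v(1)] by blast
    have "fi_at br s v2 v3 v4 v5" "fi_at br t v2 v3 v4 v5"
      using h st v by simp_all
    then show ?thesis
      using st v unfolding e by (simp add: fi_at_def lin cl HP add_ac)
  qed
  have g2: "fi_at br v1 v2 v3 v4 v5"
    if v: "v1 \<in> vcarrier P" "v2 \<in> vcarrier P" "v3 \<in> H" "v4 \<in> H" "v5 \<in> H" for v1 v2 v3 v4 v5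
  proof -
    obtain s t where st: "s \<in> H" "t \<in> H" and e: "v2 = s + t" using dec[OF v(2)] by blast
    have "fi_at br v1 s v3 v4 v5" "fi_at br v1 t v3 v4 v5"
      using g1 st v by simp_all
    then show ?thesis
      using st v unfolding e by (simp add: fi_at_def lin cl HP add_ac)
  qed
  have g3: "fi_at br v1 v2 v3 v4 v5"
    if v: "v1 \<in> vcarrier P" "v2 \<in> vcarrier P" "v3 \<in> vcarrier P" "v4 \<in> H" "v5 \<in> H" for v1 v2 v3 v4 v5
  proof -
    obtain s t where st: "s \<in> H" "t \<in> H" and e: "v3 = s + t" using dec[OF v(3)] by blast
    have "fi_at br v1 v2 s v4 v5" "fi_at br v1 v2 t v4 v5"
      using g2 st v by simp_all
    then show ?thesis
      using st v unfolding e by (simp add: fi_at_def lin cl HP add_ac)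
  qed
  have g4: "fi_at br v1 v2 v3 v4 v5"
    if v: "v1 \<in> vcarrier P" "v2 \<in> vcarrier P" "v3 \<in> vcarrier P" "v4 \<in> vcarrier P" "v5 \<in> H"
      for v1 v2 v3 v4 v5
  proof -
    obtain s t where st: "s \<in> H" "t \<in> H" and e: "v4 = s + t" using dec[OF v(4)] by blast
    have "fi_at br v1 v2 v3 s v5" "fi_at br v1 v2 v3 t v5"
      using g3 st v by simp_all
    then show ?thesis
      using st v unfolding e by (simp add: fi_at_def lin cl HP add_ac)
  qed
  show ?thesis
  proof -
    obtain s t where st: "s \<in> H" "t \<in> H" and e: "u5 = s + t" using dec[OF u(5)] by blast
    have "fi_at br u1 u2 u3 u4 s" "fi_at br u1 u2 u3 u4 t"
      using g4 st u by simp_all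
    then show ?thesis
      using st u unfolding e by (simp add: fi_at_def lin cl HP add_ac)
  qed
qed

text \<open>Exchanging the first two arguments only permutes the summands on the right, by
  commutativity, and exchanging the last two negates both sides. Hence both pairs can be sorted
  independently, which leaves nine cases.\<close>

lemma leibniz_at_homogeneous:
  assumes vs: "is_vspace P" and bil: "bilinear_on P P P m" and tri: "trilinear_on P P P P br"
    and comm: "\<And>u v. \<lbrakk>u \<in> vcarrier P; v \<in> vcarrier P\<rbrakk> \<Longrightarrow> m u v = m v u"
    and sk: "skew3_on (vcarrier P) br"
    and sum: "vcarrier P = {s + t |s t. s \<in> S \<and> t \<in> T}" and sub: "S \<subseteq> vcarrier P" "T \<subseteq> vcarrier P"
    and base: "\<And>X1 X2 X3 X4 u1 u2 u3 u4. \<lbrakk>(X1, X2) \<in> {(S, S), (S, T), (T, T)};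
      (X3, X4) \<in> {(S, S), (S, T), (T, T)};
      u1 \<in> X1; u2 \<in> X2; u3 \<in> X3; u4 \<in> X4\<rbrakk> \<Longrightarrow> leibniz_at m br u1 u2 u3 u4"
    and u: "u1 \<in> vcarrier P" "u2 \<in> vcarrier P" "u3 \<in> vcarrier P" "u4 \<in> vcarrier P"
  shows "leibniz_at m br u1 u2 u3 u4"
proof -
  define H where "H = S \<union> T"
  note lin = linear_onD[OF trilinear_onD(1)[OF tri] vs]
    linear_onD(2-6)[OF trilinear_onD(2)[OF tri] vs]
    linear_onD(2-6)[OF trilinear_onD(3)[OF tri] vs]
    linear_onD[OF bilinear_onD(1)[OF bil] vs] linear_onD(2-6)[OF bilinear_onD(2)[OF bil] vs]
  note cl = is_vspace_closed[OF vs]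
  have HP: "v \<in> vcarrier P" if "v \<in> H" for v using that sub by (auto simp: H_def)
  have sk2: "br x z y = - br x y z" if "x \<in> vcarrier P" "y \<in> vcarrier P" "z \<in> vcarrier P" for x y z
    using sk that unfolding skew3_on_def by blast
  have sw12: "leibniz_at m br v2 v1 v3 v4"
    if "leibniz_at m br v1 v2 v3 v4" "v1 \<in> H" "v2 \<in> H" for v1 v2 v3 v4
    using that comm[of v1 v2] HP by (simp add: leibniz_at_def add.commute)
  have sw34: "leibniz_at m br v1 v2 v4 v3"
    if "leibniz_at m br v1 v2 v3 v4" "v1 \<in> H" "v2 \<in> H" "v3 \<in> H" "v4 \<in> H" for v1 v2 v3 v4
    using that HP by (simp add: leibniz_at_def sk2[of _ v3 v4] lin)
  have srt: "leibniz_at m br v1 v2 v3 v4"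
    if "v1 \<in> S \<or> v2 \<in> T" "v3 \<in> S \<or> v4 \<in> T" "v1 \<in> H" "v2 \<in> H" "v3 \<in> H" "v4 \<in> H" for v1 v2 v3 v4
  proof -
    have "\<exists>X1 X2. (X1, X2) \<in> {(S, S), (S, T), (T, T)} \<and> v1 \<in> X1 \<and> v2 \<in> X2"
      "\<exists>X3 X4. (X3, X4) \<in> {(S, S), (S, T), (T, T)} \<and> v3 \<in> X3 \<and> v4 \<in> X4"
      using that unfolding H_def by auto
    then show ?thesis using base by blast
  qed
  have h: "leibniz_at m br v1 v2 v3 v4"
    if v: "v1 \<in> H" "v2 \<in> H" "v3 \<in> H" "v4 \<in> H" for v1 v2 v3 v4
  proof -
    have a: "leibniz_at m br w1 w2 v3 v4" if "w1 \<in> S \<or> w2 \<in> T" "w1 \<in> H" "w2 \<in> H" for w1 w2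
    proof (cases "v3 \<in> S \<or> v4 \<in> T")
      case True
      then show ?thesis using that v by (intro srt) auto
    next
      case False
      then have "leibniz_at m br w1 w2 v4 v3" using that v by (intro srt) (auto simp: H_def)
      then show ?thesis by (rule sw34) (use that v in simp_all)
    qed
    show ?thesis
    proof (cases "v1 \<in> S \<or> v2 \<in> T")
      case True
      then show ?thesis using v by (intro a)
    next
      case False
      then have "leibniz_at m br v2 v1 v3 v4" using v by (intro a) (auto simp: H_def)
      then show ?thesis by (rule sw12) (use v in simp_all)
    qed
  qed
  have dec: "\<exists>s t. s \<in> H \<and> t \<in> H \<and> v = s + t" if "v \<in> vcarrier P" for v
    using that unfolding sum H_def by blast
  have g1: "leibniz_at m br v1 v2 v3 v4"
    if v: "v1 \<in> vcarrier P" "v2 \<in> H" "v3 \<in> H" "v4 \<in> H" for v1 v2 v3 v4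
  proof -
    obtain s t where st: "s \<in> H" "t \<in> H" and e: "v1 = s + t" using dec[OF v(1)] by blast
    have "leibniz_at m br s v2 v3 v4" "leibniz_at m br t v2 v3 v4"
      using h st v by simp_all
    then show ?thesis
      using st v unfolding e by (simp add: leibniz_at_def lin cl HP add_ac)
  qed
  have g2: "leibniz_at m br v1 v2 v3 v4"
    if v: "v1 \<in> vcarrier P" "v2 \<in> vcarrier P" "v3 \<in> H" "v4 \<in> H" for v1 v2 v3 v4
  proof -
    obtain s t where st: "s \<in> H" "t \<in> H" and e: "v2 = s + t" using dec[OF v(2)] by blast
    have "leibniz_at m br v1 s v3 v4" "leibniz_at m br v1 t v3 v4"
      using g1 st v by simp_all
    then show ?thesis
      using st v unfolding e by (simp add: leibniz_at_def lin cl HP add_ac)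
  qed
  have g3: "leibniz_at m br v1 v2 v3 v4"
    if v: "v1 \<in> vcarrier P" "v2 \<in> vcarrier P" "v3 \<in> vcarrier P" "v4 \<in> H" for v1 v2 v3 v4
  proof -
    obtain s t where st: "s \<in> H" "t \<in> H" and e: "v3 = s + t" using dec[OF v(3)] by blast
    have "leibniz_at m br v1 v2 s v4" "leibniz_at m br v1 v2 t v4"
      using g2 st v by simp_all
    then show ?thesis
      using st v unfolding e by (simp add: leibniz_at_def lin cl HP add_ac)
  qed
  show ?thesis
  proof -
    obtain s t where st: "s \<in> H" "t \<in> H" and e: "u4 = s + t" using dec[OF u(4)] by blast
    have "leibniz_at m br u1 u2 u3 s" "leibniz_at m br u1 u2 u3 t"
      using g3 st u by simp_all
    then show ?thesis
      using st u unfolding e by (simp add: leibniz_at_def lin cl HP add_ac)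
  qed
qed

context poisson_pairing
begin

section \<open>Linearity, symmetry and invariance on the double\<close>

lemmas rhoB_lin [simp] = poisson_pairing.rhoA_lin[OF swap]
lemmas muB_lin [simp] = poisson_pairing.muA_lin[OF swap]
lemmas rhoB_skew = poisson_pairing.rhoA_skew[OF swap]
lemmas brB_fi = poisson_pairing.brA_fi[OF swap]
lemmas leibnizB = poisson_pairing.leibnizA[OF swap]

abbreviation "dcarrier \<equiv> dsum A B"
abbreviation "dmult \<equiv> double_mult mA mB \<mu>A \<mu>B"
abbreviation "dbracket \<equiv> double_bracket brA brB \<rho>A \<rho>B"
abbreviation "dform \<equiv> double_form p"

lemma dmult_simp [simp]:
  "dmult (x, a) (y, b) = (mA x y + \<mu>B a y + \<mu>B b x, \<mu>A x b + \<mu>A y a + mB a b)"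
  by (simp add: double_mult_def)

lemma dbracket_simp [simp]:
  "dbracket (x, a) (y, b) (z, c) =
     (brA x y z + \<rho>B a b z - \<rho>B a c y + \<rho>B b c x,
      \<rho>A x y c - \<rho>A x z b + \<rho>A y z a + brB a b c)"
  by (simp add: double_bracket_def)

lemma dform_simp [simp]: "dform (x, a) (y, b) = p x b + p y a"
  by (simp add: double_form_def)

lemma vs_double: "is_vspace dcarrier"
  by (rule is_vspace_dsum[OF vsA vsB])

lemma dmult_bilinear: "bilinear_on dcarrier dcarrier dcarrier dmult"
  by (auto simp: bilinear_on_def linear_on_def vspace_scale_add[OF vsA] vspace_scale_add[OF vsB])

lemma dbracket_trilinear: "trilinear_on dcarrier dcarrier dcarrier dcarrier dbracket"
  by (auto simp: trilinear_on_def linear_on_def vspace_scale_add[OF vsA] vspace_scale_add[OF vsB])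

lemma dform_bilinear: "bilinear_on dcarrier dcarrier scalars dform"
  by (auto simp: bilinear_on_def linear_on_def algebra_simps)

lemma dmult_comm: "\<lbrakk>u \<in> vcarrier dcarrier; v \<in> vcarrier dcarrier\<rbrakk> \<Longrightarrow> dmult u v = dmult v u"
proof -
  assume "u \<in> vcarrier dcarrier" "v \<in> vcarrier dcarrier"
  then obtain x a y b where e: "u = (x, a)" "v = (y, b)"
    and "x \<in> vcarrier A" "a \<in> vcarrier B" "y \<in> vcarrier A" "b \<in> vcarrier B" by auto
  then show ?thesis
    unfolding e using mA_comm[of x y] mB_comm[of a b] by (simp add: ac_simps)
qed

lemma dbracket_skew: "skew3_on (vcarrier dcarrier) dbracket"
  unfolding skew3_on_def
proof (intro ballI)
  fix u v w assume "u \<in> vcarrier dcarrier" "v \<in> vcarrier dcarrier" "w \<in> vcarrier dcarrier"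
  then obtain x a y b z c where e: "u = (x, a)" "v = (y, b)" "w = (z, c)"
    and m: "x \<in> vcarrier A" "a \<in> vcarrier B" "y \<in> vcarrier A" "b \<in> vcarrier B"
    "z \<in> vcarrier A" "c \<in> vcarrier B" by auto
  show "dbracket v u w = - dbracket u v w \<and> dbracket u w v = - dbracket u v w"
    unfolding e
    using brA_skew(1)[of x y z] brA_skew(2)[of x y z] brB_skew(1)[of a b c] brB_skew(2)[of a b c]
      rhoA_skew[of x y c] rhoA_skew[of y z a] rhoB_skew[of a b z] rhoB_skew[of b c x] m
    by (simp add: algebra_simps)
qed

text \<open>Invariance expresses that each algebra acts on the other by transposes of its own
  operations. It therefore follows from the adjunctions and the symmetry of the operations, before
  any compatibility between \<open>A\<close> and \<open>B\<close> enters.\<close>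

lemma dform_invariant: "invariant_form dcarrier dmult dbracket dform"
  unfolding invariant_form_def
proof (intro conjI ballI)
  fix u v w assume "u \<in> vcarrier dcarrier" "v \<in> vcarrier dcarrier" "w \<in> vcarrier dcarrier"
  then obtain x a y b z c where e: "u = (x, a)" "v = (y, b)" "w = (z, c)"
    and m [simp]: "x \<in> vcarrier A" "a \<in> vcarrier B" "y \<in> vcarrier A" "b \<in> vcarrier B"
    "z \<in> vcarrier A" "c \<in> vcarrier B" by auto
  show "dform (dmult u v) w = dform u (dmult v w)"
    unfolding e using mA_comm[of x y] mA_comm[of x z] mB_comm[of a b] mB_comm[of a c]
    by (simp add: rhoA_adj rhoB_adj muA_adj muB_adj)
next
  fix u v w t assume "u \<in> vcarrier dcarrier" "v \<in> vcarrier dcarrier" "w \<in> vcarrier dcarrier"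
    "t \<in> vcarrier dcarrier"
  then obtain x a y b z c t' d where e: "u = (x, a)" "v = (y, b)" "w = (z, c)" "t = (t', d)"
    and m [simp]: "x \<in> vcarrier A" "a \<in> vcarrier B" "y \<in> vcarrier A" "b \<in> vcarrier B"
    "z \<in> vcarrier A" "c \<in> vcarrier B" "t' \<in> vcarrier A" "d \<in> vcarrier B" by auto
  show "dform (dbracket u v w) t = - dform (dbracket u v t) w"
    unfolding e
    using brA_skew(2)[of x z t'] brA_skew(2)[of y z t'] brB_skew(2)[of a c d] brB_skew(2)[of b c d]
    by (simp add: rhoA_adj rhoB_adj)
qed

lemma double_sum:
  "vcarrier dcarrier = {s + t |s t. s \<in> vcarrier A \<times> {0} \<and> t \<in> {0} \<times> vcarrier B}"
  by force

lemma double_sub: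
  "vcarrier A \<times> {0} \<subseteq> vcarrier dcarrier" "{0} \<times> vcarrier B \<subseteq> vcarrier dcarrier"
  by auto

section \<open>The axioms of a Poisson 3-Lie algebra on the double\<close>

lemma rhoA_mA:
  "\<lbrakk>x \<in> vcarrier A; y \<in> vcarrier A; z \<in> vcarrier A; v \<in> vcarrier B\<rbrakk> \<Longrightarrow>
   \<rho>A (mA x y) z v = \<mu>A x (\<rho>A y z v) + \<mu>A y (\<rho>A x z v)"
  and rhoA_muA:
  "\<lbrakk>x \<in> vcarrier A; y \<in> vcarrier A; z \<in> vcarrier A; v \<in> vcarrier B\<rbrakk> \<Longrightarrow>
   \<rho>A x y (\<mu>A z v) = \<mu>A (brA x y z) v + \<mu>A z (\<rho>A x y v)"
  using poisson_repA unfolding poisson_lie3_rep_def by blast+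

lemma muA_mA:
  "\<lbrakk>x \<in> vcarrier A; y \<in> vcarrier A; v \<in> vcarrier B\<rbrakk> \<Longrightarrow> \<mu>A (mA x y) v = \<mu>A x (\<mu>A y v)"
  using comm_assoc_repA unfolding comm_assoc_rep_def by blast

lemmas rhoB_mB = poisson_pairing.rhoA_mA[OF swap]
lemmas rhoB_muB = poisson_pairing.rhoA_muA[OF swap]
lemmas muB_mB = poisson_pairing.muA_mA[OF swap]

text \<open>The twelve sorted cases correspond to twelve facts: the fundamental identities of
  \<open>A\<close> and \<open>B\<close>, the two composition axioms of \<open>lie3_rep\<close> for
  each action, and the three identities of \<open>lie3_compatible\<close> for each side.\<close>

lemma compatible_imp_double_fi:
  assumes C: compatible
    and u: "u1 \<in> vcarrier dcarrier" "u2 \<in> vcarrier dcarrier" "u3 \<in> vcarrier dcarrier"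
      "u4 \<in> vcarrier dcarrier" "u5 \<in> vcarrier dcarrier"
  shows "fi_at dbracket u1 u2 u3 u4 u5"
proof -
  let ?S = "vcarrier A \<times> {0}" and ?T = "{0} \<times> vcarrier B"
  interpret S: poisson_pairing B A "\<lambda>b a. p a b" mB brB mA brA \<rho>B \<mu>B \<rho>A \<mu>A
    by (rule swap)
  note C' = compatible_swap[OF C]
  note KA = lie3_compatibleA[OF C, unfolded lie3_compatible_def]
    and KB = S.lie3_compatibleA[OF C', unfolded lie3_compatible_def]
  note K1A = KA[THEN conjunct1, rule_format] and K1B = KB[THEN conjunct1, rule_format]
  note K2A = KA[THEN conjunct2, THEN conjunct1, rule_format]
    and K2B = KB[THEN conjunct2, THEN conjunct1, rule_format]
  note K3A = KA[THEN conjunct2, THEN conjunct2, rule_format]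
    and K3B = KB[THEN conjunct2, THEN conjunct2, rule_format]
  have rep1A: "\<rho>A x1 x2 (\<rho>A x3 x4 v) - \<rho>A x3 x4 (\<rho>A x1 x2 v)
      = \<rho>A (brA x1 x2 x3) x4 v - \<rho>A (brA x1 x2 x4) x3 v"
    and rep2A: "\<rho>A (brA x1 x2 x3) x4 v
      = \<rho>A x1 x2 (\<rho>A x3 x4 v) + \<rho>A x2 x3 (\<rho>A x1 x4 v) + \<rho>A x3 x1 (\<rho>A x2 x4 v)"
    if "x1 \<in> vcarrier A" "x2 \<in> vcarrier A" "x3 \<in> vcarrier A" "x4 \<in> vcarrier A" "v \<in> vcarrier B"
    for x1 x2 x3 x4 v
    using lie3_repA that unfolding lie3_rep_def by blast+
  have rep1B: "\<rho>B x1 x2 (\<rho>B x3 x4 v) - \<rho>B x3 x4 (\<rho>B x1 x2 v)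
      = \<rho>B (brB x1 x2 x3) x4 v - \<rho>B (brB x1 x2 x4) x3 v"
    and rep2B: "\<rho>B (brB x1 x2 x3) x4 v
      = \<rho>B x1 x2 (\<rho>B x3 x4 v) + \<rho>B x2 x3 (\<rho>B x1 x4 v) + \<rho>B x3 x1 (\<rho>B x2 x4 v)"
    if "x1 \<in> vcarrier B" "x2 \<in> vcarrier B" "x3 \<in> vcarrier B" "x4 \<in> vcarrier B" "v \<in> vcarrier A"
    for x1 x2 x3 x4 v
    using S.lie3_repA that unfolding lie3_rep_def by blast+
  show ?thesis
  proof (rule fi_at_homogeneous[OF vs_double dbracket_trilinear dbracket_skew double_sum
    double_sub _ u])
    fix X1 X2 X3 X4 X5 u1 u2 u3 u4 u5
    assume "(X1, X2) \<in> {(?S, ?S), (?S, ?T), (?T, ?T)}"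
      "(X3, X4, X5) \<in> {(?S, ?S, ?S), (?S, ?S, ?T), (?S, ?T, ?T), (?T, ?T, ?T)}"
      "u1 \<in> X1" "u2 \<in> X2" "u3 \<in> X3" "u4 \<in> X4" "u5 \<in> X5"
    then show "fi_at dbracket u1 u2 u3 u4 u5"
    \<comment> \<open>In every sorted case the terms with a zero argument disappear and one equation
      in a single component is left. The minus signs come from the summands of
      \<open>double_bracket\<close> in which the middle argument is acted on.\<close>
    proof (elim insertE emptyE; clarsimp simp: fi_at_def)
      fix x1 x2 x3 x4 x5
      assume [simp]: "x1 \<in> vcarrier A" "x2 \<in> vcarrier A" "x3 \<in> vcarrier A" "x4 \<in> vcarrier A"
        "x5 \<in> vcarrier A"
      show "brA x1 x2 (brA x3 x4 x5)
          = brA (brA x1 x2 x3) x4 x5 + brA x3 (brA x1 x2 x4) x5 + brA x3 x4 (brA x1 x2 x5)"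
        by (rule brA_fi) simp_all
    next
      fix x1 x2 x3 x4 y
      assume [simp]: "x1 \<in> vcarrier A" "x2 \<in> vcarrier A" "x3 \<in> vcarrier A" "x4 \<in> vcarrier A"
        "y \<in> vcarrier B"
      show "\<rho>A x1 x2 (\<rho>A x3 x4 y)
          = \<rho>A (brA x1 x2 x3) x4 y + \<rho>A x3 (brA x1 x2 x4) y + \<rho>A x3 x4 (\<rho>A x1 x2 y)"
        using rep1A[of x1 x2 x3 x4 y] rhoA_skew[of x3 "brA x1 x2 x4" y] by (simp add: algebra_simps)
    next
      fix x1 x2 x3 y4 y5
      assume [simp]: "x1 \<in> vcarrier A" "x2 \<in> vcarrier A" "x3 \<in> vcarrier A" "y4 \<in> vcarrier B"
        "y5 \<in> vcarrier B"
      show "brA x1 x2 (\<rho>B y4 y5 x3)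
        = \<rho>B y4 y5 (brA x1 x2 x3) + \<rho>B (\<rho>A x1 x2 y4) y5 x3 + \<rho>B y4 (\<rho>A x1 x2 y5) x3"
        using K3A[of x3 y4 y5 x1 x2] brA_rot[of "\<rho>B y4 y5 x3" x1 x2] brA_rot[of x3 x1 x2]
        by simp
    next
      fix x1 x2 y3 y4 y5
      assume [simp]: "x1 \<in> vcarrier A" "x2 \<in> vcarrier A" "y3 \<in> vcarrier B" "y4 \<in> vcarrier B"
        "y5 \<in> vcarrier B"
      show "\<rho>A x1 x2 (brB y3 y4 y5)
        = brB (\<rho>A x1 x2 y3) y4 y5 + brB y3 (\<rho>A x1 x2 y4) y5 + brB y3 y4 (\<rho>A x1 x2 y5)"
        using K1B[of y3 y4 y5 x1 x2]
        by simp
    next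
      fix x1 y2 x3 x4 x5
      assume [simp]: "x1 \<in> vcarrier A" "y2 \<in> vcarrier B" "x3 \<in> vcarrier A" "x4 \<in> vcarrier A"
        "x5 \<in> vcarrier A"
      show "- \<rho>A x1 (brA x3 x4 x5) y2
        = \<rho>A x3 x5 (\<rho>A x1 x4 y2) - \<rho>A x4 x5 (\<rho>A x1 x3 y2) - \<rho>A x3 x4 (\<rho>A x1 x5 y2)"
        using rep2A[of x3 x4 x5 x1 y2] rhoA_skew[of x1 "brA x3 x4 x5" y2] rhoA_skew[of x1 x5 y2]
          rhoA_skew[of x1 x3 y2] rhoA_skew[of x1 x4 y2] rhoA_skew[of x3 x5 "\<rho>A x1 x4 y2"]
        by (simp add: algebra_simps)
    next
      fix y1 y2 x3 x4 x5
      assume [simp]: "y1 \<in> vcarrier B" "y2 \<in> vcarrier B" "x3 \<in> vcarrier A" "x4 \<in> vcarrier A"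
        "x5 \<in> vcarrier A"
      show "\<rho>B y1 y2 (brA x3 x4 x5)
        = brA (\<rho>B y1 y2 x3) x4 x5 + brA x3 (\<rho>B y1 y2 x4) x5 + brA x3 x4 (\<rho>B y1 y2 x5)"
        using K1A[of x3 x4 x5 y1 y2]
        by simp
    next
      fix x1 y2 x3 x4 y5
      assume [simp]: "x1 \<in> vcarrier A" "y2 \<in> vcarrier B" "x3 \<in> vcarrier A" "x4 \<in> vcarrier A"
        "y5 \<in> vcarrier B"
      show "\<rho>B y2 (\<rho>A x3 x4 y5) x1
        = \<rho>B (\<rho>A x1 x3 y2) y5 x4 - \<rho>B (\<rho>A x1 x4 y2) y5 x3 + brA x3 x4 (\<rho>B y2 y5 x1)"
        using K2A[of x3 x4 y5 x1 y2] rhoB_skew[of y2 "\<rho>A x3 x4 y5" x1] rhoA_skew[of x1 x3 y2]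
          rhoA_skew[of x1 x4 y2] rhoB_skew[of y2 y5 x1]
        by (simp add: algebra_simps)
    next
      fix x1 y2 x3 y4 y5
      assume [simp]: "x1 \<in> vcarrier A" "y2 \<in> vcarrier B" "x3 \<in> vcarrier A" "y4 \<in> vcarrier B"
        "y5 \<in> vcarrier B"
      show "- \<rho>A x1 (\<rho>B y4 y5 x3) y2
        = \<rho>A x3 (\<rho>B y2 y4 x1) y5 - brB (\<rho>A x1 x3 y2) y4 y5 - \<rho>A x3 (\<rho>B y2 y5 x1) y4"
        using K2B[of y4 y5 x3 y2 x1] rhoA_skew[of x1 "\<rho>B y4 y5 x3" y2]
          rhoA_skew[of x3 "\<rho>B y2 y4 x1" y5] rhoA_skew[of x3 "\<rho>B y2 y5 x1" y4]
          rhoB_skew[of y2 y4 x1] rhoB_skew[of y2 y5 x1] rhoA_skew[of x1 x3 y2]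
          brB_rot[of "\<rho>A x1 x3 y2" y4 y5]
        by (simp add: algebra_simps)
    next
      fix x1 y2 y3 y4 y5
      assume [simp]: "x1 \<in> vcarrier A" "y2 \<in> vcarrier B" "y3 \<in> vcarrier B" "y4 \<in> vcarrier B"
        "y5 \<in> vcarrier B"
      show "\<rho>B y2 (brB y3 y4 y5) x1
        = \<rho>B y4 y5 (\<rho>B y2 y3 x1) - \<rho>B y3 y5 (\<rho>B y2 y4 x1) + \<rho>B y3 y4 (\<rho>B y2 y5 x1)"
        using rep2B[of y3 y4 y5 y2 x1] rhoB_skew[of y2 "brB y3 y4 y5" x1] rhoB_skew[of y2 y5 x1]
          rhoB_skew[of y2 y3 x1] rhoB_skew[of y2 y4 x1] rhoB_skew[of y3 y5 "\<rho>B y2 y4 x1"]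
        by (simp add: algebra_simps)
    next
      fix y1 y2 x3 x4 y5
      assume [simp]: "y1 \<in> vcarrier B" "y2 \<in> vcarrier B" "x3 \<in> vcarrier A" "x4 \<in> vcarrier A"
        "y5 \<in> vcarrier B"
      show "brB y1 y2 (\<rho>A x3 x4 y5)
        = \<rho>A (\<rho>B y1 y2 x3) x4 y5 + \<rho>A x3 (\<rho>B y1 y2 x4) y5 + \<rho>A x3 x4 (brB y1 y2 y5)"
        using K3B[of y5 x3 x4 y1 y2] brB_rot[of "\<rho>A x3 x4 y5" y1 y2] brB_rot[of y5 y1 y2]
        by (simp add: algebra_simps)
    next
      fix y1 y2 x3 y4 y5
      assume [simp]: "y1 \<in> vcarrier B" "y2 \<in> vcarrier B" "x3 \<in> vcarrier A" "y4 \<in> vcarrier B"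
        "y5 \<in> vcarrier B"
      show "\<rho>B y1 y2 (\<rho>B y4 y5 x3)
        = \<rho>B y4 y5 (\<rho>B y1 y2 x3) + \<rho>B (brB y1 y2 y4) y5 x3 + \<rho>B y4 (brB y1 y2 y5) x3"
        using rep1B[of y1 y2 y4 y5 x3] rhoB_skew[of y4 "brB y1 y2 y5" x3]
        by (simp add: algebra_simps)
    next
      fix y1 y2 y3 y4 y5
      assume [simp]: "y1 \<in> vcarrier B" "y2 \<in> vcarrier B" "y3 \<in> vcarrier B" "y4 \<in> vcarrier B"
        "y5 \<in> vcarrier B"
      show "brB y1 y2 (brB y3 y4 y5)
          = brB (brB y1 y2 y3) y4 y5 + brB y3 (brB y1 y2 y4) y5 + brB y3 y4 (brB y1 y2 y5)"
        by (rule brB_fi) simp_all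
    qed
  qed
qed

text \<open>Five of the nine sorted cases have two nontrivial components. In four of these, one
  component is a mixed axiom of \<open>poisson_lie3_rep\<close> and the other a compatibility
  identity. In the fifth, where each algebra contributes one factor and one bracket argument, both
  are compatibility identities.\<close>

lemma compatible_imp_double_leibniz:
  assumes C: compatible
    and u: "u1 \<in> vcarrier dcarrier" "u2 \<in> vcarrier dcarrier" "u3 \<in> vcarrier dcarrier"
      "u4 \<in> vcarrier dcarrier"
  shows "leibniz_at dmult dbracket u1 u2 u3 u4"
proof -
  let ?S = "vcarrier A \<times> {0}" and ?T = "{0} \<times> vcarrier B"
  interpret S: poisson_pairing B A "\<lambda>b a. p a b" mB brB mA brA \<rho>B \<mu>B \<rho>A \<mu>A
    by (rule swap)
  note C' = compatible_swap[OF C]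
  note MA = poisson_compatibleA[OF C] and MB = S.poisson_compatibleA[OF C']
  show ?thesis
  proof (rule leibniz_at_homogeneous[OF vs_double dmult_bilinear dbracket_trilinear dmult_comm
        dbracket_skew double_sum double_sub _ u])
    fix X1 X2 X3 X4 u1 u2 u3 u4
    assume "(X1, X2) \<in> {(?S, ?S), (?S, ?T), (?T, ?T)}" "(X3, X4) \<in> {(?S, ?S), (?S, ?T), (?T, ?T)}"
      "u1 \<in> X1" "u2 \<in> X2" "u3 \<in> X3" "u4 \<in> X4"
    then show "leibniz_at dmult dbracket u1 u2 u3 u4"
    proof (elim insertE emptyE; clarsimp simp: leibniz_at_def)
      fix x1 x2 x3 x4
      assume [simp]: "x1 \<in> vcarrier A" "x2 \<in> vcarrier A" "x3 \<in> vcarrier A" "x4 \<in> vcarrier A"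
      show "brA (mA x1 x2) x3 x4 = mA x1 (brA x2 x3 x4) + mA x2 (brA x1 x3 x4)"
        by (rule leibnizA) simp_all
    next
      fix x1 x2 x3 y
      assume [simp]: "x1 \<in> vcarrier A" "x2 \<in> vcarrier A" "x3 \<in> vcarrier A" "y \<in> vcarrier B"
      show "\<mu>B (\<rho>A x2 x3 y) x1 + \<mu>B (\<rho>A x1 x3 y) x2 = 0
        \<and> \<rho>A (mA x1 x2) x3 y = \<mu>A x1 (\<rho>A x2 x3 y) + \<mu>A x2 (\<rho>A x1 x3 y)"
        using MA(4)[of x2 x3 x1 y y]
        by (simp add: rhoA_mA)
    next
      fix x1 x2 y3 y4
      assume [simp]: "x1 \<in> vcarrier A" "x2 \<in> vcarrier A" "y3 \<in> vcarrier B" "y4 \<in> vcarrier B"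
      show "\<rho>B y3 y4 (mA x1 x2) = mA x1 (\<rho>B y3 y4 x2) + mA x2 (\<rho>B y3 y4 x1)"
        using MA(5)[of x1 x2 x1 y3 y4]
        by simp
    next
      fix x1 y2 x3 x4
      assume [simp]: "x1 \<in> vcarrier A" "y2 \<in> vcarrier B" "x3 \<in> vcarrier A" "x4 \<in> vcarrier A"
      show "brA (\<mu>B y2 x1) x3 x4 = \<mu>B (\<rho>A x3 x4 y2) x1 + \<mu>B y2 (brA x1 x3 x4)
        \<and> \<rho>A x3 x4 (\<mu>A x1 y2) = \<mu>A x1 (\<rho>A x3 x4 y2) + \<mu>A (brA x1 x3 x4) y2"
        using MA(2)[of x1 x3 x4 y2 y2] rhoA_muA[of x3 x4 x1 y2] brA_rot[of x1 x3 x4]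
        by (simp add: add.commute)
    next
      fix y1 y2 x3 x4
      assume [simp]: "y1 \<in> vcarrier B" "y2 \<in> vcarrier B" "x3 \<in> vcarrier A" "x4 \<in> vcarrier A"
      show "\<rho>A x3 x4 (mB y1 y2) = mB y1 (\<rho>A x3 x4 y2) + mB y2 (\<rho>A x3 x4 y1)"
        using MB(5)[of y1 y2 y1 x3 x4]
        by simp
    next
      fix x1 y2 x3 y4
      assume [simp]: "x1 \<in> vcarrier A" "y2 \<in> vcarrier B" "x3 \<in> vcarrier A" "y4 \<in> vcarrier B"
      show "\<rho>B (\<mu>A x1 y2) y4 x3 = mA x1 (\<rho>B y2 y4 x3) \<and> \<rho>A (\<mu>B y2 x1) x3 y4 = mB y2 (\<rho>A x1 x3 y4)"
        using MA(3)[of x1 x3 x1 y2 y4] MB(3)[of y2 y4 y2 x1 x3]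
        by simp
    next
      fix x1 y2 y3 y4
      assume [simp]: "x1 \<in> vcarrier A" "y2 \<in> vcarrier B" "y3 \<in> vcarrier B" "y4 \<in> vcarrier B"
      show "\<rho>B y3 y4 (\<mu>B y2 x1) = \<mu>B (brB y2 y3 y4) x1 + \<mu>B y2 (\<rho>B y3 y4 x1)
        \<and> brB (\<mu>A x1 y2) y3 y4 = \<mu>A x1 (brB y2 y3 y4) + \<mu>A (\<rho>B y3 y4 x1) y2"
        using MB(2)[of y2 y3 y4 x1 x1] rhoB_muB[of y3 y4 y2 x1] brB_rot[of y2 y3 y4]
        by (simp add: add.commute)
    next
      fix y1 y2 x3 y4
      assume [simp]: "y1 \<in> vcarrier B" "y2 \<in> vcarrier B" "x3 \<in> vcarrier A" "y4 \<in> vcarrier B"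
      show "- \<rho>B (mB y1 y2) y4 x3 = - \<mu>B y1 (\<rho>B y2 y4 x3) - \<mu>B y2 (\<rho>B y1 y4 x3)
        \<and> - \<mu>A (\<rho>B y2 y4 x3) y1 = \<mu>A (\<rho>B y1 y4 x3) y2"
        using MB(4)[of y1 y4 y2 x3 x3]
        by (simp add: rhoB_mB add_eq_0_iff)
    next
      fix y1 y2 y3 y4
      assume [simp]: "y1 \<in> vcarrier B" "y2 \<in> vcarrier B" "y3 \<in> vcarrier B" "y4 \<in> vcarrier B"
      show "brB (mB y1 y2) y3 y4 = mB y1 (brB y2 y3 y4) + mB y2 (brB y1 y3 y4)"
        by (rule leibnizB) simp_all
    qed
  qed
qed

text \<open>Associativity on the double has few enough terms to be expanded at once. This is its
  \<open>A\<close>-component at \<open>(x, a)\<close>, \<open>(y, b)\<close>, \<open>(z, c)\<close>;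
  the \<open>B\<close>-component is the instance for the swapped pairing.\<close>

lemma double_assocA:
  assumes C: compatible and m [simp]: "x \<in> vcarrier A" "y \<in> vcarrier A" "z \<in> vcarrier A"
    "a \<in> vcarrier B" "b \<in> vcarrier B" "c \<in> vcarrier B"
  shows "mA (mA x y + \<mu>B a y + \<mu>B b x) z + \<mu>B (\<mu>A x b + \<mu>A y a + mB a b) z
      + \<mu>B c (mA x y + \<mu>B a y + \<mu>B b x)
    = mA x (mA y z + \<mu>B b z + \<mu>B c y) + \<mu>B a (mA y z + \<mu>B b z + \<mu>B c y)
      + \<mu>B (\<mu>A y c + \<mu>A z b + mB b c) x"
proof -
  note M = poisson_compatibleA(1)[OF C]
  have 1: "\<mu>B a (mA y z) = mA (\<mu>B a y) z + \<mu>B (\<mu>A y a) z"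
    using M[of y z y a a] by simp
  \<comment> \<open>Both sides equal \<open>\<mu>B b (mA x z)\<close>, expanded with either factor
    of the commutative product in front.\<close>
  have 2: "mA (\<mu>B b x) z + \<mu>B (\<mu>A x b) z = mA x (\<mu>B b z) + \<mu>B (\<mu>A z b) x"
    using M[of x z x b b] M[of z x x b b] mA_comm[of x z] mA_comm[of x "\<mu>B b z"] by simp
  have 3: "\<mu>B c (mA x y) = mA x (\<mu>B c y) + \<mu>B (\<mu>A y c) x"
    using M[of y x x c c] mA_comm[of x y] mA_comm[of x "\<mu>B c y"] by simp
  have 4: "\<mu>B c (\<mu>B a y) = \<mu>B a (\<mu>B c y)" "\<mu>B c (\<mu>B b x) = \<mu>B (mB b c) x"
    "\<mu>B (mB a b) z = \<mu>B a (\<mu>B b z)"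
    using mB_comm[of a c] mB_comm[of b c] by (simp_all add: muB_mB[symmetric])
  have "mA (mA x y + \<mu>B a y + \<mu>B b x) z + \<mu>B (\<mu>A x b + \<mu>A y a + mB a b) z
      + \<mu>B c (mA x y + \<mu>B a y + \<mu>B b x)
    = mA x (mA y z) + (mA (\<mu>B a y) z + \<mu>B (\<mu>A y a) z) + (mA (\<mu>B b x) z + \<mu>B (\<mu>A x b) z)
      + \<mu>B a (\<mu>B b z) + (mA x (\<mu>B c y) + \<mu>B (\<mu>A y c) x) + \<mu>B a (\<mu>B c y) + \<mu>B (mB b c) x"
    by (simp add: mA_assoc 3 4 add_ac)
  also have "\<dots> = mA x (mA y z + \<mu>B b z + \<mu>B c y) + \<mu>B a (mA y z + \<mu>B b z + \<mu>B c y)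
      + \<mu>B (\<mu>A y c + \<mu>A z b + mB b c) x"
    unfolding 1[symmetric] 2 by (simp add: add_ac)
  finally show ?thesis .
qed

lemma compatible_imp_manin_triple:
  assumes C: compatible
  shows "manin_triple dcarrier dmult dbracket dform (vcarrier A \<times> {0}) ({0} \<times> vcarrier B)"
proof -
  let ?S = "vcarrier A \<times> {0}" and ?T = "{0} \<times> vcarrier B"
  interpret S: poisson_pairing B A "\<lambda>b a. p a b" mB brB mA brA \<rho>B \<mu>B \<rho>A \<mu>A
    by (rule swap)
  note C' = compatible_swap[OF C]
  have A: "dmult (dmult u v) w = dmult u (dmult v w)"
    if uvw: "u \<in> vcarrier dcarrier" "v \<in> vcarrier dcarrier" "w \<in> vcarrier dcarrier" for u v w
  proof -
    obtain x a y b z c where e: "u = (x, a)" "v = (y, b)" "w = (z, c)"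
      and m [simp]: "x \<in> vcarrier A" "a \<in> vcarrier B" "y \<in> vcarrier A" "b \<in> vcarrier B"
        "z \<in> vcarrier A" "c \<in> vcarrier B" using uvw by auto
    show ?thesis
      unfolding e
      using double_assocA[OF C, of x y z a b c] S.double_assocA[OF C', of a b c x y z]
      by (simp add: add_ac)
  qed
  have "comm_assoc_algebra dcarrier dmult"
    unfolding comm_assoc_algebra_def
    by (intro conjI ballI vs_double dmult_bilinear dmult_comm A)
  moreover have "lie3_algebra dcarrier dbracket"
    unfolding lie3_algebra_def
    by (intro conjI ballI vs_double dbracket_trilinear dbracket_skew
        compatible_imp_double_fi[OF C, unfolded fi_at_def])
  ultimately have "poisson_lie3_algebra dcarrier dmult dbracket"
    unfolding poisson_lie3_algebra_def
    by (intro conjI ballI compatible_imp_double_leibniz[OF C, unfolded leibniz_at_def])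
  moreover have "poisson_lie3_subalgebra dcarrier dmult dbracket ?S"
    "poisson_lie3_subalgebra dcarrier dmult dbracket ?T"
  proof -
    interpret D: vector_space "vscale dcarrier" using vs_double by (simp add: is_vspace_def)
    have "D.subspace ?S" "D.subspace ?T"
      unfolding D.subspace_def
      by (auto simp: zero_prod_def vspace_scale_add[OF vsA] vspace_scale_add[OF vsB])
    then show "poisson_lie3_subalgebra dcarrier dmult dbracket ?S"
      "poisson_lie3_subalgebra dcarrier dmult dbracket ?T"
      by (auto simp: poisson_lie3_subalgebra_def)
  qed
  moreover have "nondegenerate_form dcarrier dform"
    unfolding nondegenerate_form_def
  proof (clarsimp)
    fix x a assume m: "x \<in> vcarrier A" "a \<in> vcarrier B"
      and z: "\<forall>y\<in>vcarrier A. \<forall>b\<in>vcarrier B. p x b + p y a = 0"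
    have "p x b = 0" if "b \<in> vcarrier B" for b using z[rule_format, of 0 b] that m by simp
    moreover have "p y a = 0" if "y \<in> vcarrier A" for y using z[rule_format, of y 0] that m by simp
    ultimately have "x = 0" "a = 0" using nondegA nondegB m by blast+
    then show "(x, a) = 0" by (simp add: zero_prod_def)
  qed
  moreover have "symmetric_form dcarrier dform"
    by (auto simp: symmetric_form_def)
  moreover have "isotropic dform ?S" "isotropic dform ?T"
    by (auto simp: isotropic_def)
  moreover have "internal_direct_sum dcarrier ?S ?T"
    using double_sum by (auto simp: internal_direct_sum_def zero_prod_def)
  \<comment> \<open>By the shape of \<open>double_bracket\<close>, two arguments in one summand and
    one in the other give a value in the other summand. The projection conditions thus only ask that
    \<open>proj\<close> vanish on the complement.\<close>
  moreover have "proj ?S ?T v = 0" if "v \<in> ?T" for v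
    unfolding proj_def using that
    by (intro the_equality) (auto simp: zero_prod_def)
  moreover have "proj ?T ?S v = 0" if "v \<in> ?S" for v
    unfolding proj_def using that
    by (intro the_equality) (auto simp: zero_prod_def)
  ultimately show ?thesis
    unfolding manin_triple_def bilinear_form_def
    by (intro conjI dform_bilinear dform_invariant) simp_all
qed

text \<open>The identities with values in \<open>A\<close>, together with one of those with values in \<open>B\<close>, suffice.\<close>

lemma compatibleI:
  assumes 1: "\<And>x y a. \<lbrakk>x \<in> vcarrier A; y \<in> vcarrier A; a \<in> vcarrier B\<rbrakk> \<Longrightarrow>
      \<mu>B a (mA x y) = mA (\<mu>B a x) y + \<mu>B (\<mu>A x a) y"
    and 2: "\<And>x y z a b. \<lbrakk>x \<in> vcarrier A; y \<in> vcarrier A; z \<in> vcarrier A; a \<in> vcarrier B; b \<in>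
      vcarrier B\<rbrakk>
      \<Longrightarrow> \<rho>B a b (brA x y z) = brA (\<rho>B a b x) y z + brA x (\<rho>B a b y) z + brA x y (\<rho>B a b z)"
    and 3: "\<And>x y z a b. \<lbrakk>x \<in> vcarrier A; y \<in> vcarrier A; z \<in> vcarrier A; a \<in> vcarrier B; b \<in>
      vcarrier B\<rbrakk>
      \<Longrightarrow> brA (\<rho>B a b x) y z = \<rho>B a b (brA x y z) + \<rho>B (\<rho>A y z a) b x + \<rho>B a (\<rho>A y z b) x"
    and 4: "\<And>x y z a. \<lbrakk>x \<in> vcarrier A; y \<in> vcarrier A; z \<in> vcarrier A; a \<in> vcarrier B\<rbrakk>
      \<Longrightarrow> brA (\<mu>B a x) y z = \<mu>B (\<rho>A y z a) x + \<mu>B a (brA x y z)"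
    and 5: "\<And>x y a b. \<lbrakk>x \<in> vcarrier A; y \<in> vcarrier A; a \<in> vcarrier B; b \<in> vcarrier B\<rbrakk>
      \<Longrightarrow> \<rho>B a b (mA x y) = mA x (\<rho>B a b y) + mA y (\<rho>B a b x)"
    and 6: "\<And>x y a b. \<lbrakk>x \<in> vcarrier A; y \<in> vcarrier A; a \<in> vcarrier B; b \<in> vcarrier B\<rbrakk>
      \<Longrightarrow> \<rho>B (\<mu>A x a) b y = mA x (\<rho>B a b y)"
    and 7: "\<And>x y a b. \<lbrakk>x \<in> vcarrier A; y \<in> vcarrier A; a \<in> vcarrier B; b \<in> vcarrier B\<rbrakk>
      \<Longrightarrow> \<rho>A (\<mu>B a x) y b = mB a (\<rho>A x y b)"
  shows compatible
  unfolding pairing_compatible_def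
proof (intro ballI)
  fix x y z a b c
  assume m [simp]: "x \<in> vcarrier A" "y \<in> vcarrier A" "z \<in> vcarrier A"
    "a \<in> vcarrier B" "b \<in> vcarrier B" "c \<in> vcarrier B"
  note N = muB_adj rhoB_adj normalize_brackets
  show "p (mA x y) (mB a b) = p y (mB (\<mu>A x a) b) + p x (mB a (\<mu>A y b)) \<and>
        p (brA x y z) (brB a b c)
          = - (p x (brB a b (\<rho>A y z c)) + p y (brB a b (\<rho>A z x c)) + p z (brB a b (\<rho>A x y c))) \<and>
        p (brA x y z) (brB a b c)
          = - (p x (brB a b (\<rho>A y z c)) + p x (brB a (\<rho>A y z b) c) + p x (brB (\<rho>A y z a) b c)) \<and>
        p (brA x y z) (mB a b) = - (p x (mB a (\<rho>A y z b)) + p x (mB (\<rho>A y z a) b)) \<and>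
        p (mA x y) (brB a b c) = p x (brB (\<mu>A y a) b c) + p y (brB (\<mu>A x a) b c) \<and>
        p y (brB (\<mu>A x a) b c) = p y (brB a b (\<mu>A x c)) \<and>
        p z (mB a (\<rho>A x y b)) = p x (mB a (\<rho>A y z b))"
  proof (intro conjI)
    show "p (mA x y) (mB a b) = p y (mB (\<mu>A x a) b) + p x (mB a (\<mu>A y b))"
      using arg_cong[OF 1[of x y a], of "\<lambda>u. p u b"] by (simp add: N)
    show "p (brA x y z) (brB a b c)
        = - (p x (brB a b (\<rho>A y z c)) + p y (brB a b (\<rho>A z x c)) + p z (brB a b (\<rho>A x y c)))"
      using arg_cong[OF 2[of x y z a b], of "\<lambda>u. p u c"] by (simp add: N) algebra
    show "p (brA x y z) (brB a b c)
        = - (p x (brB a b (\<rho>A y z c)) + p x (brB a (\<rho>A y z b) c) + p x (brB (\<rho>A y z a) b c))"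
      using arg_cong[OF 3[of x y z a b], of "\<lambda>u. p u c"] by (simp add: N)
    show "p (brA x y z) (mB a b) = - (p x (mB a (\<rho>A y z b)) + p x (mB (\<rho>A y z a) b))"
      using arg_cong[OF 4[of x y z a], of "\<lambda>u. p u b"] by (simp add: N)
    show "p (mA x y) (brB a b c) = p x (brB (\<mu>A y a) b c) + p y (brB (\<mu>A x a) b c)"
      using arg_cong[OF 5[of x y b c], of "\<lambda>u. p u a"] by (simp add: N brB_rot[of a b c]) algebra
    show "p y (brB (\<mu>A x a) b c) = p y (brB a b (\<mu>A x c))"
      using arg_cong[OF 6[of x y a b], of "\<lambda>u. p u c"] by (simp add: N)
    \<comment> \<open>Hypothesis 7 has values in \<open>B\<close>, so it is paired with
      \<open>z\<close>. The adjunction of \<open>\<rho>A\<close> at \<open>\<mu>B a x\<close> turns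
      its left side into a bracket of \<open>A\<close>, from which \<open>normalize_brackets\<close>
      frees \<open>x\<close>.\<close>
    show "p z (mB a (\<rho>A x y b)) = p x (mB a (\<rho>A y z b))"
      using arg_cong[OF 7[of x y a b], of "p z"] by (simp add: N rhoA_adj[of "\<mu>B a x"])
  qed
qed

section \<open>Matched pairs and Manin triples are equivalent to the scalar identities\<close>

lemma matched_pair_iff_compatible:
  "poisson_lie3_matched_pair A mA brA B mB brB \<rho>A \<mu>A \<rho>B \<mu>B \<longleftrightarrow> compatible"
proof
  assume MP: "poisson_lie3_matched_pair A mA brA B mB brB \<rho>A \<mu>A \<rho>B \<mu>B"
  show compatible
  proof (rule compatibleI)
    have K: "lie3_compatible A brA B \<rho>A \<rho>B" and cm: "comm_assoc_matched_pair A mA B mB \<mu>A \<mu>B"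
      using MP by (simp_all add: poisson_lie3_matched_pair_def lie3_matched_pair_def)
    show "\<mu>B a (mA x y) = mA (\<mu>B a x) y + \<mu>B (\<mu>A x a) y"
      if "x \<in> vcarrier A" "y \<in> vcarrier A" "a \<in> vcarrier B" for x y a
      using cm that unfolding comm_assoc_matched_pair_def by blast
    show "\<rho>B a b (brA x y z) = brA (\<rho>B a b x) y z + brA x (\<rho>B a b y) z + brA x y (\<rho>B a b z)"
      "brA (\<rho>B a b x) y z = \<rho>B a b (brA x y z) + \<rho>B (\<rho>A y z a) b x + \<rho>B a (\<rho>A y z b) x"
      if "x \<in> vcarrier A" "y \<in> vcarrier A" "z \<in> vcarrier A" "a \<in> vcarrier B" "b \<in> vcarrier B"
      for x y z a b
      using K that unfolding lie3_compatible_def by blast+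
    note M = MP[unfolded poisson_lie3_matched_pair_def]
    have "\<forall>x1\<in>vcarrier A. \<forall>x2\<in>vcarrier A. \<forall>x3\<in>vcarrier A. \<forall>y1\<in>vcarrier B.
        brA (\<mu>B y1 x1) x2 x3 = \<mu>B (\<rho>A x2 x3 y1) x1 + \<mu>B y1 (brA x1 x2 x3)"
      using M by (elim conjE)
    then show "brA (\<mu>B a x) y z = \<mu>B (\<rho>A y z a) x + \<mu>B a (brA x y z)"
      if "x \<in> vcarrier A" "y \<in> vcarrier A" "z \<in> vcarrier A" "a \<in> vcarrier B" for x y z a
      using that by blast
    have "\<forall>x1\<in>vcarrier A. \<forall>x2\<in>vcarrier A. \<forall>y3\<in>vcarrier B. \<forall>y4\<in>vcarrier B.
        \<rho>B y3 y4 (mA x1 x2) = mA x1 (\<rho>B y3 y4 x2) + mA x2 (\<rho>B y3 y4 x1)"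
      using M by (elim conjE)
    then show "\<rho>B a b (mA x y) = mA x (\<rho>B a b y) + mA y (\<rho>B a b x)"
      if "x \<in> vcarrier A" "y \<in> vcarrier A" "a \<in> vcarrier B" "b \<in> vcarrier B" for x y a b
      using that by blast
    have "\<forall>x1\<in>vcarrier A. \<forall>x2\<in>vcarrier A. \<forall>y1\<in>vcarrier B. \<forall>y2\<in>vcarrier B.
        \<rho>B (\<mu>A x1 y1) y2 x2 = mA x1 (\<rho>B y1 y2 x2)"
      using M by (elim conjE)
    then show "\<rho>B (\<mu>A x a) b y = mA x (\<rho>B a b y)"
      if "x \<in> vcarrier A" "y \<in> vcarrier A" "a \<in> vcarrier B" "b \<in> vcarrier B" for x y a b
      using that by blast
    have "\<forall>x1\<in>vcarrier A. \<forall>x2\<in>vcarrier A. \<forall>y1\<in>vcarrier B. \<forall>y2\<in>vcarrier B.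
        \<rho>A (\<mu>B y1 x1) x2 y2 = mB y1 (\<rho>A x1 x2 y2)"
      using M by (elim conjE)
    then show "\<rho>A (\<mu>B a x) y b = mB a (\<rho>A x y b)"
      if "x \<in> vcarrier A" "y \<in> vcarrier A" "a \<in> vcarrier B" "b \<in> vcarrier B" for x y a b
      using that by blast
  qed
qed (rule compatible_imp_matched_pair)

lemma manin_triple_iff_compatible:
  "manin_triple dcarrier dmult dbracket dform (vcarrier A \<times> {0}) ({0} \<times> vcarrier B) \<longleftrightarrow> compatible"
proof
  assume "manin_triple dcarrier dmult dbracket dform (vcarrier A \<times> {0}) ({0} \<times> vcarrier B)"
  then have P: "poisson_lie3_algebra dcarrier dmult dbracket"
    by (simp add: manin_triple_def)
  have as: "dmult (dmult u v) w = dmult u (dmult v w)"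
    if "u \<in> vcarrier dcarrier" "v \<in> vcarrier dcarrier" "w \<in> vcarrier dcarrier" for u v w
    using P that unfolding poisson_lie3_algebra_def comm_assoc_algebra_def by blast
  have fi: "dbracket u v (dbracket w s t) =
      dbracket (dbracket u v w) s t + dbracket w (dbracket u v s) t + dbracket w s (dbracket u v t)"
    if "u \<in> vcarrier dcarrier" "v \<in> vcarrier dcarrier" "w \<in> vcarrier dcarrier"
      "s \<in> vcarrier dcarrier" "t \<in> vcarrier dcarrier" for u v w s t
    using P that unfolding poisson_lie3_algebra_def lie3_algebra_def by blast
  have lz: "dbracket (dmult u v) w s = dmult u (dbracket v w s) + dmult v (dbracket u w s)"
    if "u \<in> vcarrier dcarrier" "v \<in> vcarrier dcarrier" "w \<in> vcarrier dcarrier"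
      "s \<in> vcarrier dcarrier" for u v w s
    using P that unfolding poisson_lie3_algebra_def by blast
  show compatible
  proof (rule compatibleI)
    fix x y z a b
    assume [simp]: "x \<in> vcarrier A" "y \<in> vcarrier A" "z \<in> vcarrier A" "a \<in> vcarrier B"
      "b \<in> vcarrier B"
    \<comment> \<open>At homogeneous arguments most terms vanish. Here \<open>\<rho>B a b\<close> is
      seen to be a derivation of the bracket of \<open>A\<close>; in the next equation the operator
      \<open>brA y z\<close> passes through an action of \<open>B\<close>.\<close>
    show "\<rho>B a b (brA x y z) = brA (\<rho>B a b x) y z + brA x (\<rho>B a b y) z + brA x y (\<rho>B a b z)"
      using fi[of "(0, a)" "(0, b)" "(x, 0)" "(y, 0)" "(z, 0)"] by simp
    show "brA (\<rho>B a b x) y z = \<rho>B a b (brA x y z) + \<rho>B (\<rho>A y z a) b x + \<rho>B a (\<rho>A y z b) x"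
      using fi[of "(y, 0)" "(z, 0)" "(x, 0)" "(0, a)" "(0, b)"]
        brA_rot[of "\<rho>B a b x" y z] brA_rot[of x y z] by simp
  next
    fix x y a
    assume [simp]: "x \<in> vcarrier A" "y \<in> vcarrier A" "a \<in> vcarrier B"
    show "\<mu>B a (mA x y) = mA (\<mu>B a x) y + \<mu>B (\<mu>A x a) y"
      using as[of "(0, a)" "(x, 0)" "(y, 0)"] by simp
  next
    fix x y z a
    assume [simp]: "x \<in> vcarrier A" "y \<in> vcarrier A" "z \<in> vcarrier A" "a \<in> vcarrier B"
    show "brA (\<mu>B a x) y z = \<mu>B (\<rho>A y z a) x + \<mu>B a (brA x y z)"
      using lz[of "(x, 0)" "(0, a)" "(y, 0)" "(z, 0)"] by simp
  next
    fix x y a b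
    assume [simp]: "x \<in> vcarrier A" "y \<in> vcarrier A" "a \<in> vcarrier B" "b \<in> vcarrier B"
    show "\<rho>B a b (mA x y) = mA x (\<rho>B a b y) + mA y (\<rho>B a b x)"
      using lz[of "(x, 0)" "(y, 0)" "(0, a)" "(0, b)"] by simp
    \<comment> \<open>A single instance of the Leibniz rule gives both equations, as its two
      components.\<close>
    show "\<rho>B (\<mu>A x a) b y = mA x (\<rho>B a b y)" "\<rho>A (\<mu>B a x) y b = mB a (\<rho>A x y b)"
      using lz[of "(x, 0)" "(0, a)" "(y, 0)" "(0, b)"] by simp_all
  qed
qed (rule compatible_imp_manin_triple)

end

section \<open>Dual spaces and tensors\<close>

lemma vector_space_mult: "vector_space ((*) :: 'k::field \<Rightarrow> 'k \<Rightarrow> 'k)"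
  by unfold_locales (simp_all add: algebra_simps)

lemma dual_set_iff:
  assumes "vector_space sc"
  shows "\<xi> \<in> dual_set sc \<longleftrightarrow> (\<forall>x y. \<xi> (x + y) = \<xi> x + \<xi> y) \<and> (\<forall>c x. \<xi> (sc c x) = c * \<xi> x)"
  using assms vector_space_mult by (auto simp: dual_set_def Vector_Spaces.linear_iff)

lemma whole_simps [simp]: "vscale (whole sc) = sc" "vcarrier (whole sc) = UNIV"
  by (simp_all add: whole_def)

lemma dual_simps [simp]: "vscale (dual sc) = fscale" "vcarrier (dual sc) = dual_set sc"
  by (simp_all add: dual_def)

lemma is_vspace_whole: "vector_space sc \<Longrightarrow> is_vspace (whole sc)"
  by (simp add: is_vspace_def module.subspace_UNIV module_iff_vector_space)

lemma is_vspace_dual: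
  assumes "vector_space sc"
  shows "is_vspace (dual sc)"
proof -
  interpret f: vector_space fscale by (rule vector_space_fscale)
  have "f.subspace (dual_set sc)"
    unfolding f.subspace_def
    by (simp add: dual_set_iff[OF assms] fscale_def algebra_simps)
  then show ?thesis by (simp add: is_vspace_def vector_space_fscale)
qed

text \<open>Linearity in one slot becomes visible once the factor at position
  \<open>length us\<close> is split off. The remaining product does not depend on \<open>f\<close>:
  the entry \<open>0\<close> is a placeholder at the index that is left out.\<close>

lemma elem_tensor_slot:
  assumes "length us < length xs"
  shows "elem_tensor sc xs (us @ f # vs) =
    (if f \<in> dual_set sc then f (xs ! length us) else 0) *
    (if length us + length vs + 1 = length xs \<and> set us \<subseteq> dual_set sc \<and> set vs \<subseteq> dual_set sc
     then \<Prod>i\<in>{..<length xs} - {length us}. ((us @ 0 # vs) ! i) (xs ! i) else 0)"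
proof -
  have "(\<Prod>i<length xs. ((us @ f # vs) ! i) (xs ! i))
      = f (xs ! length us) * (\<Prod>i\<in>{..<length xs} - {length us}. ((us @ f # vs) ! i) (xs ! i))"
    using assms by (subst prod.remove[of _ "length us"]) simp_all
  also have "(\<Prod>i\<in>{..<length xs} - {length us}. ((us @ f # vs) ! i) (xs ! i))
      = (\<Prod>i\<in>{..<length xs} - {length us}. ((us @ 0 # vs) ! i) (xs ! i))"
    by (rule prod.cong) (auto simp: nth_append nth_Cons')
  finally show ?thesis by (auto simp: elem_tensor_def)
qed

text \<open>These are linear conditions on \<open>T\<close>, so they pass from elementary tensors to
  their span. They are all that is used below about membership in
  \<open>tensor_power\<close>.\<close>

definition multilinear_tensor ::
    "('k::field \<Rightarrow> 'a::ab_group_add \<Rightarrow> 'a) \<Rightarrow> nat \<Rightarrow> ('k, 'a) tensor \<Rightarrow> bool" where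
  "multilinear_tensor sc n T \<longleftrightarrow>
     (\<forall>\<xi>s. \<not> (length \<xi>s = n \<and> set \<xi>s \<subseteq> dual_set sc) \<longrightarrow> T \<xi>s = 0) \<and>
     (\<forall>us vs f g. f \<in> dual_set sc \<longrightarrow> g \<in> dual_set sc \<longrightarrow>
        T (us @ (f + g) # vs) = T (us @ f # vs) + T (us @ g # vs)) \<and>
     (\<forall>us vs c f. f \<in> dual_set sc \<longrightarrow> T (us @ fscale c f # vs) = c * T (us @ f # vs))"

lemma tensor_power_multilinear:
  assumes vs: "vector_space sc" and T: "T \<in> vcarrier (tensor_power sc n)"
  shows "multilinear_tensor sc n T"
proof -
  interpret f: vector_space fscale by (rule vector_space_fscale)
  note D = is_vspace_closed[OF is_vspace_dual[OF vs], simplified]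
  have "T \<in> f.span (elem_tensor sc ` {xs. length xs = n})"
    using T by (simp add: tensor_power_def)
  then show ?thesis
  proof (induction rule: f.span_induct_alt)
    case base
    then show ?case by (simp add: multilinear_tensor_def)
  next
    case (step c E T)
    then obtain xs where E: "E = elem_tensor sc xs" and n: "n = length xs" by auto
    have "multilinear_tensor sc n E"
      unfolding multilinear_tensor_def
    proof (intro conjI allI impI)
      fix \<xi>s assume "\<not> (length \<xi>s = n \<and> set \<xi>s \<subseteq> dual_set sc)"
      then show "E \<xi>s = 0" unfolding E n by (rule elem_tensor_eq_0)
    next
      fix us vs f g assume [simp]: "f \<in> dual_set sc" "g \<in> dual_set sc"
      show "E (us @ (f + g) # vs) = E (us @ f # vs) + E (us @ g # vs)"
      proof (cases "length us < length xs")
        case True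
        then show ?thesis by (simp add: E elem_tensor_slot D algebra_simps)
      next
        case False
        then show ?thesis by (simp add: E elem_tensor_eq_0)
      qed
    next
      fix us vs c f assume [simp]: "f \<in> dual_set sc"
      show "E (us @ fscale c f # vs) = c * E (us @ f # vs)"
      proof (cases "length us < length xs")
        case True
        then show ?thesis by (simp add: E elem_tensor_slot D) (simp add: fscale_def)
      next
        case False
        then show ?thesis by (simp add: E elem_tensor_eq_0)
      qed
    qed
    then show ?case
      using step.IH by (auto simp: multilinear_tensor_def fscale_def algebra_simps)
  qed
qed

context
  fixes sc :: "'k::field \<Rightarrow> 'a::ab_group_add \<Rightarrow> 'a" and n :: nat and T :: "('k, 'a) tensor"
  assumes vs: "vector_space sc" and T: "T \<in> vcarrier (tensor_power sc n)"
begin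

lemma tensor_vanish: "\<not> (length \<xi>s = n \<and> set \<xi>s \<subseteq> dual_set sc) \<Longrightarrow> T \<xi>s = 0"
  and tensor_add: "\<lbrakk>f \<in> dual_set sc; g \<in> dual_set sc\<rbrakk> \<Longrightarrow>
    T (us @ (f + g) # vs) = T (us @ f # vs) + T (us @ g # vs)"
  and tensor_scale: "f \<in> dual_set sc \<Longrightarrow> T (us @ fscale c f # vs) = c * T (us @ f # vs)"
  using tensor_power_multilinear[OF vs T] unfolding multilinear_tensor_def by blast+

lemma tensor_zero: "T (us @ (\<lambda>x. 0) # vs) = 0"
proof -
  have "0 \<in> dual_set sc" using is_vspace_closed(1)[OF is_vspace_dual[OF vs]] by simp
  from tensor_scale[OF this, of us 0 vs] show ?thesis
    by (simp add: fscale_def zero_fun_def)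
qed

lemma tensor_neg:
  assumes "f \<in> dual_set sc"
  shows "T (us @ (\<lambda>x. - f x) # vs) = - T (us @ f # vs)"
  using tensor_scale[OF assms, of us "-1" vs] by (simp add: fscale_def)

text \<open>With this, tensor equations need only be tested on lists of functionals of the right
  length. A bad list stays bad under \<open>tmap1\<close> unless the fault lies in slot
  \<open>l\<close>, and then the functional inserted there is zero.\<close>

lemma tmap1_vanish:
  assumes l: "l < n" and bad: "\<not> (length \<xi>s = n \<and> set \<xi>s \<subseteq> dual_set sc)"
  shows "tmap1 sc l f T \<xi>s = 0"
proof (cases "l < length \<xi>s \<and> \<xi>s ! l \<in> dual_set sc")
  case True
  let ?\<eta>s = "take l \<xi>s @ [\<lambda>x. elem_tensor sc [f x] (take 1 (drop l \<xi>s))] @ drop (l + 1) \<xi>s"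
  have e: "set \<xi>s = set (take l \<xi>s) \<union> {\<xi>s ! l} \<union> set (drop (l + 1) \<xi>s)"
    using True by (subst id_take_nth_drop[of l \<xi>s]) auto
  have "length ?\<eta>s = length \<xi>s" using True by auto
  moreover have "set ?\<eta>s \<subseteq> dual_set sc \<Longrightarrow> set \<xi>s \<subseteq> dual_set sc"
    unfolding e using True by simp
  ultimately have "\<not> (length ?\<eta>s = n \<and> set ?\<eta>s \<subseteq> dual_set sc)" using bad by auto
  then show ?thesis
    unfolding tmap1_def tmap_def by (rule tensor_vanish)
next
  case False
  have "elem_tensor sc [f x] (take 1 (drop l \<xi>s)) = 0" for x
  proof (rule elem_tensor_eq_0)
    show "\<not> (length (take 1 (drop l \<xi>s)) = length [f x] \<and> set (take 1 (drop l \<xi>s)) \<subseteq> dual_set sc)"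
    proof (cases "l < length \<xi>s")
      case True
      then have "take 1 (drop l \<xi>s) = [\<xi>s ! l]"
        by (metis One_nat_def take_Suc_Cons Cons_nth_drop_Suc take0)
      then show ?thesis using True False by simp
    qed simp
  qed
  then show ?thesis using tensor_zero by (simp add: tmap1_def tmap_def)
qed

end

lemma elem_tensor_single: "\<xi> \<in> dual_set sc \<Longrightarrow> elem_tensor sc [x] [\<xi>] = \<xi> x"
  by (simp add: elem_tensor_def)

lemma tmap1_eval2:
  assumes "a \<in> dual_set sc" "b \<in> dual_set sc"
  shows "tmap1 sc 0 f T [a, b] = T [\<lambda>x. a (f x), b]"
    and "tmap1 sc (Suc 0) f T [a, b] = T [a, \<lambda>x. b (f x)]"
  using assms by (simp_all add: tmap1_def tmap_def elem_tensor_single)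

lemma tmap1_eval3:
  assumes "a \<in> dual_set sc" "b \<in> dual_set sc" "c \<in> dual_set sc"
  shows "tmap1 sc 0 f T [a, b, c] = T [\<lambda>x. a (f x), b, c]"
    and "tmap1 sc (Suc 0) f T [a, b, c] = T [a, \<lambda>x. b (f x), c]"
    and "tmap1 sc 2 f T [a, b, c] = T [a, b, \<lambda>x. c (f x)]"
  using assms by (simp_all add: tmap1_def tmap_def elem_tensor_single numeral_2_eq_2)

lemma tensor_eqI:
  fixes S T :: "('k::field, 'a) tensor"
  assumes "\<And>\<xi>s. \<not> (length \<xi>s = n \<and> set \<xi>s \<subseteq> D) \<Longrightarrow> S \<xi>s = 0"
    and "\<And>\<xi>s. \<not> (length \<xi>s = n \<and> set \<xi>s \<subseteq> D) \<Longrightarrow> T \<xi>s = 0"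
    and "\<And>\<xi>s. \<lbrakk>length \<xi>s = n; set \<xi>s \<subseteq> D\<rbrakk> \<Longrightarrow> S \<xi>s = T \<xi>s"
  shows "S = T"
proof
  fix \<xi>s show "S \<xi>s = T \<xi>s"
    using assms by (cases "length \<xi>s = n \<and> set \<xi>s \<subseteq> D") auto
qed

lemma tensor2_eq_iff:
  fixes S T :: "('k::field, 'a) tensor"
  assumes "\<And>\<xi>s. \<not> (length \<xi>s = 2 \<and> set \<xi>s \<subseteq> D) \<Longrightarrow> S \<xi>s = 0"
    and "\<And>\<xi>s. \<not> (length \<xi>s = 2 \<and> set \<xi>s \<subseteq> D) \<Longrightarrow> T \<xi>s = 0"
  shows "S = T \<longleftrightarrow> (\<forall>a\<in>D. \<forall>b\<in>D. S [a, b] = T [a, b])"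
proof
  assume e: "\<forall>a\<in>D. \<forall>b\<in>D. S [a, b] = T [a, b]"
  show "S = T"
  proof (rule tensor_eqI[OF assms])
    fix \<xi>s :: "('a \<Rightarrow> 'k) list" assume "length \<xi>s = 2" and s: "set \<xi>s \<subseteq> D"
    then obtain a b where "\<xi>s = [a, b]"
      by (auto simp: numeral_2_eq_2 length_Suc_conv)
    then show "S \<xi>s = T \<xi>s" using e s by simp
  qed
qed simp

lemma tensor3_eq_iff:
  fixes S T :: "('k::field, 'a) tensor"
  assumes "\<And>\<xi>s. \<not> (length \<xi>s = 3 \<and> set \<xi>s \<subseteq> D) \<Longrightarrow> S \<xi>s = 0"
    and "\<And>\<xi>s. \<not> (length \<xi>s = 3 \<and> set \<xi>s \<subseteq> D) \<Longrightarrow> T \<xi>s = 0"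
  shows "S = T \<longleftrightarrow> (\<forall>a\<in>D. \<forall>b\<in>D. \<forall>c\<in>D. S [a, b, c] = T [a, b, c])"
proof
  assume e: "\<forall>a\<in>D. \<forall>b\<in>D. \<forall>c\<in>D. S [a, b, c] = T [a, b, c]"
  show "S = T"
  proof (rule tensor_eqI[OF assms])
    fix \<xi>s :: "('a \<Rightarrow> 'k) list" assume "length \<xi>s = 3" and s: "set \<xi>s \<subseteq> D"
    then obtain a b c where "\<xi>s = [a, b, c]"
      by (auto simp: numeral_3_eq_3 length_Suc_conv)
    then show "S \<xi>s = T \<xi>s" using e s by simp
  qed
qed simp

text \<open>A coalgebra axiom evaluated at functionals is the algebra axiom for the transposed
  operations. Linearity of \<open>\<Delta>\<close> and \<open>\<delta>\<close> makes the values
  functionals, and multilinearity of tensors makes the operations linear in each argument.\<close>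

lemma poisson_lie3_algebra_transpose:
  fixes sc :: "'k::field \<Rightarrow> 'a::ab_group_add \<Rightarrow> 'a"
  assumes "poisson_lie3_coalgebra sc \<Delta> \<delta>"
  shows "poisson_lie3_algebra (dual sc) (transpose2 \<Delta>) (transpose3 \<delta>)"
proof -
  let ?m = "transpose2 \<Delta>" and ?br = "transpose3 \<delta>"
  have ca: "cocomm_coassoc_coalgebra sc \<Delta>" and la: "lie3_coalgebra sc \<delta>"
    and po: "\<And>x. tmap 0 2 \<Delta> (\<delta> x) = tmap 1 3 \<delta> (\<Delta> x) + tswap 1 2 (tmap 1 3 \<delta> (\<Delta> x))"
    using assms by (auto simp: poisson_lie3_coalgebra_def)
  have vs: "vector_space sc" and lin2: "linear_on (whole sc) (tensor_power sc 2) \<Delta>"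
    and comm: "\<And>x. tswap 1 2 (\<Delta> x) = \<Delta> x"
    and coassoc: "\<And>x. tmap 0 2 \<Delta> (\<Delta> x) = tmap 1 2 \<Delta> (\<Delta> x)"
    using ca by (auto simp: cocomm_coassoc_coalgebra_def)
  have lin3: "linear_on (whole sc) (tensor_power sc 3) \<delta>"
    and skew: "skew3_on (dual_set sc) ?br"
    and cofi: "\<And>x. tmap 0 3 \<delta> (\<delta> x)
          + tswap 2 3 (tswap 1 2 (tmap 1 3 \<delta> (\<delta> x)))
          + tswap 1 3 (tswap 2 4 (tmap 2 3 \<delta> (\<delta> x)))
        = tmap 2 3 \<delta> (\<delta> x)"
    using la by (auto simp: lie3_coalgebra_def)
  note d = dual_set_iff[OF vs]
  have t2: "\<Delta> x \<in> vcarrier (tensor_power sc 2)" and t3: "\<delta> x \<in> vcarrier (tensor_power sc 3)" for x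
    using lin2 lin3 by (auto simp: linear_on_def)
  have m_dual: "?m a b \<in> dual_set sc" for a b
    using lin2 by (simp add: d linear_on_def transpose2_def tensor_power_def fscale_def)
  have br_dual: "?br a b c \<in> dual_set sc" for a b c
    using lin3 by (simp add: d linear_on_def transpose3_def tensor_power_def fscale_def)
  have m_bil: "bilinear_on (dual sc) (dual sc) (dual sc) ?m"
    using tensor_add[OF vs t2, where us = "[]"] tensor_add[OF vs t2, where us = "[a]" for a]
      tensor_scale[OF vs t2, where us = "[]"] tensor_scale[OF vs t2, where us = "[a]" for a] m_dual
    by (simp add: bilinear_on_def linear_on_def) (simp add: transpose2_def fun_eq_iff fscale_def)
  have br_tri: "trilinear_on (dual sc) (dual sc) (dual sc) (dual sc) ?br"
    using tensor_add[OF vs t3, where us = "[]"] tensor_add[OF vs t3, where us = "[a]" for a]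
      tensor_add[OF vs t3, where us = "[a, b]" for a b] tensor_scale[OF vs t3, where us = "[]"]
      tensor_scale[OF vs t3, where us = "[a]" for a]
        tensor_scale[OF vs t3, where us = "[a, b]" for a b] br_dual
    by (simp add: trilinear_on_def linear_on_def) (simp add: transpose3_def fun_eq_iff fscale_def)
  have m_comm: "?m a b = ?m b a" for a b
    using fun_cong[OF comm, of _ "[b, a]"] by (simp add: transpose2_def tswap_def)
  have m_assoc: "?m (?m a b) c = ?m a (?m b c)" for a b c
    using fun_cong[OF coassoc, of _ "[a, b, c]"]
    by (simp add: transpose2_def tmap_def numeral_2_eq_2)
  \<comment> \<open>The swaps turn \<open>[x1, x2, x3, x4, x5]\<close> into
    \<open>[x3, x1, x2, x4, x5]\<close> and into \<open>[x3, x4, x1, x2, x5]\<close>, which produces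
    the last two summands.\<close>
  have fi: "?br x1 x2 (?br x3 x4 x5) = ?br (?br x1 x2 x3) x4 x5 + ?br x3 (?br x1 x2 x4) x5
      + ?br x3 x4 (?br x1 x2 x5)" for x1 x2 x3 x4 x5
    using fun_cong[OF cofi, of _ "[x1, x2, x3, x4, x5]"]
    by (simp add: transpose3_def tmap_def tswap_def fun_eq_iff numeral_eq_Suc)
  have leib: "?br (?m w x) y z = ?m w (?br x y z) + ?m x (?br w y z)" for w x y z
    using fun_cong[OF po, of _ "[w, x, y, z]"]
    by (simp add: transpose3_def transpose2_def tmap_def tswap_def fun_eq_iff numeral_eq_Suc)
  show ?thesis
    unfolding poisson_lie3_algebra_def comm_assoc_algebra_def lie3_algebra_def
    by (intro conjI ballI is_vspace_dual[OF vs] m_bil br_tri m_comm m_assoc fi leib)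
       (simp add: skew)
qed

section \<open>Actions on the bidual and the evaluation pairing\<close>

lemma sum_fun_apply: "(\<Sum>i\<in>I. f i) x = (\<Sum>i\<in>I. f i x)"
  by (induction I rule: infinite_finite_induct) simp_all

text \<open>Finite dimension enters here: some vector represents the functional
  \<open>\<xi> \<mapsto> - F \<xi> x\<close> on the dual space. The coordinate functionals dictate
  its coordinates, which also yields the uniqueness behind \<open>THE\<close>.\<close>

lemma predual_act_eval:
  fixes sc :: "'k::field \<Rightarrow> 'a::ab_group_add \<Rightarrow> 'a"
  assumes fd: "finite_dimensional_vector_space sc Basis"
    and F: "linear_on (dual sc) (dual sc) F" and \<xi>: "\<xi> \<in> dual_set sc"
  shows "\<xi> (predual_act sc F x) = - F \<xi> x"
proof -
  interpret finite_dimensional_vector_space sc Basis by (rule fd)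
  note d = dual_set_iff[OF vector_space_axioms]
  have vsd: "is_vspace (dual sc)" by (rule is_vspace_dual) (rule vector_space_axioms)
  note D = is_vspace_closed[OF vsd, simplified] and L = linear_onD[OF F vsd, simplified]
  \<comment> \<open>The coordinate functionals, which form the dual basis.\<close>
  define e where "e b = (\<lambda>v. representation Basis v b)" for b
  have e: "e b \<in> dual_set sc" for b
    unfolding e_def dual_set_def using
      linear_representation[OF independent_Basis span_Basis] by simp
  have v: "(\<Sum>b\<in>Basis. sc (e b v) b) = v" for v
    unfolding e_def
    by (rule sum_representation_eq) (simp_all add: independent_Basis span_Basis finite_Basis)
  have lin_sum: "\<xi> (\<Sum>b\<in>I. sc (g b) b) = (\<Sum>b\<in>I. g b * \<xi> b)"
    if "\<xi> \<in> dual_set sc" "finite I" for \<xi> g I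
    using that(2)
  proof induction
    case empty
    then show ?case using that(1) unfolding d by (metis add_cancel_left_left sum.empty)
  next
    case (insert b I)
    then show ?case using that(1) by (simp add: d)
  qed
  have F_sum: "(\<Sum>b\<in>I. fscale (g b) (e b)) \<in> dual_set sc \<and>
      F (\<Sum>b\<in>I. fscale (g b) (e b)) = (\<Sum>b\<in>I. fscale (g b) (F (e b)))" if "finite I" for g I
    using that
  proof induction
    case empty
    then show ?case using D(1) L(3) by (simp add: zero_fun_def)
  next
    case (insert b I)
    then have "(\<Sum>b\<in>I. fscale (g b) (e b)) \<in> dual_set sc"
      and "F (\<Sum>b\<in>I. fscale (g b) (e b)) = (\<Sum>b\<in>I. fscale (g b) (F (e b)))" by blast+
    moreover have "fscale (g b) (e b) \<in> dual_set sc" by (rule D(5)[OF e])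
    ultimately show ?case
      unfolding sum.insert[OF insert.hyps]
      using L(2)[of "fscale (g b) (e b)" "\<Sum>b\<in>I. fscale (g b) (e b)"] L(6)[OF e[of b], of "g b"]
      by (simp only: D(2) simp_thms)
  qed
  \<comment> \<open>Testing the required equation on \<open>e b\<close> shows that the coordinate at
    \<open>b\<close> can only be \<open>- F (e b) x\<close>.\<close>
  define y where "y = (\<Sum>b\<in>Basis. sc (- F (e b) x) b)"
  have y: "\<eta> y = - F \<eta> x" if \<eta>: "\<eta> \<in> dual_set sc" for \<eta>
  proof -
    \<comment> \<open>Expanding the functional in the dual basis reduces the claim to the values
      \<open>F (e b)\<close>.\<close>
    have "\<eta> = (\<Sum>b\<in>Basis. fscale (\<eta> b) (e b))"
    proof
      fix v
      have "\<eta> v = \<eta> (\<Sum>b\<in>Basis. sc (e b v) b)" by (simp add: v)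
      also have "\<dots> = (\<Sum>b\<in>Basis. fscale (\<eta> b) (e b)) v"
        by (simp add: lin_sum[OF \<eta> finite_Basis] fscale_def mult.commute sum_fun_apply)
      finally show "\<eta> v = (\<Sum>b\<in>Basis. fscale (\<eta> b) (e b)) v" .
    qed
    then have "F \<eta> = (\<Sum>b\<in>Basis. fscale (\<eta> b) (F (e b)))"
      using F_sum[OF finite_Basis, of \<eta>] by simp
    then have "F \<eta> x = (\<Sum>b\<in>Basis. \<eta> b * F (e b) x)"
      by (simp add: sum_fun_apply fscale_def)
    then show ?thesis
      unfolding y_def lin_sum[OF \<eta> finite_Basis] by (simp add: sum_negf mult.commute)
  qed
  have "predual_act sc F x = y"
    unfolding predual_act_def
  proof (rule the_equality)
    show "\<forall>\<xi>\<in>dual_set sc. \<xi> y = - F \<xi> x" using y by blast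
    fix y' assume y': "\<forall>\<xi>\<in>dual_set sc. \<xi> y' = - F \<xi> x"
    then have "e b y' = e b y" for b using e y by simp
    then show "y' = y" using v[of y] v[of y'] by simp
  qed
  then show ?thesis using y[OF \<xi>] by simp
qed

lemma std_mult_eq_double:
  "std_mult sc m m' = double_mult m m' (\<lambda>x \<xi>. - dual_act (m x) \<xi>) (\<lambda>\<xi> x. - predual_act sc (m' \<xi>) x)"
  by (auto simp: std_mult_def double_mult_def fun_eq_iff)

lemma std_bracket_eq_double:
  "std_bracket sc br br'
    = double_bracket br br' (\<lambda>x y. dual_act (br x y)) (\<lambda>\<xi> \<eta>. predual_act sc (br' \<xi> \<eta>))"
  by (auto simp: std_bracket_def double_bracket_def fun_eq_iff)

lemma std_form_eq_double: "std_form = double_form (\<lambda>x \<xi>. \<xi> x)"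
  by (auto simp: std_form_def double_form_def fun_eq_iff)

text \<open>Evaluation is a perfect pairing because the coordinate functionals separate vectors and
  a function is determined by its values. In the two multiplicative actions the explicit minus
  cancels the one built into \<open>dual_act\<close> and \<open>predual_act\<close>.\<close>

lemma poisson_pairing_dual:
  fixes sc :: "'k::field \<Rightarrow> 'a::ab_group_add \<Rightarrow> 'a"
  assumes fd: "finite_dimensional_vector_space sc Basis"
    and alg: "poisson_lie3_algebra (whole sc) m br"
    and dalg: "poisson_lie3_algebra (dual sc) m' br'"
  shows "poisson_pairing (whole sc) (dual sc) (\<lambda>x \<xi>. \<xi> x) m br m' br'
    (\<lambda>x y. dual_act (br x y)) (\<lambda>x \<xi>. - dual_act (m x) \<xi>)
    (\<lambda>\<xi> \<eta>. predual_act sc (br' \<xi> \<eta>)) (\<lambda>\<xi> x. - predual_act sc (m' \<xi>) x)"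
proof -
  interpret finite_dimensional_vector_space sc Basis by (rule fd)
  note d = dual_set_iff[OF vector_space_axioms]
  have bil: "bilinear_on (whole sc) (whole sc) (whole sc) m"
    and tri: "trilinear_on (whole sc) (whole sc) (whole sc) (whole sc) br"
    and dbil: "bilinear_on (dual sc) (dual sc) (dual sc) m'"
    and dtri: "trilinear_on (dual sc) (dual sc) (dual sc) (dual sc) br'"
    using alg dalg
    by (simp_all add: poisson_lie3_algebra_def comm_assoc_algebra_def lie3_algebra_def)
  note w = is_vspace_whole[OF vector_space_axioms]
  have neg: "\<xi> (- v) = - \<xi> v" if "\<xi> \<in> dual_set sc" for \<xi> v
  proof -
    have add: "\<xi> (x + y) = \<xi> x + \<xi> y" for x y using that by (simp add: d)
    have "\<xi> (sc 0 0) = 0 * \<xi> 0" using that unfolding d by blast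
    then have "\<xi> 0 = 0" by simp
    then show ?thesis using add[of "- v" v] by (simp add: eq_neg_iff_add_eq_0)
  qed
  show ?thesis
  proof
    show "bilinear_on (whole sc) (dual sc) scalars (\<lambda>x \<xi>. \<xi> x)"
      by (simp add: bilinear_on_def linear_on_def d fscale_def)
    show "x = 0" if "\<And>b. b \<in> vcarrier (dual sc) \<Longrightarrow> b x = 0" for x
    proof -
      have "(\<lambda>v. representation Basis v b) \<in> dual_set sc" for b
        unfolding dual_set_def using linear_representation[OF independent_Basis span_Basis] by simp
      then have "representation Basis x b = 0" for b
        using that[of "\<lambda>v. representation Basis v b"] by simp
      then show ?thesis
        using sum_representation_eq[of Basis x Basis]
        by (simp add: independent_Basis span_Basis finite_Basis)
    qed
    show "b = 0" if "\<And>x. x \<in> vcarrier (whole sc) \<Longrightarrow> b x = 0" for b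
      using that by (simp add: fun_eq_iff)
    show "dual_act (br x y) b \<in> vcarrier (dual sc)" if "b \<in> vcarrier (dual sc)" for x y b
      using that linear_onD(2,6)[OF trilinear_onD(3)[OF tri] w]
      by (simp add: d dual_act_def)
    show "- dual_act (m x) b \<in> vcarrier (dual sc)" if "b \<in> vcarrier (dual sc)" for x b
      using that linear_onD(2,6)[OF bilinear_onD(2)[OF bil] w]
      by (simp add: d dual_act_def)
    show "predual_act sc (br' a b) x \<in> vcarrier (whole sc)" for a b x by simp
    show "- predual_act sc (m' a) x \<in> vcarrier (whole sc)" for a x by simp
    show "dual_act (br x y) b z = - b (br x y z)" for x y z b by (simp add: dual_act_def)
    show "(- dual_act (m x) b) z = b (m x z)" for x z b by (simp add: dual_act_def)
    show "c (predual_act sc (br' a b) x) = - br' a b c x"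
      if "a \<in> vcarrier (dual sc)" "b \<in> vcarrier (dual sc)" "c \<in> vcarrier (dual sc)" for a b c x
      using predual_act_eval[OF fd trilinear_onD(3)[OF dtri, of a b], of c x] that by simp
    show "c (- predual_act sc (m' a) x) = m' a c x"
      if "a \<in> vcarrier (dual sc)" "c \<in> vcarrier (dual sc)" for a c x
      using predual_act_eval[OF fd bilinear_onD(2)[OF dbil, of a], of c x] that by (simp add: neg)
  qed (rule alg dalg)+
qed

text \<open>The tensors compared here agree once they agree on all lists of functionals of the right
  length, and on such lists \<open>tmap1\<close> replaces a functional by its composite with the
  operator. Up to sign these composites are the dual actions, so the seven tensor equations become
  the seven scalar identities.\<close>

lemma double_bialgebra_iff_compatible:
  fixes sc :: "'k::field \<Rightarrow> 'a::ab_group_add \<Rightarrow> 'a"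
  assumes alg: "poisson_lie3_algebra (whole sc) m br"
    and coalg: "poisson_lie3_coalgebra sc \<Delta> \<delta>"
  shows "double_poisson_lie3_bialgebra sc m br \<Delta> \<delta> \<longleftrightarrow>
    pairing_compatible (whole sc) (dual sc) (\<lambda>x \<xi>. \<xi> x) m br (transpose2 \<Delta>) (transpose3 \<delta>)
      (\<lambda>x y. dual_act (br x y)) (\<lambda>x \<xi>. - dual_act (m x) \<xi>)"
proof -
  have ca: "cocomm_coassoc_coalgebra sc \<Delta>" and la: "lie3_coalgebra sc \<delta>"
    using coalg by (simp_all add: poisson_lie3_coalgebra_def)
  have vs: "vector_space sc" and "linear_on (whole sc) (tensor_power sc 2) \<Delta>"
    "linear_on (whole sc) (tensor_power sc 3) \<delta>"
    using ca la by (simp_all add: cocomm_coassoc_coalgebra_def lie3_coalgebra_def)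
  then have t2: "\<Delta> x \<in> vcarrier (tensor_power sc 2)" and t3: "\<delta> x \<in> vcarrier (tensor_power sc 3)"
    for x
    by (auto simp: linear_on_def)
  note w = is_vspace_whole[OF vs]
  have calg: "comm_assoc_algebra (whole sc) m" and lalg: "lie3_algebra (whole sc) br"
    using alg by (simp_all add: poisson_lie3_algebra_def)
  then have tri: "trilinear_on (whole sc) (whole sc) (whole sc) (whole sc) br"
    by (simp add: lie3_algebra_def)
  let ?D = "dual_set sc"
  have br_dual: "(\<lambda>v. b (br x y v)) \<in> ?D" if "b \<in> ?D" for b x y
    using that linear_onD(2,6)[OF trilinear_onD(3)[OF tri] w] by (simp add: dual_set_iff[OF vs])
  have da: "dual_act (br x y) b = (\<lambda>v. - b (br x y v))" for x y b
    by (simp add: dual_act_def)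
  have ma: "- dual_act (m x) b = (\<lambda>v. b (m x v))" for x b
    by (simp add: dual_act_def fun_eq_iff)
  have v2: "\<not> (length \<xi>s = 2 \<and> set \<xi>s \<subseteq> ?D) \<Longrightarrow> \<Delta> x \<xi>s = 0"
    and v3: "\<not> (length \<xi>s = 3 \<and> set \<xi>s \<subseteq> ?D) \<Longrightarrow> \<delta> x \<xi>s = 0" for x \<xi>s
    using tensor_vanish[OF vs t2] tensor_vanish[OF vs t3] by blast+
  have w2: "\<not> (length \<xi>s = 2 \<and> set \<xi>s \<subseteq> ?D) \<Longrightarrow> l < 2 \<Longrightarrow> tmap1 sc l f (\<Delta> x) \<xi>s = 0"
    and w3: "\<not> (length \<xi>s = 3 \<and> set \<xi>s \<subseteq> ?D) \<Longrightarrow> l < 3 \<Longrightarrow> tmap1 sc l f (\<delta> x) \<xi>s = 0" for x \<xi>s l f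
    using tmap1_vanish[OF vs t2] tmap1_vanish[OF vs t3] by blast+
  \<comment> \<open>The dual of a bracket operator carries a minus sign, which multilinearity pulls
    out of whichever slot it occupies.\<close>
  have n2: "\<Delta> x [\<lambda>v. - b (br y z v), a] = - \<Delta> x [\<lambda>v. b (br y z v), a]"
    "\<Delta> x [a, \<lambda>v. - b (br y z v)] = - \<Delta> x [a, \<lambda>v. b (br y z v)]"
    if "b \<in> ?D" for x y z a b
    using tensor_neg[OF vs t2 br_dual[OF that], where us = "[]"]
      tensor_neg[OF vs t2 br_dual[OF that], where us = "[a]" and vs = "[]"] by simp_all
  have n3: "\<delta> x [\<lambda>v. - b (br y z v), a, c] = - \<delta> x [\<lambda>v. b (br y z v), a, c]"
    "\<delta> x [a, \<lambda>v. - b (br y z v), c] = - \<delta> x [a, \<lambda>v. b (br y z v), c]"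
    "\<delta> x [a, c, \<lambda>v. - b (br y z v)] = - \<delta> x [a, c, \<lambda>v. b (br y z v)]"
    if "b \<in> ?D" for x y z a b c
    using tensor_neg[OF vs t3 br_dual[OF that], where us = "[]"]
      tensor_neg[OF vs t3 br_dual[OF that], where us = "[a]" and vs = "[c]"]
      tensor_neg[OF vs t3 br_dual[OF that], where us = "[a, c]" and vs = "[]"] by simp_all
  note E2 = tensor2_eq_iff[of ?D] and E3 = tensor3_eq_iff[of ?D]
  have 1: "\<Delta> (m x y) = tmap1 sc 0 (m x) (\<Delta> y) + tmap1 sc 1 (m y) (\<Delta> x) \<longleftrightarrow>
     (\<forall>a\<in>?D. \<forall>b\<in>?D. \<Delta> (m x y) [a, b] = \<Delta> y [\<lambda>v. a (m x v), b] + \<Delta> x [a, \<lambda>v. b (m y v)])" for x y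
    by (subst E2) (simp_all add: v2 w2 tmap1_eval2)
  have 2: "\<delta> (br x y z)
    = tmap1 sc 2 (br y z) (\<delta> x) + tmap1 sc 2 (br z x) (\<delta> y) + tmap1 sc 2 (br x y) (\<delta> z)
     \<longleftrightarrow> (\<forall>a\<in>?D. \<forall>b\<in>?D. \<forall>c\<in>?D. \<delta> (br x y z) [a, b, c] = \<delta> x [a, b, \<lambda>v. c (br y z v)]
        + \<delta> y [a, b, \<lambda>v. c (br z x v)] + \<delta> z [a, b, \<lambda>v. c (br x y v)])" for x y z
    by (subst E3) (simp_all add: v3 w3 tmap1_eval3)
  have 3: "\<delta> (br x y z)
    = tmap1 sc 2 (br y z) (\<delta> x) + tmap1 sc 1 (br y z) (\<delta> x) + tmap1 sc 0 (br y z) (\<delta> x)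
     \<longleftrightarrow> (\<forall>a\<in>?D. \<forall>b\<in>?D. \<forall>c\<in>?D. \<delta> (br x y z) [a, b, c] = \<delta> x [a, b, \<lambda>v. c (br y z v)]
        + \<delta> x [a, \<lambda>v. b (br y z v), c] + \<delta> x [\<lambda>v. a (br y z v), b, c])" for x y z
    by (subst E3) (simp_all add: v3 w3 tmap1_eval3)
  have 4: "\<Delta> (br x y z) = tmap1 sc 1 (br y z) (\<Delta> x) + tmap1 sc 0 (br y z) (\<Delta> x) \<longleftrightarrow>
     (\<forall>a\<in>?D. \<forall>b\<in>?D. \<Delta> (br x y z) [a, b] = \<Delta> x [a, \<lambda>v. b (br y z v)] + \<Delta> x [\<lambda>v. a (br y z v), b])"
    for x y z
    by (subst E2) (simp_all add: v2 w2 tmap1_eval2)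
  have 5: "\<delta> (m x y) = tmap1 sc 0 (m y) (\<delta> x) + tmap1 sc 0 (m x) (\<delta> y) \<longleftrightarrow>
     (\<forall>a\<in>?D. \<forall>b\<in>?D. \<forall>c\<in>?D. \<delta> (m x y) [a, b, c] = \<delta> x [\<lambda>v. a (m y v), b, c]
        + \<delta> y [\<lambda>v. a (m x v), b, c])" for x y
    by (subst E3) (simp_all add: v3 w3 tmap1_eval3)
  have 6: "tmap1 sc 0 (m x) (\<delta> y) = tmap1 sc 2 (m x) (\<delta> y) \<longleftrightarrow>
     (\<forall>a\<in>?D. \<forall>b\<in>?D. \<forall>c\<in>?D. \<delta> y [\<lambda>v. a (m x v), b, c] = \<delta> y [a, b, \<lambda>v. c (m x v)])" for x y
    by (subst E3) (simp_all add: v3 w3 tmap1_eval3)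
  have 7: "tmap1 sc 1 (br x y) (\<Delta> z) = tmap1 sc 1 (br y z) (\<Delta> x) \<longleftrightarrow>
     (\<forall>a\<in>?D. \<forall>b\<in>?D. \<Delta> z [a, \<lambda>v. b (br x y v)] = \<Delta> x [a, \<lambda>v. b (br y z v)])" for x y z
    by (subst E2) (simp_all add: v2 w2 tmap1_eval2)
  \<comment> \<open>\<open>pairing_compatible\<close> quantifies every identity over three
    functionals. Since functionals exist, the surplus quantifier can be removed from those
    identities that contain only two.\<close>
  have "?D \<noteq> {}"
    using is_vspace_closed(1)[OF is_vspace_dual[OF vs]] by auto
  then show ?thesis
    unfolding double_poisson_lie3_bialgebra_def double_lie3_bialgebra_def
      comm_cocomm_infinitesimal_bialgebra_def 1 2 3 4 5 6 7
      pairing_compatible_def transpose2_def transpose3_def da ma whole_simps dual_simps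
    using alg coalg ca la calg lalg
    by (simp add: n2 n3 ball_conj_distrib all_conj_distrib add_ac diff_diff_eq2 ex_in_conv)
       (intro iffI; elim conjE; intro conjI; assumption)
qed

theorem theorem4p27:
  fixes scale :: "'k::field_char_0 \<Rightarrow> 'a::ab_group_add \<Rightarrow> 'a"
    and Basis :: "'a set"
    and mult :: "'a \<Rightarrow> 'a \<Rightarrow> 'a"
    and bracket :: "'a \<Rightarrow> 'a \<Rightarrow> 'a \<Rightarrow> 'a"
    and \<Delta> \<delta> :: "'a \<Rightarrow> ('k, 'a) tensor"
  assumes "finite_dimensional_vector_space scale Basis"
    and "poisson_lie3_algebra (whole scale) mult bracket"
    and "poisson_lie3_coalgebra scale \<Delta> \<delta>"
  shows
    "(double_poisson_lie3_bialgebra scale mult bracket \<Delta> \<delta> \<longleftrightarrow>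
      poisson_lie3_matched_pair
        (whole scale) mult bracket (dual scale) (transpose2 \<Delta>) (transpose3 \<delta>)
        (\<lambda>x y. dual_act (bracket x y)) (\<lambda>x \<xi>. - dual_act (mult x) \<xi>)
        (\<lambda>\<xi> \<eta>. predual_act scale (transpose3 \<delta> \<xi> \<eta>))
        (\<lambda>\<xi> x. - predual_act scale (transpose2 \<Delta> \<xi>) x))
     \<and>
     (poisson_lie3_matched_pair
        (whole scale) mult bracket (dual scale) (transpose2 \<Delta>) (transpose3 \<delta>)
        (\<lambda>x y. dual_act (bracket x y)) (\<lambda>x \<xi>. - dual_act (mult x) \<xi>)
        (\<lambda>\<xi> \<eta>. predual_act scale (transpose3 \<delta> \<xi> \<eta>))
        (\<lambda>\<xi> x. - predual_act scale (transpose2 \<Delta> \<xi>) x)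
      \<longleftrightarrow> std_manin_triple scale mult bracket (transpose2 \<Delta>) (transpose3 \<delta>))"
proof -
  \<comment> \<open>In the instance given by the space and its dual, the bialgebra, the matched pair
    and the Manin triple all reduce to the same \<open>pairing_compatible\<close>.\<close>
  note P = poisson_pairing_dual[OF assms(1,2) poisson_lie3_algebra_transpose[OF assms(3)]]
  show ?thesis
    unfolding std_manin_triple_def std_mult_eq_double std_bracket_eq_double std_form_eq_double
      double_bialgebra_iff_compatible[OF assms(2,3)]
      poisson_pairing.matched_pair_iff_compatible[OF P]
      poisson_pairing.manin_triple_iff_compatible[OF P, unfolded whole_simps dual_simps]
    by simp
qed

end
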